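(* Let $n\ge m>0$ and let $E_D:\{0,1\}^n\times\{0,1\}^n\to\{0,1\}^m$ be the DEOR-extractor, $E_D(x,y)=(A_1x\cdot y,\dots,A_mx\cdot y)$, where $A_1,\dots,A_m$ are $n\times n$ matrices over $GF(2)$ such that $\sum_{i\in S}A_i$ has full rank for every nonempty $S\subseteq[m]$. (a) (entangled) If $k_1+k_2-2b_2\ge 2m+n-2+2\log\varepsilon^{-1}$, then $E_D$ is a $(k_1,k_2,\varepsilon)$ X-strong extractor against $(b_1,b_2)$ entangled quantum storage. (b) (non-entangled) If $k_1+k_2-b_2\ge 2m+n-2+2\log\varepsilon^{-1}$, then $E_D$ is a $(k_1,k_2,\varepsilon)$ X-strong extractor against $(b_1,b_2)$ non-entangled quantum storage.
   Context: Logarithms are base 2. $x\cdot y=\sum_jx_jy_j\bmod2$. For a matrix $A$, $|A|_{\mathrm{tr}}=\frac12\mathrm{Tr}\sqrt{A^\dagger A}$. $U_m$ is the uniform distribution on $\{0,1\}^m$ (identified with the maximally mixed state). A source $X$ on $\{0,1\}^n$ has min-entropy (at least) $k$ if $\Pr[X=x]\le2^{-k}$ for all $x$. Storage: for independent sources $X,Y$, a $(b_1,b_2)$ entangled storage is a family of states $\rho_{xy}$ generated by two non-communicating parties as follows. Alice and Bob share an arbitrary entangled state; Alice receives $x$, Bob receives $y$; each applies any quantum operation (depending on the own input) to the own qubits; Alice then stores $b_1$ of her qubits and discards the rest, Bob stores $b_2$ of his qubits and discards the rest; $\rho_{xy}$ is the resulting joint state. The storage is $(b_1,b_2)$ non-entangled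 if $\rho_{xy}=\rho_x\otimes\rho_y$ for all $x,y$, with $\rho_x$ on $b_1$ qubits and $\rho_y$ on $b_2$ qubits. $E:\{0,1\}^n\times\{0,1\}^n\to\{0,1\}^m$ is a $(k_1,k_2,\varepsilon)$ X-strong extractor against $(b_1,b_2)$ entangled (resp. non-entangled) quantum storage if for all independent $n$-bit sources $X,Y$ with min-entropies $k_1,k_2$ and every $(b_1,b_2)$ entangled (resp. non-entangled) storage $\rho_{XY}$, $$\Big|\sum_{x,y}p(x)p(y)\,|E(x,y)\rangle\langle E(x,y)|\otimes\rho_{xy}\otimes|x\rangle\langle x|-U_m\otimes\sum_{x,y}p(x)p(y)\,\rho_{xy}\otimes|x\rangle\langle x|\Big|_{\mathrm{tr}}\le\varepsilon .$$ *)

theory Defs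
  imports
    "HOL-Library.Z2"
    "HOL-Probability.Probability_Mass_Function"
    "Jordan_Normal_Form.Schur_Decomposition"
    "Jordan_Normal_Form.DL_Rank"
begin

(* HOL-Analysis and Jordan_Normal_Form both use "$" and the bullet; only the latter is meant here. *)
unbundle no vec_syntax and no inner_syntax

hide_type (open) Finite_Cartesian_Product.vec
hide_const (open) Finite_Cartesian_Product.vec Finite_Cartesian_Product.mat
  Finite_Cartesian_Product.row


section \<open>Matrices\<close>

text \<open>Jordan_Normal_Form matrices of all dimensions share one type, which therefore has no
  zero; finite sums carry the dimensions \<open>r\<close>, \<open>c\<close> of their summands.\<close>

definition msum :: "nat \<Rightarrow> nat \<Rightarrow> ('i \<Rightarrow> 'a::comm_monoid_add mat) \<Rightarrow> 'i set \<Rightarrow> 'a mat" where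
  "msum r c f I = mat r c (\<lambda>(i, j). \<Sum>s\<in>I. f s $$ (i, j))"

definition mtrace :: "'a::comm_monoid_add mat \<Rightarrow> 'a" where
  "mtrace M = (\<Sum>i<dim_row M. M $$ (i, i))"

definition kronecker :: "'a::times mat \<Rightarrow> 'a mat \<Rightarrow> 'a mat" (infixr "\<otimes>\<^sub>m" 72) where
  "M \<otimes>\<^sub>m N = mat (dim_row M * dim_row N) (dim_col M * dim_col N)
     (\<lambda>(i, j). M $$ (i div dim_row N, j div dim_col N) * N $$ (i mod dim_row N, j mod dim_col N))"

text \<open>The matrix unit \<open>|i\<rangle>\<langle>j|\<close>.\<close>

definition mat_unit :: "nat \<Rightarrow> nat \<Rightarrow> nat \<Rightarrow> complex mat" where
  "mat_unit d i j = mat d d (\<lambda>(a, b). if a = i \<and> b = j then 1 else 0)"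

text \<open>The order on \<open>complex\<close> is the one of \<open>Complex_Order\<close>: \<open>0 \<le> z\<close> means that \<open>z\<close> is real and
  nonnegative, so \<open>psd\<close> includes being Hermitian.\<close>

definition psd :: "nat \<Rightarrow> complex mat \<Rightarrow> bool" where
  "psd d M \<longleftrightarrow> M \<in> carrier_mat d d \<and> (\<forall>v\<in>carrier_vec d. 0 \<le> (M *\<^sub>v v) \<bullet>c v)"

definition psd_sqrt :: "complex mat \<Rightarrow> complex mat" where
  "psd_sqrt M = (THE B. psd (dim_row M) B \<and> B * B = M)"

text \<open>Note the normalising factor \<open>1/2\<close>.\<close>

definition trace_norm :: "complex mat \<Rightarrow> real" where
  "trace_norm M = 1 / 2 * Re (mtrace (psd_sqrt (mat_adjoint M * M)))"


section \<open>Quantum states and operations\<close>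

definition density :: "nat \<Rightarrow> complex mat \<Rightarrow> bool" where
  "density d \<rho> \<longleftrightarrow> psd d \<rho> \<and> mtrace \<rho> = 1"

text \<open>\<open>\<Phi> \<otimes> \<Psi>\<close> for linear maps \<open>\<Phi>\<close> from \<open>dA \<times> dA\<close> to \<open>eA \<times> eA\<close> matrices and \<open>\<Psi>\<close> from \<open>dB \<times> dB\<close>
  to \<open>eB \<times> eB\<close> matrices, obtained by expanding the argument in the basis
  \<open>|i\<rangle>\<langle>j| \<otimes> |k\<rangle>\<langle>l|\<close>.\<close>

definition tensor_map :: "nat \<Rightarrow> nat \<Rightarrow> nat \<Rightarrow> nat \<Rightarrow> (complex mat \<Rightarrow> complex mat) \<Rightarrow>
    (complex mat \<Rightarrow> complex mat) \<Rightarrow> complex mat \<Rightarrow> complex mat" where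
  "tensor_map dA dB eA eB \<Phi> \<Psi> M = msum (eA * eB) (eA * eB)
     (\<lambda>((i, j), (k, l)). M $$ (i * dB + k, j * dB + l) \<cdot>\<^sub>m
        (\<Phi> (mat_unit dA i j) \<otimes>\<^sub>m \<Psi> (mat_unit dB k l)))
     (({..<dA} \<times> {..<dA}) \<times> ({..<dB} \<times> {..<dB}))"

definition linear_mat_map :: "nat \<Rightarrow> nat \<Rightarrow> (complex mat \<Rightarrow> complex mat) \<Rightarrow> bool" where
  "linear_mat_map d e \<Phi> \<longleftrightarrow>
     (\<forall>M\<in>carrier_mat d d. \<Phi> M \<in> carrier_mat e e) \<and>
     (\<forall>M\<in>carrier_mat d d. \<forall>N\<in>carrier_mat d d. \<Phi> (M + N) = \<Phi> M + \<Phi> N) \<and>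
     (\<forall>c. \<forall>M\<in>carrier_mat d d. \<Phi> (c \<cdot>\<^sub>m M) = c \<cdot>\<^sub>m \<Phi> M)"

definition completely_positive :: "nat \<Rightarrow> nat \<Rightarrow> (complex mat \<Rightarrow> complex mat) \<Rightarrow> bool" where
  "completely_positive d e \<Phi> \<longleftrightarrow>
     (\<forall>r M. psd (r * d) M \<longrightarrow> psd (r * e) (tensor_map r d r e (\<lambda>N. N) \<Phi> M))"

definition quantum_operation :: "nat \<Rightarrow> nat \<Rightarrow> (complex mat \<Rightarrow> complex mat) \<Rightarrow> bool" where
  "quantum_operation d e \<Phi> \<longleftrightarrow> linear_mat_map d e \<Phi> \<and> completely_positive d e \<Phi> \<and>
     (\<forall>M\<in>carrier_mat d d. mtrace (\<Phi> M) = mtrace M)"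

text \<open>Partial trace over the second factor of a \<open>d * e\<close> dimensional space.\<close>

definition discard_snd :: "nat \<Rightarrow> nat \<Rightarrow> complex mat \<Rightarrow> complex mat" where
  "discard_snd d e M = mat d d (\<lambda>(i, j). \<Sum>k<e. M $$ (i * e + k, j * e + k))"

text \<open>Position of \<open>|x\<rangle> = |x\<^sub>0\<rangle> \<otimes> |x\<^sub>1\<rangle> \<otimes> \<dots>\<close> in the computational basis: the first bit
  is the most significant one, in accordance with \<open>kronecker\<close>.\<close>

definition bits_index :: "bit vec \<Rightarrow> nat" where
  "bits_index x = (\<Sum>i<dim_vec x. of_bool (x $ i = 1) * 2 ^ (dim_vec x - 1 - i))"

text \<open>The projector \<open>|x\<rangle>\<langle>x|\<close>.\<close>

definition ketbra :: "bit vec \<Rightarrow> complex mat" where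
  "ketbra x = mat_unit (2 ^ dim_vec x) (bits_index x) (bits_index x)"

definition maximally_mixed :: "nat \<Rightarrow> complex mat" where
  "maximally_mixed m = (1 / 2 ^ m) \<cdot>\<^sub>m 1\<^sub>m (2 ^ m)"


section \<open>Sources, storage and extractors\<close>

definition source :: "nat \<Rightarrow> real \<Rightarrow> bit vec pmf \<Rightarrow> bool" where
  "source n k X \<longleftrightarrow> set_pmf X \<subseteq> carrier_vec n \<and> (\<forall>x. pmf X x \<le> 2 powr (- k))"

text \<open>Alice and Bob share \<open>\<sigma>\<close>, of which they hold \<open>a1\<close> and \<open>a2\<close> qubits. Their local operations
  yield \<open>b1 + c1\<close> and \<open>b2 + c2\<close> qubits, of which the last \<open>c1\<close> and \<open>c2\<close> are discarded. Storing the
  first \<open>b1\<close> and \<open>b2\<close> qubits is no restriction, as the operations may permute qubits.\<close>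

definition entangled_storage :: "nat \<Rightarrow> nat \<Rightarrow> nat \<Rightarrow> (bit vec \<Rightarrow> bit vec \<Rightarrow> complex mat) \<Rightarrow> bool" where
  "entangled_storage n b1 b2 \<rho> \<longleftrightarrow>
     (\<exists>a1 a2 c1 c2 \<sigma> \<Phi> \<Psi>.
        density (2 ^ a1 * 2 ^ a2) \<sigma> \<and>
        (\<forall>x\<in>carrier_vec n. quantum_operation (2 ^ a1) (2 ^ (b1 + c1)) (\<Phi> x)) \<and>
        (\<forall>y\<in>carrier_vec n. quantum_operation (2 ^ a2) (2 ^ (b2 + c2)) (\<Psi> y)) \<and>
        (\<forall>x\<in>carrier_vec n. \<forall>y\<in>carrier_vec n.
           \<rho> x y =
             tensor_map (2 ^ (b1 + c1)) (2 ^ (b2 + c2)) (2 ^ b1) (2 ^ b2)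
               (discard_snd (2 ^ b1) (2 ^ c1)) (discard_snd (2 ^ b2) (2 ^ c2))
               (tensor_map (2 ^ a1) (2 ^ a2) (2 ^ (b1 + c1)) (2 ^ (b2 + c2)) (\<Phi> x) (\<Psi> y) \<sigma>)))"

text \<open>Families of product states can be prepared locally, so they are not required to be an
  \<open>entangled_storage\<close>.\<close>

definition nonentangled_storage :: "nat \<Rightarrow> nat \<Rightarrow> nat \<Rightarrow> (bit vec \<Rightarrow> bit vec \<Rightarrow> complex mat) \<Rightarrow> bool" where
  "nonentangled_storage n b1 b2 \<rho> \<longleftrightarrow>
     (\<exists>\<rho>A \<rho>B. (\<forall>x\<in>carrier_vec n. density (2 ^ b1) (\<rho>A x)) \<and>
              (\<forall>y\<in>carrier_vec n. density (2 ^ b2) (\<rho>B y)) \<and>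
              (\<forall>x\<in>carrier_vec n. \<forall>y\<in>carrier_vec n. \<rho> x y = \<rho>A x \<otimes>\<^sub>m \<rho>B y))"

text \<open>The parameter \<open>storage\<close> is \<open>entangled_storage\<close> or \<open>nonentangled_storage\<close>. The registers are,
  in this order, the output of \<open>E\<close>, the storage, and the copy of \<open>x\<close>.\<close>

definition x_strong_extractor ::
    "(nat \<Rightarrow> nat \<Rightarrow> nat \<Rightarrow> (bit vec \<Rightarrow> bit vec \<Rightarrow> complex mat) \<Rightarrow> bool) \<Rightarrow> nat \<Rightarrow> nat \<Rightarrow> nat \<Rightarrow> nat \<Rightarrow>
     real \<Rightarrow> real \<Rightarrow> real \<Rightarrow> (bit vec \<Rightarrow> bit vec \<Rightarrow> bit vec) \<Rightarrow> bool" where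
  "x_strong_extractor storage b1 b2 n m k1 k2 \<epsilon> E \<longleftrightarrow>
     (\<forall>x\<in>carrier_vec n. \<forall>y\<in>carrier_vec n. E x y \<in> carrier_vec m) \<and>
     (\<forall>X Y \<rho>. source n k1 X \<longrightarrow> source n k2 Y \<longrightarrow> storage n b1 b2 \<rho> \<longrightarrow>
        (let d = 2 ^ (b1 + b2) * 2 ^ n;
             p = (\<lambda>x y. complex_of_real (pmf X x * pmf Y y));
             I = carrier_vec n \<times> carrier_vec n
         in trace_norm
              (msum (2 ^ m * d) (2 ^ m * d)
                 (\<lambda>(x, y). p x y \<cdot>\<^sub>m (ketbra (E x y) \<otimes>\<^sub>m \<rho> x y \<otimes>\<^sub>m ketbra x)) I
               - maximally_mixed m \<otimes>\<^sub>m
                 msum d d (\<lambda>(x, y). p x y \<cdot>\<^sub>m (\<rho> x y \<otimes>\<^sub>m ketbra x)) I)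
            \<le> \<epsilon>))"

text \<open>Matrices \<open>A 0, \<dots>, A (m - 1)\<close> over GF(2), the type \<open>bit\<close>.\<close>

definition deor_matrices :: "nat \<Rightarrow> nat \<Rightarrow> (nat \<Rightarrow> bit mat) \<Rightarrow> bool" where
  "deor_matrices n m A \<longleftrightarrow>
     (\<forall>i<m. A i \<in> carrier_mat n n) \<and>
     (\<forall>S. S \<subseteq> {..<m} \<longrightarrow> S \<noteq> {} \<longrightarrow> vec_space.rank n (msum n n A S) = n)"

definition deor_extractor :: "nat \<Rightarrow> (nat \<Rightarrow> bit mat) \<Rightarrow> bit vec \<Rightarrow> bit vec \<Rightarrow> bit vec" where
  "deor_extractor m A x y = vec m (\<lambda>i. (A i *\<^sub>v x) \<bullet> y)"

end

theory Submission
  imports Defs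
begin

text \<open>Conditioned on \<open>x\<close> and on the output \<open>z\<close>, the trace norm is attained by an observable that
  is a contraction \<open>S\<close> on the storage. In both storage models \<open>tr (\<rho> x y S) = (\<Sum>t. u t * v y t)\<close>,
  where \<open>u\<close> depends on \<open>x\<close>, \<open>z\<close>, \<open>S\<close> and \<open>v\<close> on \<open>y\<close> only, with squared lengths bounded by \<open>2 ^ b2\<close>
  each (entangled), respectively by \<open>2 ^ b2\<close> and \<open>1\<close> (non-entangled); here \<open>b2\<close> is the storage of Bob.
  After Cauchy--Schwarz only the second moment of \<open>\<Sum>y. p y * (of_bool (E x y = z) - 1 / 2 ^ m) * v y\<close> over
  uniform \<open>x\<close> and \<open>z\<close> is left. Its cross terms vanish: for \<open>y \<noteq> y'\<close> the full rank
  condition makes \<open>E x (y + y')\<close> uniformly distributed.\<close>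

section \<open>Contractions\<close>

text \<open>Why only Bob's storage is charged: the copy of \<open>x\<close> is kept in the clear, so
  the operator inside the trace norm is block diagonal in the output and in \<open>x\<close>, and
  each block is tested by its own contraction \<open>S\<close>. Whatever depends on \<open>x\<close>
  and \<open>S\<close> alone, Alice's \<open>b1\<close> qubits included, is absorbed in
  \<open>u\<close>, whose length bound does not involve \<open>b1\<close>. Origin of
  \<open>2 ^ b2\<close>: Bob's register is expanded in matrix units |i><j|. For fixed
  \<open>i\<close> the pieces for all \<open>j\<close> together are controlled by a single
  contraction and cost 1; the \<open>2 ^ b2\<close> values of \<open>i\<close> are then added up.
  With entanglement both vectors pay this price, since both are images of the same shared
  purification. For product states \<open>v\<close> lists the entries of Bob's density matrix, and
  its squared length is the purity, at most 1. Other constants: \<open>2 ^ m\<close> counts the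
  outputs \<open>z\<close>, each with its own \<open>u\<close>; \<open>2 ^ n * 2 powr (- k1)\<close>
  is the price of replacing the weights of \<open>X\<close> by a uniform sum;
  \<open>2 powr (- k2)\<close> bounds the collision probability of \<open>Y\<close>.\<close>

lemma cmod_sum_mult_le:
  fixes a b :: "'i \<Rightarrow> complex"
  shows "(cmod (\<Sum>i\<in>I. a i * b i))\<^sup>2 \<le> (\<Sum>i\<in>I. (cmod (a i))\<^sup>2) * (\<Sum>i\<in>I. (cmod (b i))\<^sup>2)"
proof -
  have "cmod (\<Sum>i\<in>I. a i * b i) \<le> (\<Sum>i\<in>I. cmod (a i) * cmod (b i))"
    by (metis (no_types, lifting) norm_mult norm_sum sum.cong)
  then have "(cmod (\<Sum>i\<in>I. a i * b i))\<^sup>2 \<le> (\<Sum>i\<in>I. cmod (a i) * cmod (b i))\<^sup>2"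
    by (intro power_mono) auto
  also have "\<dots> \<le> (\<Sum>i\<in>I. (cmod (a i))\<^sup>2) * (\<Sum>i\<in>I. (cmod (b i))\<^sup>2)"
    by (rule Cauchy_Schwarz_ineq_sum)
  finally show ?thesis .
qed

section \<open>Index arithmetic for tensor factors\<close>

lemma sum_lessThan_mult:
  fixes h :: "nat \<Rightarrow> 'a::comm_monoid_add"
  shows "(\<Sum>k<a * b. h k) = (\<Sum>i<a. \<Sum>j<b. h (i * b + j))"
proof -
  have "(\<Sum>j\<in>{i * b..<i * b + b}. h j) = (\<Sum>j<b. h (i * b + j))" for i
    by (rule sum.reindex_bij_witness[of _ "\<lambda>j. i * b + j" "\<lambda>j. j - i * b"]) auto
  then show ?thesis
    by (simp flip: sum.nat_group)
qed

lemma index_less_mult: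
  fixes i j a b :: nat
  assumes "i < a" and "j < b"
  shows "i * b + j < a * b"
proof -
  have "i * b + j < Suc i * b"
    using assms by simp
  also have "\<dots> \<le> a * b"
    using assms by (intro mult_le_mono1) auto
  finally show ?thesis .
qed

lemma nat_lessE_mult:
  fixes r a b :: nat
  assumes "r < a * b"
  obtains i j where "i < a" "j < b" "r = i * b + j"
  using assms that[of "r div b" "r mod b"]
  by (metis div_mult_mod_eq less_mult_imp_div_less mod_less_divisor mult_0_right neq0_conv
      not_less_zero)

text \<open>Operator norm at most 1, for kernels over arbitrary index sets instead of matrices:
  environments and registers can then be indexed by pairs and tuples without flattening them to
  numbers.\<close>

definition contraction :: "'a set \<Rightarrow> 'b set \<Rightarrow> ('a \<Rightarrow> 'b \<Rightarrow> complex) \<Rightarrow> bool" where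
  "contraction R C T \<longleftrightarrow>
     (\<forall>\<psi>. (\<Sum>r\<in>R. (cmod (\<Sum>c\<in>C. T r c * \<psi> c))\<^sup>2) \<le> (\<Sum>c\<in>C. (cmod (\<psi> c))\<^sup>2))"

text \<open>Two readings occur below: the columns are an orthonormal system of eigenvectors, or the
  rows are pairs of an output index and an environment index and the kernel is a Stinespring
  dilation.\<close>

definition isometry :: "'a set \<Rightarrow> 'b set \<Rightarrow> ('a \<Rightarrow> 'b \<Rightarrow> complex) \<Rightarrow> bool" where
  "isometry R C V \<longleftrightarrow> (\<forall>c\<in>C. \<forall>c'\<in>C. (\<Sum>r\<in>R. cnj (V r c) * V r c') = of_bool (c = c'))"

lemma contractionD:
  assumes "contraction R C T"
  shows "(\<Sum>r\<in>R. (cmod (\<Sum>c\<in>C. T r c * \<psi> c))\<^sup>2) \<le> (\<Sum>c\<in>C. (cmod (\<psi> c))\<^sup>2)"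
  using assms unfolding contraction_def by blast

lemma of_real_sum_cmod_square:
  "complex_of_real (\<Sum>i\<in>I. (cmod (f i))\<^sup>2) = (\<Sum>i\<in>I. f i * cnj (f i))"
  by (simp only: of_real_sum complex_norm_square)

lemma isometry_norm:
  assumes V: "isometry R C V" and C: "finite C"
  shows "(\<Sum>r\<in>R. (cmod (\<Sum>c\<in>C. V r c * \<psi> c))\<^sup>2) = (\<Sum>c\<in>C. (cmod (\<psi> c))\<^sup>2)"
proof -
  have "complex_of_real (\<Sum>r\<in>R. (cmod (\<Sum>c\<in>C. V r c * \<psi> c))\<^sup>2)
      = (\<Sum>r\<in>R. (\<Sum>c'\<in>C. V r c' * \<psi> c') * (\<Sum>c\<in>C. cnj (V r c * \<psi> c)))"
    by (simp only: of_real_sum_cmod_square cnj_sum)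
  also have "\<dots> = (\<Sum>r\<in>R. \<Sum>c\<in>C. \<Sum>c'\<in>C. (cnj (\<psi> c) * \<psi> c') * (cnj (V r c) * V r c'))"
    by (simp add: sum_product ac_simps) (rule sum.cong[OF refl], rule sum.swap)
  also have "\<dots> = (\<Sum>c\<in>C. \<Sum>c'\<in>C. (cnj (\<psi> c) * \<psi> c') * (\<Sum>r\<in>R. cnj (V r c) * V r c'))"
    by (subst sum.swap, intro sum.cong[OF refl], subst sum.swap) (simp add: sum_distrib_left)
  also have "\<dots> = (\<Sum>c\<in>C. \<Sum>c'\<in>C. (cnj (\<psi> c) * \<psi> c') * of_bool (c = c'))"
    using V by (intro sum.cong refl) (auto simp: isometry_def)
  also have "\<dots> = (\<Sum>c\<in>C. \<psi> c * cnj (\<psi> c))"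
    using C by (intro sum.cong refl) (simp add: of_bool_def if_distrib[where f = "\<lambda>x. _ * x"]
        sum.delta cong: if_cong)
  also have "\<dots> = complex_of_real (\<Sum>c\<in>C. (cmod (\<psi> c))\<^sup>2)"
    by (simp only: of_real_sum_cmod_square)
  finally show ?thesis
    by (simp only: of_real_eq_iff)
qed

lemma isometry_contraction:
  assumes "isometry R C V" and "finite C"
  shows "contraction R C V"
  using isometry_norm[OF assms] by (simp add: contraction_def)

text \<open>Let \<open>w\<close> be the adjoint applied to \<open>\<chi>\<close>. Then |w|^2 = <T w,
  \<chi>>, and Cauchy--Schwarz with |T w| \<le> |w| gives |w|^4 \<le> |\<chi>|^2 |w|^2; it remains
  to cancel.\<close>

lemma contraction_adjoint:
  assumes T: "contraction R C T"
  shows "contraction C R (\<lambda>c r. cnj (T r c))"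
  unfolding contraction_def
proof
  fix \<chi> :: "'a \<Rightarrow> complex"
  define w where "w c = (\<Sum>r\<in>R. cnj (T r c) * \<chi> r)" for c
  define a where "a = (\<Sum>c\<in>C. (cmod (w c))\<^sup>2)"
  define b where "b = (\<Sum>r\<in>R. (cmod (\<chi> r))\<^sup>2)"
  have ab0: "0 \<le> a" "0 \<le> b"
    by (auto simp: a_def b_def sum_nonneg)
  have "complex_of_real a = (\<Sum>c\<in>C. w c * cnj (w c))"
    unfolding a_def by (rule of_real_sum_cmod_square)
  also have "\<dots> = (\<Sum>c\<in>C. \<Sum>r\<in>R. cnj (\<chi> r) * (T r c * w c))"
    by (intro sum.cong refl) (simp add: w_def[of _] sum_distrib_left sum_distrib_right ac_simps)
  also have "\<dots> = (\<Sum>r\<in>R. cnj (\<chi> r) * (\<Sum>c\<in>C. T r c * w c))"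
    by (subst sum.swap) (simp add: sum_distrib_left)
  finally have "a\<^sup>2 = (cmod (\<Sum>r\<in>R. cnj (\<chi> r) * (\<Sum>c\<in>C. T r c * w c)))\<^sup>2"
    using ab0 by (metis abs_of_nonneg norm_of_real)
  also have "\<dots> \<le> b * (\<Sum>r\<in>R. (cmod (\<Sum>c\<in>C. T r c * w c))\<^sup>2)"
    by (rule order_trans[OF cmod_sum_mult_le]) (simp add: b_def)
  also have "\<dots> \<le> b * a"
    unfolding a_def using ab0 by (intro mult_left_mono contractionD[OF T])
  finally have "a * a \<le> b * a"
    by (simp add: power2_eq_square)
  then have "a \<le> b"
    using ab0 by (cases "a = 0") auto
  then show "(\<Sum>c\<in>C. (cmod (\<Sum>r\<in>R. cnj (T r c) * \<chi> r))\<^sup>2) \<le> (\<Sum>r\<in>R. (cmod (\<chi> r))\<^sup>2)"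
    by (simp add: a_def b_def w_def)
qed

lemma contraction_comp:
  assumes T: "contraction R M T" and T': "contraction M C T'"
  shows "contraction R C (\<lambda>r c. \<Sum>s\<in>M. T r s * T' s c)"
  unfolding contraction_def
proof
  fix \<psi> :: "'c \<Rightarrow> complex"
  have "(\<Sum>c\<in>C. (\<Sum>s\<in>M. T r s * T' s c) * \<psi> c) = (\<Sum>s\<in>M. T r s * (\<Sum>c\<in>C. T' s c * \<psi> c))" for r
    by (simp add: sum_distrib_left sum_distrib_right mult.assoc, rule sum.swap)
  then show "(\<Sum>r\<in>R. (cmod (\<Sum>c\<in>C. (\<Sum>s\<in>M. T r s * T' s c) * \<psi> c))\<^sup>2)
      \<le> (\<Sum>c\<in>C. (cmod (\<psi> c))\<^sup>2)"
    by (simp add: order_trans[OF contractionD[OF T] contractionD[OF T']])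
qed

section \<open>Spectral theorem\<close>

definition hermitian_mat :: "nat \<Rightarrow> complex mat \<Rightarrow> bool" where
  "hermitian_mat N D \<longleftrightarrow>
     D \<in> carrier_mat N N \<and> (\<forall>i<N. \<forall>j<N. D $$ (j, i) = cnj (D $$ (i, j)))"

lemma hermitian_mat_cnj:
  assumes "hermitian_mat N D" and "i < N" and "j < N"
  shows "cnj (D $$ (i, j)) = D $$ (j, i)"
  using assms unfolding hermitian_mat_def by metis

lemma mtrace_mult:
  assumes "A \<in> carrier_mat r c" and "B \<in> carrier_mat c r"
  shows "mtrace (A * B) = (\<Sum>i<r. \<Sum>j<c. A $$ (i, j) * B $$ (j, i))"
  using assms unfolding mtrace_def
  by (auto simp: scalar_prod_def atLeast0LessThan intro!: sum.cong)

lemma mtrace_comm: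
  fixes A B :: "'a::comm_semiring_0 mat"
  assumes A: "A \<in> carrier_mat r c" and B: "B \<in> carrier_mat c r"
  shows "mtrace (A * B) = mtrace (B * A)"
  unfolding mtrace_mult[OF A B] mtrace_mult[OF B A]
  by (subst sum.swap) (simp add: mult.commute)

text \<open>Double counting of the squared moduli of the entries: each column contributes 1, and
  each row at most 1 because the adjoint is a contraction, tested on a basis vector. This bounds the
  size of orthonormal systems, so that a maximal one exists.\<close>

lemma isometry_card_le:
  fixes N K :: nat
  assumes u: "isometry {..<N} {..<K} u"
  shows "K \<le> N"
proof -
  have row: "(\<Sum>k<K. (cmod (u a k))\<^sup>2) \<le> 1" if a: "a < N" for a
  proof -
    have "(\<Sum>k<K. (cmod (\<Sum>r<N. cnj (u r k) * of_bool (r = a)))\<^sup>2)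
        \<le> (\<Sum>r<N. (cmod (of_bool (r = a)))\<^sup>2)"
      by (rule contractionD[OF contraction_adjoint[OF isometry_contraction[OF u finite_lessThan]]])
    moreover have "(\<Sum>r<N. cnj (u r k) * of_bool (r = a)) = cnj (u a k)" for k
      using a by (simp add: of_bool_def if_distrib[where f = "\<lambda>x. _ * x"] cong: if_cong)
    moreover have "(\<Sum>r<N. (cmod (of_bool (r = a)))\<^sup>2) = 1"
    proof -
      have "(\<Sum>r<N. (cmod (of_bool (r = a)))\<^sup>2) = (\<Sum>r<N. if r = a then 1 else 0)"
        by (intro sum.cong) auto
      then show ?thesis using a by simp
    qed
    ultimately show ?thesis by simp
  qed
  have col: "(\<Sum>a<N. (cmod (u a k))\<^sup>2) = 1" if "k < K" for k
  proof -
    have "complex_of_real (\<Sum>a<N. (cmod (u a k))\<^sup>2) = (\<Sum>a<N. cnj (u a k) * u a k)"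
      unfolding of_real_sum_cmod_square by (simp add: mult.commute)
    also have "\<dots> = 1"
      using u that by (auto simp: isometry_def)
    finally show ?thesis
      by (simp only: of_real_eq_1_iff)
  qed
  have "real K = (\<Sum>k<K. \<Sum>a<N. (cmod (u a k))\<^sup>2)"
    using col by simp
  also have "\<dots> = (\<Sum>a<N. \<Sum>k<K. (cmod (u a k))\<^sup>2)"
    by (rule sum.swap)
  also have "\<dots> \<le> (\<Sum>a<N. 1)"
    by (intro sum_mono row) auto
  finally show ?thesis by simp
qed

text \<open>For hermitian \<open>D\<close> the trace of \<open>D * D\<close> is the sum of the
  squared moduli of all entries.\<close>

lemma hermitian_zeroI:
  assumes D: "hermitian_mat N D" and tr: "mtrace (D * D) = 0" and ij: "i < N" "j < N"
  shows "D $$ (i, j) = 0"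
proof -
  have car: "D \<in> carrier_mat N N"
    using D by (simp add: hermitian_mat_def)
  have "complex_of_real (\<Sum>i<N. \<Sum>j<N. (cmod (D $$ (i, j)))\<^sup>2)
      = (\<Sum>i<N. \<Sum>j<N. D $$ (i, j) * D $$ (j, i))"
    unfolding of_real_sum[of _ "{..<N}"] of_real_sum_cmod_square
    by (intro sum.cong refl) (simp add: hermitian_mat_cnj[OF D])
  also have "\<dots> = 0"
    using tr mtrace_mult[OF car car] by simp
  finally have "(\<Sum>i<N. \<Sum>j<N. (cmod (D $$ (i, j)))\<^sup>2) = 0"
    by (simp only: of_real_eq_0_iff)
  then show ?thesis
    using ij by (simp add: sum_nonneg_eq_0_iff sum_nonneg)
qed

text \<open>If all eigenvalues vanish, then a triangular form \<open>B\<close> of \<open>D\<close> has zero diagonal, so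
  \<open>tr (D D) = tr (B B) = 0\<close>.\<close>

lemma hermitian_eigenvector:
  assumes D: "hermitian_mat N D" and nz: "i < N" "j < N" "D $$ (i, j) \<noteq> 0"
  obtains \<mu> :: real and v :: "nat \<Rightarrow> complex"
  where "\<mu> \<noteq> 0" "(\<Sum>a<N. (cmod (v a))\<^sup>2) = 1"
    "\<And>a. a < N \<Longrightarrow> (\<Sum>b<N. D $$ (a, b) * v b) = of_real \<mu> * v a"
proof -
  have car[simp]: "D \<in> carrier_mat N N" and dims[simp]: "dim_row D = N" "dim_col D = N"
    using D by (auto simp: hermitian_mat_def)
  obtain es where es: "char_poly D = (\<Prod>e\<leftarrow>es. [:- e, 1:])"
    using char_poly_factorized[OF car] by blast
  obtain B P Q where "schur_decomposition D es = (B, P, Q)"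
    by (cases "schur_decomposition D es") auto
  from schur_decomposition[OF car es this]
  have wit: "similar_mat_wit D B P Q" and tri: "upper_triangular B" and diag: "diag_mat B = es"
    by auto
  from similar_mat_witD2[OF car wit]
  have QP: "Q * P = 1\<^sub>m N" and eq: "D = P * B * Q"
    and B: "B \<in> carrier_mat N N" and P: "P \<in> carrier_mat N N" and Q: "Q \<in> carrier_mat N N"
    by auto
  have "\<exists>e\<in>set es. e \<noteq> 0"
  proof (rule ccontr)
    assume "\<not> (\<exists>e\<in>set es. e \<noteq> 0)"
    then have diag0: "B $$ (i, i) = 0" if "i < N" for i
      using that B diag[symmetric] by (auto simp: diag_mat_def)
    have "D * D = P * (B * (B * Q))"
    proof -
      have "D * D = P * B * (Q * P) * (B * Q)"
        unfolding eq using B P Q by (simp add: assoc_mult_mat[of _ N N _ N _ N])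
      then show ?thesis
        using B P Q by (simp add: QP assoc_mult_mat[of _ N N _ N _ N])
    qed
    then have "mtrace (D * D) = mtrace ((B * (B * Q)) * P)"
      using B P Q mtrace_comm[of P N N "B * (B * Q)"] by simp
    also have "(B * (B * Q)) * P = B * B"
      using B P Q by (simp add: QP assoc_mult_mat[of _ N N _ N _ N])
    also have "mtrace (B * B) = (\<Sum>i<N. \<Sum>j<N. B $$ (i, j) * B $$ (j, i))"
      by (rule mtrace_mult[OF B B])
    also have "\<dots> = 0"
    proof (intro sum.neutral ballI)
      fix i j assume "i \<in> {..<N}" "j \<in> {..<N}"
      then show "B $$ (i, j) * B $$ (j, i) = 0"
        using diag0 tri B unfolding upper_triangular_def
        by (cases i j rule: linorder_cases) auto
    qed
    finally show False
      using hermitian_zeroI[OF D _ nz(1,2)] nz(3) by simp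
  qed
  then obtain e where e: "e \<in> set es" "e \<noteq> 0" by blast
  have "poly (char_poly D) e = 0"
    unfolding es poly_prod_list using e by (auto simp: prod_list_zero_iff)
  then have "eigenvalue D e"
    using eigenvalue_root_char_poly[OF car] by simp
  then obtain w where w: "w \<in> carrier_vec N" "w \<noteq> 0\<^sub>v N" "D *\<^sub>v w = e \<cdot>\<^sub>v w"
    by (auto simp: eigenvalue_def eigenvector_def)
  have Dw: "(\<Sum>b<N. D $$ (a, b) * w $ b) = e * w $ a" if "a < N" for a
    using arg_cong[OF w(3), of "\<lambda>v. v $ a"] that w(1)
    by (simp add: scalar_prod_def atLeast0LessThan)
  define s where "s = (\<Sum>a<N. (cmod (w $ a))\<^sup>2)"
  have "s \<noteq> 0"
  proof
    assume "s = 0"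
    then have "w $ a = 0" if "a < N" for a
      using that by (simp add: s_def sum_nonneg_eq_0_iff)
    then have "w = 0\<^sub>v N"
      using w(1) by (intro eq_vecI) auto
    then show False using w(2) by simp
  qed
  then have s: "s > 0"
    unfolding s_def by (simp add: less_le sum_nonneg)
  have ss: "complex_of_real s = (\<Sum>a<N. w $ a * cnj (w $ a))"
    unfolding s_def by (rule of_real_sum_cmod_square)
  \<comment> \<open>The eigenvalue is real: the form <D w, w> is evaluated by the eigenvalue
    equation and, after \<open>D\<close> is moved to the other argument by hermitian symmetry, by
    its conjugate.\<close>
  have "e * complex_of_real s = (\<Sum>a<N. \<Sum>b<N. D $$ (a, b) * w $ b * cnj (w $ a))"
    unfolding ss sum_distrib_left by (simp add: sum_distrib_right Dw[symmetric] flip: mult.assoc)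
  also have "\<dots> = (\<Sum>b<N. \<Sum>a<N. D $$ (a, b) * w $ b * cnj (w $ a))"
    by (rule sum.swap)
  also have "\<dots> = (\<Sum>b<N. w $ b * cnj (\<Sum>a<N. D $$ (b, a) * w $ a))"
    by (simp add: hermitian_mat_cnj[OF D] sum_distrib_left ac_simps)
  also have "\<dots> = cnj e * complex_of_real s"
    unfolding ss sum_distrib_left by (intro sum.cong refl, simp only: Dw lessThan_iff) (simp add: ac_simps)
  finally have "cnj e = e"
    using s by simp
  then have er: "e = of_real (Re e)"
    by (metis Reals_cnj_iff of_real_Re)
  show thesis
  proof (rule that[of "Re e" "\<lambda>a. w $ a / sqrt s"])
    show "Re e \<noteq> 0"
      using e(2) er by auto
    show "(\<Sum>a<N. (cmod (w $ a / sqrt s))\<^sup>2) = 1"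
      using s by (simp add: norm_divide power_divide flip: sum_divide_distrib s_def)
    show "(\<Sum>b<N. D $$ (a, b) * (w $ b / sqrt s)) = of_real (Re e) * (w $ a / sqrt s)"
      if "a < N" for a
      using Dw[OF that] er by (simp flip: sum_divide_distrib)
  qed
qed

text \<open>Eigenvectors for the eigenvalue \<open>0\<close> are not needed, so the system \<open>u\<close> may be incomplete.\<close>

lemma hermitian_spectral:
  assumes D: "hermitian_mat N D"
  obtains K :: nat and u :: "nat \<Rightarrow> nat \<Rightarrow> complex" and l :: "nat \<Rightarrow> real"
  where "isometry {..<N} {..<K} u"
    "\<And>a b. a < N \<Longrightarrow> b < N \<Longrightarrow> D $$ (a, b) = (\<Sum>k<K. of_real (l k) * u a k * cnj (u b k))"
proof -
  define P where "P K \<longleftrightarrow> (\<exists>u l. isometry {..<N} {..<K} u \<and>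
      (\<forall>k<K. \<forall>a<N. (\<Sum>b<N. D $$ (a, b) * u b k) = of_real (l k :: real) * u a k))" for K :: nat
  have "P 0" by (auto simp: P_def isometry_def)
  moreover have bound: "\<forall>K. P K \<longrightarrow> K \<le> N"
    using isometry_card_le by (auto simp: P_def)
  ultimately obtain K where K: "P K" and max: "\<And>K'. P K' \<Longrightarrow> K' \<le> K"
    using Nat.GreatestI_nat[of P 0 N] Nat.Greatest_le_nat[of P _ N] by blast
  from K obtain u l where u: "isometry {..<N} {..<K} u"
    and ev: "\<And>k a. k < K \<Longrightarrow> a < N \<Longrightarrow> (\<Sum>b<N. D $$ (a, b) * u b k) = of_real (l k :: real) * u a k"
    by (auto simp: P_def)
  have on: "(\<Sum>b<N. cnj (u b k) * u b k') = of_bool (k = k')" if "k < K" "k' < K" for k k'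
    using u that by (auto simp: isometry_def)
  \<comment> \<open>Deflation: \<open>D'\<close> is \<open>D\<close> with the part carried by the
    maximal system removed, so it annihilates every \<open>u _ k\<close>. A nonzero
    \<open>D'\<close> would have an eigenvector that extends the system.\<close>
  define R where "R a b = (\<Sum>k<K. of_real (l k) * u a k * cnj (u b k))" for a b
  define D' where "D' = mat N N (\<lambda>(a, b). D $$ (a, b) - R a b)"
  have D': "hermitian_mat N D'"
    by (simp add: hermitian_mat_def D'_def R_def hermitian_mat_cnj[OF D] ac_simps)
  have Ru: "(\<Sum>b<N. R a b * x b) = (\<Sum>k<K. of_real (l k) * u a k * (\<Sum>b<N. cnj (u b k) * x b))" for a x
    unfolding R_def sum_distrib_right sum_distrib_left
    by (subst sum.swap) (simp add: mult.assoc)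
  have D'u: "(\<Sum>b<N. D' $$ (a, b) * u b k) = 0" if "a < N" "k < K" for a k
  proof -
    have "(\<Sum>b<N. D' $$ (a, b) * u b k) = (\<Sum>b<N. D $$ (a, b) * u b k) - (\<Sum>b<N. R a b * u b k)"
      using that by (simp add: D'_def left_diff_distrib sum_subtractf)
    also have "\<dots> = of_real (l k) * u a k - (\<Sum>k'<K. of_real (l k') * u a k' * of_bool (k' = k))"
      unfolding Ru using that by (simp add: ev on)
    also have "\<dots> = 0"
      using that by (simp add: of_bool_def if_distrib[where f = "\<lambda>x. _ * x"] cong: if_cong)
    finally show ?thesis .
  qed
  have "D' $$ (i, j) = 0" if ij: "i < N" "j < N" for i j
  proof (rule ccontr)
    assume "D' $$ (i, j) \<noteq> 0"
    from hermitian_eigenvector[OF D' ij this] obtain \<mu> v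
      where \<mu>: "\<mu> \<noteq> 0" and v: "(\<Sum>a<N. (cmod (v a))\<^sup>2) = 1"
        and ev': "\<And>a. a < N \<Longrightarrow> (\<Sum>b<N. D' $$ (a, b) * v b) = of_real \<mu> * v a"
      by blast
    \<comment> \<open>\<mu> <u k, v> = <u k, D' v> = <D' u k, v> = 0, and \<mu> is nonzero. This is
      why only eigenvectors for nonzero eigenvalues are collected.\<close>
    have orth: "(\<Sum>a<N. cnj (u a k) * v a) = 0" if "k < K" for k
    proof -
      have "of_real \<mu> * (\<Sum>a<N. cnj (u a k) * v a) = (\<Sum>a<N. cnj (u a k) * (\<Sum>b<N. D' $$ (a, b) * v b))"
        by (subst sum_distrib_left, intro sum.cong refl, simp only: ev' lessThan_iff) simp
      also have "\<dots> = (\<Sum>b<N. \<Sum>a<N. cnj (u a k) * (D' $$ (a, b) * v b))"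
        unfolding sum_distrib_left by (rule sum.swap)
      also have "\<dots> = (\<Sum>b<N. v b * cnj (\<Sum>a<N. D' $$ (b, a) * u a k))"
        by (simp add: hermitian_mat_cnj[OF D'] sum_distrib_left ac_simps)
      also have "\<dots> = 0"
        using D'u that by simp
      finally show ?thesis using \<mu> by simp
    qed
    have orth': "(\<Sum>a<N. cnj (v a) * u a k) = 0" if "k < K" for k
      using arg_cong[OF orth[OF that], of cnj] by (simp add: mult.commute)
    have vv: "(\<Sum>a<N. cnj (v a) * v a) = 1"
      using arg_cong[OF v, of complex_of_real] unfolding of_real_sum_cmod_square
      by (simp add: mult.commute)
    define u' where "u' a k = (if k = K then v a else u a k)" for a k
    define l' where "l' k = (if k = K then \<mu> else l k)" for k
    have "isometry {..<N} {..<Suc K} u'"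
      using on orth orth' vv by (auto simp: isometry_def u'_def less_Suc_eq)
    moreover have "(\<Sum>b<N. D $$ (a, b) * u' b k) = of_real (l' k) * u' a k" if "k < Suc K" "a < N" for k a
    proof (cases "k = K")
      case True
      have "(\<Sum>b<N. D' $$ (a, b) * v b) = (\<Sum>b<N. D $$ (a, b) * v b) - (\<Sum>b<N. R a b * v b)"
        using that by (simp add: D'_def left_diff_distrib sum_subtractf)
      also have "(\<Sum>b<N. R a b * v b) = 0"
        unfolding Ru using orth by simp
      finally show ?thesis
        using True ev'[OF that(2)] by (simp add: u'_def l'_def)
    next
      case False
      then show ?thesis
        using that ev by (simp add: u'_def l'_def)
    qed
    ultimately have "P (Suc K)"
      unfolding P_def by blast
    then show False
      using max[of "Suc K"] by simp
  qed
  then have "D $$ (a, b) = R a b" if "a < N" "b < N" for a b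
    using that by (simp add: D'_def)
  then show thesis
    using that[OF u] unfolding R_def by blast
qed

section \<open>Positive semidefinite matrices and the trace norm\<close>

lemma psd_form:
  assumes "psd N M"
  shows "0 \<le> (\<Sum>a<N. (\<Sum>b<N. M $$ (a, b) * \<psi> b) * cnj (\<psi> a))"
proof -
  have "M \<in> carrier_mat N N" and "0 \<le> (M *\<^sub>v vec N \<psi>) \<bullet>c vec N \<psi>"
    using assms by (auto simp: psd_def)
  then show ?thesis
    by (auto simp: scalar_prod_def atLeast0LessThan)
qed

lemma psdI:
  assumes M: "M \<in> carrier_mat N N"
    and pos: "\<And>\<psi>. 0 \<le> (\<Sum>a<N. (\<Sum>b<N. M $$ (a, b) * \<psi> b) * cnj (\<psi> a))"
  shows "psd N M"
  unfolding psd_def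
proof (intro conjI ballI)
  fix v :: "complex vec"
  assume "v \<in> carrier_vec N"
  then have "(M *\<^sub>v v) \<bullet>c v = (\<Sum>a<N. (\<Sum>b<N. M $$ (a, b) * v $ b) * cnj (v $ a))"
    using M by (auto simp: scalar_prod_def atLeast0LessThan)
  then show "0 \<le> (M *\<^sub>v v) \<bullet>c v"
    using pos[of "\<lambda>a. v $ a"] by simp
qed fact

lemma psd_hermitian:
  assumes M: "psd N M"
  shows "hermitian_mat N M"
  unfolding hermitian_mat_def
proof (intro conjI allI impI)
  show "M \<in> carrier_mat N N"
    using M by (simp add: psd_def)
  fix i j assume ij: "i < N" "j < N"
  have im: "Im (M $$ (i, i) * (x * cnj x) + M $$ (i, j) * (y * cnj x)
      + M $$ (j, i) * (x * cnj y) + M $$ (j, j) * (y * cnj y)) = 0" for x y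
  proof -
    \<comment> \<open>The sum of two conditionals also covers \<open>i = j\<close>, where the two
      weights add up.\<close>
    define \<psi> where "\<psi> a = (if a = i then x else 0) + (if a = j then y else 0)" for a
    have "(\<Sum>b<N. M $$ (a, b) * \<psi> b) = M $$ (a, i) * x + M $$ (a, j) * y" for a
      using ij by (simp add: \<psi>_def distrib_left sum.distrib if_distrib[where f = "\<lambda>x. _ * x"]
          cong: if_cong)
    moreover have "(\<Sum>a<N. h a * cnj (\<psi> a)) = h i * cnj x + h j * cnj y" for h
      using ij by (simp add: \<psi>_def distrib_left sum.distrib if_distrib[where f = "\<lambda>x. _ * x"]
          if_distrib[where f = cnj] cong: if_cong)
    ultimately have "0 \<le> (M $$ (i, i) * x + M $$ (i, j) * y) * cnj x
        + (M $$ (j, i) * x + M $$ (j, j) * y) * cnj y"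
      using psd_form[OF M, of \<psi>] by simp
    then have "Im ((M $$ (i, i) * x + M $$ (i, j) * y) * cnj x
        + (M $$ (j, i) * x + M $$ (j, j) * y) * cnj y) = 0"
      by (simp add: less_eq_complex_def)
    then show ?thesis
      by (simp add: algebra_simps)
  qed
  have "Im (M $$ (i, i)) = 0" "Im (M $$ (j, j)) = 0"
    using im[of 1 0] im[of 0 1] by simp_all
  \<comment> \<open>The weights 1, 1 kill the imaginary part of the sum of the two off-diagonal
    entries, the weights 1, \<open>\<i>\<close> the real part of their difference.\<close>
  then show "M $$ (j, i) = cnj (M $$ (i, j))"
    using im[of 1 1] im[of 1 \<i>] by (simp add: complex_eq_iff)
qed

text \<open>Each eigenvalue is the value of the form at its unit eigenvector, hence nonnegative;
  eigenvectors scaled by its square root are the Gram vectors. The decomposition later yields Kraus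
  operators from Choi matrices and purifications from density matrices.\<close>

lemma psd_gram:
  assumes M: "psd N M"
  shows "\<exists>(K :: nat) g. \<forall>a<N. \<forall>b<N. M $$ (a, b) = (\<Sum>k<K. g a k * cnj (g b k))"
proof -
  obtain K u and l :: "nat \<Rightarrow> real" where u: "isometry {..<N} {..<K::nat} u"
    and eq: "\<And>a b. a < N \<Longrightarrow> b < N \<Longrightarrow> M $$ (a, b) = (\<Sum>k<K. of_real (l k) * u a k * cnj (u b k))"
    using hermitian_spectral[OF psd_hermitian[OF M]] by blast
  have on: "(\<Sum>b<N. cnj (u b k) * u b k') = of_bool (k = k')" if "k < K" "k' < K" for k k'
    using u that by (auto simp: isometry_def)
  have l: "l k \<ge> 0" if k: "k < K" for k
  proof -
    have "(\<Sum>b<N. M $$ (a, b) * u b k) = of_real (l k) * u a k" if a: "a < N" for a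
    proof -
      have "(\<Sum>b<N. M $$ (a, b) * u b k)
          = (\<Sum>k'<K. of_real (l k') * u a k' * (\<Sum>b<N. cnj (u b k') * u b k))"
        using a unfolding sum_distrib_left
        by (subst sum.swap) (simp add: eq sum_distrib_right mult.assoc)
      also have "\<dots> = (\<Sum>k'<K. of_real (l k') * u a k' * of_bool (k' = k))"
        using k by (simp add: on)
      also have "\<dots> = of_real (l k) * u a k"
        using k by (simp add: of_bool_def if_distrib[where f = "\<lambda>x. _ * x"] cong: if_cong)
      finally show ?thesis .
    qed
    then have "0 \<le> (\<Sum>a<N. of_real (l k) * u a k * cnj (u a k))"
      using psd_form[OF M, of "\<lambda>b. u b k"] by simp
    also have "\<dots> = of_real (l k) * (\<Sum>a<N. cnj (u a k) * u a k)"
      by (simp add: sum_distrib_left ac_simps)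
    also have "\<dots> = of_real (l k)"
      using on k by simp
    finally show ?thesis
      by (simp add: less_eq_complex_def)
  qed
  show ?thesis
  proof (rule exI[of _ K], rule exI[of _ "\<lambda>a k. of_real (sqrt (l k)) * u a k"], intro allI impI)
    fix a b assume ab: "a < N" "b < N"
    have sq: "of_real (sqrt (l k)) * u a k * cnj (of_real (sqrt (l k)) * u b k)
        = of_real (l k) * u a k * cnj (u b k)" if "k < K" for k
    proof -
      have "complex_of_real (sqrt (l k)) * complex_of_real (sqrt (l k)) = of_real (l k)"
        using l[OF that] by (simp flip: of_real_mult)
      then show ?thesis
        by (simp add: ac_simps)
    qed
    show "M $$ (a, b) = (\<Sum>k<K. of_real (sqrt (l k)) * u a k * cnj (of_real (sqrt (l k)) * u b k))"
      unfolding eq[OF ab] by (intro sum.cong[OF refl] sq[symmetric]) simp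
  qed
qed

lemma psd_of_gram:
  assumes "M \<in> carrier_mat N N"
    and eq: "\<And>a b. a < N \<Longrightarrow> b < N \<Longrightarrow> M $$ (a, b) = (\<Sum>k\<in>K. g a k * cnj (g b k))"
  shows "psd N M"
proof (rule psdI[OF assms(1)])
  fix \<psi> :: "nat \<Rightarrow> complex"
  have "(\<Sum>a<N. (\<Sum>b<N. M $$ (a, b) * \<psi> b) * cnj (\<psi> a))
      = (\<Sum>a<N. \<Sum>b<N. \<Sum>k\<in>K. (cnj (g b k) * \<psi> b) * (g a k * cnj (\<psi> a)))"
    by (simp add: eq sum_distrib_left sum_distrib_right ac_simps)
  also have "\<dots> = (\<Sum>a<N. \<Sum>k\<in>K. \<Sum>b<N. (cnj (g b k) * \<psi> b) * (g a k * cnj (\<psi> a)))"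
    by (rule sum.cong[OF refl], rule sum.swap)
  also have "\<dots> = (\<Sum>k\<in>K. \<Sum>a<N. \<Sum>b<N. (cnj (g b k) * \<psi> b) * (g a k * cnj (\<psi> a)))"
    by (rule sum.swap)
  also have "\<dots> = (\<Sum>k\<in>K. (\<Sum>b<N. cnj (g b k) * \<psi> b) * cnj (\<Sum>a<N. cnj (g a k) * \<psi> a))"
    by (simp add: sum_distrib_left sum_distrib_right)
  also have "\<dots> = complex_of_real (\<Sum>k\<in>K. (cmod (\<Sum>b<N. cnj (g b k) * \<psi> b))\<^sup>2)"
    by (rule of_real_sum_cmod_square[symmetric])
  finally show "0 \<le> (\<Sum>a<N. (\<Sum>b<N. M $$ (a, b) * \<psi> b) * cnj (\<psi> a))"
    by (simp add: less_eq_complex_def sum_nonneg)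
qed

text \<open>With \<open>M\<close> the product of a Gram factor \<open>G\<close> and its adjoint, the
  trace is the squared Frobenius norm of \<open>D\<close> times \<open>G\<close>, called
  \<open>h\<close> below. If it vanishes then so does \<open>h\<close>, and with it
  \<open>D * M\<close>.\<close>

lemma mtrace_psd_conj:
  assumes M: "psd N M" and D: "hermitian_mat N D"
  shows "0 \<le> mtrace (D * (M * D))"
    and "mtrace (D * (M * D)) = 0 \<Longrightarrow> D * M = 0\<^sub>m N N"
proof -
  have car: "M \<in> carrier_mat N N" "D \<in> carrier_mat N N"
    using M D by (auto simp: psd_def hermitian_mat_def)
  then have dims[simp]: "dim_row M = N" "dim_col M = N" "dim_row D = N" "dim_col D = N"
    by auto
  obtain K g where g: "\<forall>a<N. \<forall>b<N. M $$ (a, b) = (\<Sum>k<(K::nat). g a k * cnj (g b k))"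
    using psd_gram[OF M] by blast
  define h where "h i k = (\<Sum>j<N. D $$ (i, j) * g j k)" for i k
  have DM: "(D * M) $$ (i, b) = (\<Sum>k<K. h i k * cnj (g b k))" if "i < N" "b < N" for i b
  proof -
    have "(D * M) $$ (i, b) = (\<Sum>j<N. \<Sum>k<K. D $$ (i, j) * g j k * cnj (g b k))"
      using that by (simp add: scalar_prod_def atLeast0LessThan g sum_distrib_left mult.assoc)
    also have "\<dots> = (\<Sum>k<K. h i k * cnj (g b k))"
      by (subst sum.swap) (simp add: h_def sum_distrib_right)
    finally show ?thesis .
  qed
  have hc: "cnj (h i k) = (\<Sum>b<N. cnj (g b k) * D $$ (b, i))" if "i < N" for i k
    unfolding h_def cnj_sum complex_cnj_mult using that
    by (intro sum.cong refl) (simp add: hermitian_mat_cnj[OF D] mult.commute)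
  have "mtrace (D * (M * D)) = mtrace ((D * M) * D)"
    using car by (simp add: assoc_mult_mat[of _ N N _ N _ N])
  also have "\<dots> = (\<Sum>i<N. \<Sum>b<N. \<Sum>k<K. h i k * (cnj (g b k) * D $$ (b, i)))"
    unfolding mtrace_mult[OF mult_carrier_mat[OF car(2,1)] car(2)]
    by (intro sum.cong refl) (simp add: DM sum_distrib_right mult.assoc del: index_mult_mat)
  also have "\<dots> = (\<Sum>i<N. \<Sum>k<K. h i k * cnj (h i k))"
    by (rule sum.cong[OF refl], subst sum.swap) (simp add: hc sum_distrib_left)
  also have "\<dots> = complex_of_real (\<Sum>i<N. \<Sum>k<K. (cmod (h i k))\<^sup>2)"
    unfolding of_real_sum[of _ "{..<N}"] of_real_sum_cmod_square ..
  finally have tr: "mtrace (D * (M * D)) = complex_of_real (\<Sum>i<N. \<Sum>k<K. (cmod (h i k))\<^sup>2)" .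
  show "0 \<le> mtrace (D * (M * D))"
    unfolding tr by (simp add: less_eq_complex_def sum_nonneg)
  assume "mtrace (D * (M * D)) = 0"
  then have "(\<Sum>i<N. \<Sum>k<K. (cmod (h i k))\<^sup>2) = 0"
    unfolding tr by (simp only: of_real_eq_0_iff)
  then have "h i k = 0" if "i < N" "k < K" for i k
    using that by (simp add: sum_nonneg_eq_0_iff sum_nonneg)
  then show "D * M = 0\<^sub>m N N"
    by (intro eq_matI) (auto simp: DM simp del: index_mult_mat(1))
qed

lemma mtrace_minus:
  fixes A B :: "'a::ab_group_add mat"
  assumes "A \<in> carrier_mat r c" and "B \<in> carrier_mat r c" and "r \<le> c"
  shows "mtrace (A - B) = mtrace A - mtrace B"
  using assms by (auto simp: mtrace_def simp flip: sum_subtractf intro!: sum.cong)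

text \<open>For \<open>D = B - C\<close>, cyclicity of the trace and \<open>B * B = C * C\<close>
  make tr (D B D) + tr (D C D) vanish. Both terms are nonnegative, so \<open>D * B\<close> and
  \<open>D * C\<close> vanish, hence \<open>D * D\<close> and finally \<open>D\<close>. Without
  uniqueness the description in \<open>psd_sqrt\<close> could not be evaluated.\<close>

lemma psd_square_inj:
  assumes B: "psd N B" and C: "psd N C" and eq: "B * B = C * C"
  shows "B = C"
proof -
  have car: "B \<in> carrier_mat N N" "C \<in> carrier_mat N N"
    using B C by (auto simp: psd_def)
  define D where "D = B - C"
  have D: "hermitian_mat N D"
    using car by (auto simp: hermitian_mat_def D_def hermitian_mat_cnj[OF psd_hermitian[OF B]]
        hermitian_mat_cnj[OF psd_hermitian[OF C]])
  have Dcar: "D \<in> carrier_mat N N"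
    using car by (auto simp: D_def)
  note assoc = assoc_mult_mat[of _ N N _ N _ N]
  have cyc: "mtrace (X * (Y * Z)) = mtrace (Y * (Z * X))"
    if "X \<in> carrier_mat N N" "Y \<in> carrier_mat N N" "Z \<in> carrier_mat N N" for X Y Z :: "complex mat"
    using that mtrace_comm[of X N N "Y * Z"] by (simp add: assoc)
  have expand: "mtrace (D * (X * D)) = mtrace (B * (X * B)) - mtrace (B * (X * C))
      - (mtrace (C * (X * B)) - mtrace (C * (X * C)))" if X: "X \<in> carrier_mat N N" for X
  proof -
    have XB: "X * B \<in> carrier_mat N N" and XC: "X * C \<in> carrier_mat N N"
      using X car by auto
    have "X * D = X * B - X * C"
      unfolding D_def by (rule mult_minus_distrib_mat[OF X car])
    then have "D * (X * D) = B * (X * B - X * C) - C * (X * B - X * C)"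
      unfolding D_def by (simp only: minus_mult_distrib_mat[OF car minus_carrier_mat[OF XC]])
    also have "\<dots> = (B * (X * B) - B * (X * C)) - (C * (X * B) - C * (X * C))"
      using mult_minus_distrib_mat[OF car(1) XB XC] mult_minus_distrib_mat[OF car(2) XB XC] by simp
    finally have eq': "D * (X * D) = (B * (X * B) - B * (X * C)) - (C * (X * B) - C * (X * C))" .
    have "B * (X * B) \<in> carrier_mat N N" "B * (X * C) \<in> carrier_mat N N"
      "C * (X * B) \<in> carrier_mat N N" "C * (X * C) \<in> carrier_mat N N"
      using XB XC car by auto
    then show ?thesis
      unfolding eq' by (simp only: mtrace_minus[of _ N N] minus_carrier_mat order.refl)
  qed
  have "C * (C * B) = B * (B * B)"
    using assoc[OF car(2,2,1)] assoc[OF car(1,1,1)] by (simp only: eq)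
  moreover have "mtrace (C * (B * C)) = mtrace (B * (B * B))"
    using cyc[of C B C] car by (simp flip: eq)
  moreover have "mtrace (B * (B * C)) = mtrace (B * (C * B))"
    using cyc[of B B C] car by simp
  ultimately have "mtrace (D * (B * D)) + mtrace (D * (C * D)) = 0"
    unfolding expand[OF car(1)] expand[OF car(2)] by (simp flip: eq)
  then have "mtrace (D * (B * D)) = 0 \<and> mtrace (D * (C * D)) = 0"
    using mtrace_psd_conj(1)[OF B D] mtrace_psd_conj(1)[OF C D]
    by (metis add_nonneg_eq_0_iff)
  then have "D * B = 0\<^sub>m N N" "D * C = 0\<^sub>m N N"
    using mtrace_psd_conj(2)[OF B D] mtrace_psd_conj(2)[OF C D] by auto
  then have "D * D = 0\<^sub>m N N - 0\<^sub>m N N"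
    using mult_minus_distrib_mat[OF Dcar car] by (simp add: D_def[symmetric])
  then have "mtrace (D * D) = 0"
    by (simp add: mtrace_def)
  then have "D $$ (i, j) = 0" if "i < N" "j < N" for i j
    using hermitian_zeroI[OF D _ that] by blast
  then show ?thesis
    using car by (intro eq_matI) (auto simp: D_def)
qed

section \<open>Absolute value and sign of a hermitian matrix\<close>

lemma mat_adjoint_hermitian:
  assumes D: "hermitian_mat N D"
  shows "mat_adjoint D = D"
proof (rule eq_matI)
  have dims: "dim_row D = N" "dim_col D = N"
    using D by (auto simp: hermitian_mat_def)
  then show "dim_row (mat_adjoint D) = dim_row D" "dim_col (mat_adjoint D) = dim_col D"
    by (auto simp: mat_adjoint_def)
  fix i j assume "i < dim_row D" "j < dim_col D"
  then show "mat_adjoint D $$ (i, j) = D $$ (i, j)"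
    using dims by (simp add: mat_adjoint_def mat_of_rows_index hermitian_mat_cnj[OF D])
qed

lemma psd_sqrt_square:
  assumes "psd N B" and "B * B = M" and "dim_row M = N"
  shows "psd_sqrt M = B"
  unfolding psd_sqrt_def using assms psd_square_inj by (intro the_equality) auto

text \<open>Functional calculus: for orthonormal columns \<open>u\<close>, the function
  \<open>c\<close> prescribes the eigenvalues on their span and 0 on the complement, so products and
  traces reduce to those of \<open>c\<close>.\<close>

definition spectral_sum :: "(nat \<Rightarrow> nat \<Rightarrow> complex) \<Rightarrow> nat \<Rightarrow> (nat \<Rightarrow> real) \<Rightarrow> nat \<Rightarrow> nat \<Rightarrow> complex" where
  "spectral_sum u K c a b = (\<Sum>k<K. of_real (c k) * u a k * cnj (u b k))"

lemma spectral_sum_mult: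
  assumes u: "isometry {..<N} {..<K} u"
  shows "(\<Sum>b<N. spectral_sum u K c a b * spectral_sum u K c' b d)
    = spectral_sum u K (\<lambda>k. c k * c' k) a d"
proof -
  have "(\<Sum>b<N. spectral_sum u K c a b * spectral_sum u K c' b d)
      = (\<Sum>b<N. \<Sum>k<K. \<Sum>k'<K. (of_real (c k) * u a k * of_real (c' k') * cnj (u d k')) *
          (cnj (u b k) * u b k'))"
    by (simp add: spectral_sum_def sum_product ac_simps)
  also have "\<dots> = (\<Sum>k<K. \<Sum>k'<K. (of_real (c k) * u a k * of_real (c' k') * cnj (u d k')) *
          (\<Sum>b<N. cnj (u b k) * u b k'))"
    unfolding sum_distrib_left
    by (subst sum.swap, rule sum.cong[OF refl], rule sum.swap)
  also have "\<dots> = (\<Sum>k<K. \<Sum>k'<K. (of_real (c k) * u a k * of_real (c' k') * cnj (u d k')) *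
          of_bool (k = k'))"
    using u by (simp add: isometry_def)
  also have "\<dots> = spectral_sum u K (\<lambda>k. c k * c' k) a d"
    by (simp add: spectral_sum_def of_bool_def if_distrib[where f = "\<lambda>x. _ * x"] ac_simps
        cong: if_cong)
  finally show ?thesis .
qed

lemma spectral_sum_trace:
  assumes u: "isometry {..<N} {..<K} u"
  shows "(\<Sum>a<N. spectral_sum u K c a a) = (\<Sum>k<K. of_real (c k))"
proof -
  have "(\<Sum>a<N. spectral_sum u K c a a) = (\<Sum>k<K. of_real (c k) * (\<Sum>a<N. cnj (u a k) * u a k))"
    unfolding spectral_sum_def sum_distrib_left
    by (subst sum.swap) (simp add: ac_simps)
  then show ?thesis
    using u by (simp add: isometry_def)
qed

text \<open>The kernel is \<open>u\<close> with columns scaled by \<open>c\<close>, composed with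
  the adjoint of \<open>u\<close>; both factors are contractions.\<close>

lemma contraction_spectral_sum:
  assumes u: "isometry {..<N} {..<K} u" and c: "\<And>k. \<bar>c k\<bar> \<le> 1"
  shows "contraction {..<N} {..<N} (spectral_sum u K c)"
proof -
  have con: "contraction {..<N} {..<K} u"
    by (rule isometry_contraction[OF u finite_lessThan])
  have "contraction {..<N} {..<K} (\<lambda>a k. of_real (c k) * u a k)"
    unfolding contraction_def
  proof
    fix \<psi> :: "nat \<Rightarrow> complex"
    have "(\<Sum>r<N. (cmod (\<Sum>k<K. u r k * (of_real (c k) * \<psi> k)))\<^sup>2)
        \<le> (\<Sum>k<K. (cmod (of_real (c k) * \<psi> k))\<^sup>2)"
      by (rule contractionD[OF con])
    also have "\<dots> \<le> (\<Sum>k<K. (cmod (\<psi> k))\<^sup>2)"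
      using c by (intro sum_mono power_mono) (auto simp: norm_mult intro: mult_left_le_one_le)
    finally show "(\<Sum>r<N. (cmod (\<Sum>k<K. of_real (c k) * u r k * \<psi> k))\<^sup>2) \<le> (\<Sum>k<K. (cmod (\<psi> k))\<^sup>2)"
      by (simp add: ac_simps)
  qed
  from contraction_comp[OF this contraction_adjoint[OF con]] show ?thesis
    by (simp add: spectral_sum_def[abs_def])
qed

text \<open>The observable is the sign of \<open>D\<close>. The matrix \<open>B\<close> with the
  absolute eigenvalues is the positive root of \<open>D * D\<close>, and it equals \<open>D\<close>
  times that sign. Since \<open>sgn 0 = 0\<close>, the sign is taken as 0 on the kernel of
  \<open>D\<close>, which fits the possibly incomplete system \<open>u\<close>.\<close>

lemma trace_norm_hermitian:
  assumes D: "hermitian_mat N D"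
  obtains S where "contraction {..<N} {..<N} S"
    "trace_norm D = 1 / 2 * Re (\<Sum>i<N. \<Sum>j<N. D $$ (i, j) * S j i)"
proof -
  have car: "D \<in> carrier_mat N N"
    using D by (simp add: hermitian_mat_def)
  obtain K u and l :: "nat \<Rightarrow> real" where u: "isometry {..<N} {..<K::nat} u"
    and eq: "\<And>a b. a < N \<Longrightarrow> b < N \<Longrightarrow> D $$ (a, b) = spectral_sum u K l a b"
    using hermitian_spectral[OF D] unfolding spectral_sum_def by blast
  define B where "B = mat N N (\<lambda>(a, b). spectral_sum u K (\<lambda>k. \<bar>l k\<bar>) a b)"
  have "psd N B"
  proof (rule psd_of_gram[where K = "{..<K}" and g = "\<lambda>a k. of_real (sqrt \<bar>l k\<bar>) * u a k"])
    fix a b assume "a < N" "b < N"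
    have sq: "of_real (sqrt \<bar>l k\<bar>) * u a k * cnj (of_real (sqrt \<bar>l k\<bar>) * u b k)
        = of_real \<bar>l k\<bar> * u a k * cnj (u b k)" for k
    proof -
      have "complex_of_real (sqrt \<bar>l k\<bar>) * complex_of_real (sqrt \<bar>l k\<bar>) = of_real \<bar>l k\<bar>"
        by (simp flip: of_real_mult)
      then show ?thesis
        by (simp add: ac_simps)
    qed
    have "B $$ (a, b) = (\<Sum>k<K. of_real \<bar>l k\<bar> * u a k * cnj (u b k))"
      using \<open>a < N\<close> \<open>b < N\<close> by (simp add: B_def spectral_sum_def)
    then show "B $$ (a, b)
        = (\<Sum>k<K. of_real (sqrt \<bar>l k\<bar>) * u a k * cnj (of_real (sqrt \<bar>l k\<bar>) * u b k))"
      by (simp only: sq)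
  qed (simp add: B_def)
  moreover have "B * B = mat_adjoint D * D"
    unfolding mat_adjoint_hermitian[OF D] using car
    by (intro eq_matI) (auto simp: B_def scalar_prod_def atLeast0LessThan eq spectral_sum_mult[OF u])
  moreover have "dim_row (mat_adjoint D * D) = N"
    unfolding mat_adjoint_hermitian[OF D] using car by simp
  ultimately have "psd_sqrt (mat_adjoint D * D) = B"
    by (rule psd_sqrt_square)
  then have "trace_norm D = 1 / 2 * Re (mtrace B)"
    by (simp add: trace_norm_def)
  also have "mtrace B = (\<Sum>k<K. of_real \<bar>l k\<bar>)"
    unfolding spectral_sum_trace[OF u, symmetric] by (simp add: mtrace_def B_def)
  also have "\<dots> = (\<Sum>a<N. spectral_sum u K (\<lambda>k. l k * sgn (l k)) a a)"
    unfolding spectral_sum_trace[OF u] by (simp add: abs_sgn)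
  also have "\<dots> = (\<Sum>i<N. \<Sum>j<N. D $$ (i, j) * spectral_sum u K (\<lambda>k. sgn (l k)) j i)"
    by (simp add: eq flip: spectral_sum_mult[OF u])
  finally have "trace_norm D
      = 1 / 2 * Re (\<Sum>i<N. \<Sum>j<N. D $$ (i, j) * spectral_sum u K (\<lambda>k. sgn (l k)) j i)" .
  moreover have "contraction {..<N} {..<N} (spectral_sum u K (\<lambda>k. sgn (l k)))"
    by (rule contraction_spectral_sum[OF u]) (simp add: sgn_if)
  ultimately show thesis
    using that by blast
qed

section \<open>Stinespring isometries\<close>

lemma msum_index:
  "i < r \<Longrightarrow> j < c \<Longrightarrow> msum r c f I $$ (i, j) = (\<Sum>s\<in>I. f s $$ (i, j))"
  by (simp add: msum_def)

lemma msum_carrier [simp]: "msum r c f I \<in> carrier_mat r c"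
  by (simp add: msum_def)

lemma mat_unit_carrier [simp]: "mat_unit d i j \<in> carrier_mat d d"
  by (simp add: mat_unit_def)

lemma mat_unit_index:
  "a < d \<Longrightarrow> b < d \<Longrightarrow> mat_unit d i j $$ (a, b) = of_bool (a = i) * of_bool (b = j)"
  by (simp add: mat_unit_def)

lemma kronecker_index:
  assumes "A \<in> carrier_mat r c" and "B \<in> carrier_mat r' c'"
    and "i < r" "j < c" "i' < r'" "j' < c'"
  shows "(A \<otimes>\<^sub>m B) $$ (i * r' + i', j * c' + j') = A $$ (i, j) * B $$ (i', j')"
  using assms index_less_mult[of i r i' r'] index_less_mult[of j c j' c']
  by (auto simp: kronecker_def)

lemma kronecker_carrier:
  "A \<in> carrier_mat r c \<Longrightarrow> B \<in> carrier_mat r' c' \<Longrightarrow> A \<otimes>\<^sub>m B \<in> carrier_mat (r * r') (c * c')"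
  by (auto simp: kronecker_def)

lemma tensor_map_carrier: "tensor_map dA dB eA eB \<Phi> \<Psi> M \<in> carrier_mat (eA * eB) (eA * eB)"
  by (simp add: tensor_map_def)

lemma tensor_map_index:
  assumes \<Phi>: "\<And>i j. i < dA \<Longrightarrow> j < dA \<Longrightarrow> \<Phi> (mat_unit dA i j) \<in> carrier_mat eA eA"
    and \<Psi>: "\<And>i j. i < dB \<Longrightarrow> j < dB \<Longrightarrow> \<Psi> (mat_unit dB i j) \<in> carrier_mat eB eB"
    and ab: "a < eA" "b < eA" "a' < eB" "b' < eB"
  shows "tensor_map dA dB eA eB \<Phi> \<Psi> M $$ (a * eB + a', b * eB + b') =
    (\<Sum>i<dA. \<Sum>j<dA. \<Sum>k<dB. \<Sum>l<dB. M $$ (i * dB + k, j * dB + l) *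
       (\<Phi> (mat_unit dA i j) $$ (a, b) * \<Psi> (mat_unit dB k l) $$ (a', b')))"
proof -
  have less: "a * eB + a' < eA * eB" "b * eB + b' < eA * eB"
    using ab by (auto intro: index_less_mult)
  have summand: "(M $$ (i * dB + k, j * dB + l) \<cdot>\<^sub>m (\<Phi> (mat_unit dA i j) \<otimes>\<^sub>m \<Psi> (mat_unit dB k l))) $$
        (a * eB + a', b * eB + b') = M $$ (i * dB + k, j * dB + l) *
       (\<Phi> (mat_unit dA i j) $$ (a, b) * \<Psi> (mat_unit dB k l) $$ (a', b'))"
    if "i < dA" "j < dA" "k < dB" "l < dB" for i j k l
    using kronecker_index[OF \<Phi>[OF that(1,2)] \<Psi>[OF that(3,4)] ab]
      kronecker_carrier[OF \<Phi>[OF that(1,2)] \<Psi>[OF that(3,4)]] less by auto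
  have "tensor_map dA dB eA eB \<Phi> \<Psi> M $$ (a * eB + a', b * eB + b') =
    (\<Sum>((i, j), (k, l))\<in>({..<dA} \<times> {..<dA}) \<times> ({..<dB} \<times> {..<dB}). M $$ (i * dB + k, j * dB + l) *
       (\<Phi> (mat_unit dA i j) $$ (a, b) * \<Psi> (mat_unit dB k l) $$ (a', b')))"
    unfolding tensor_map_def msum_index[OF less]
    by (intro sum.cong refl) (clarsimp simp: summand)
  then show ?thesis
    by (simp add: sum.cartesian_product')
qed

text \<open>A partial trace of a matrix unit has entries that are sums of such products of deltas;
  the lemma substitutes \<open>r = f c\<close> and \<open>s = g c\<close>.\<close>

lemma sum_double_delta:
  fixes F :: "nat \<Rightarrow> nat \<Rightarrow> complex"
  assumes "\<And>c. c \<in> C \<Longrightarrow> f c < R" "\<And>c. c \<in> C \<Longrightarrow> g c < R'"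
  shows "(\<Sum>r<R. \<Sum>s<R'. F r s * (\<Sum>c\<in>C. of_bool (f c = r) * of_bool (g c = s)))
    = (\<Sum>c\<in>C. F (f c) (g c))"
proof -
  have "(\<Sum>r<R. \<Sum>s<R'. F r s * (\<Sum>c\<in>C. of_bool (f c = r) * of_bool (g c = s)))
      = (\<Sum>r<R. \<Sum>c\<in>C. \<Sum>s<R'. F r s * (of_bool (f c = r) * of_bool (g c = s)))"
    unfolding sum_distrib_left by (rule sum.cong[OF refl], rule sum.swap)
  also have "\<dots> = (\<Sum>c\<in>C. \<Sum>r<R. \<Sum>s<R'. F r s * (of_bool (f c = r) * of_bool (g c = s)))"
    by (rule sum.swap)
  also have "\<dots> = (\<Sum>c\<in>C. F (f c) (g c))"
  proof (rule sum.cong[OF refl])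
    fix c assume c: "c \<in> C"
    have "(\<Sum>s<R'. F r s * (of_bool (f c = r) * of_bool (g c = s)))
        = (if f c = r then F r (g c) else 0)" for r
      using assms(2)[OF c]
      by (simp add: of_bool_def if_distrib[where f = "\<lambda>x. _ * x"] cong: if_cong)
    then show "(\<Sum>r<R. \<Sum>s<R'. F r s * (of_bool (f c = r) * of_bool (g c = s))) = F (f c) (g c)"
      using assms(1)[OF c] by simp
  qed
  finally show ?thesis .
qed

lemma sum_delta_pair:
  fixes F :: "nat \<Rightarrow> nat \<Rightarrow> complex"
  assumes "i < d" "j < d"
  shows "(\<Sum>k<d. \<Sum>l<d. of_bool (i = k) * of_bool (j = l) * F k l) = F i j"
  using sum_double_delta[of "{()}" "\<lambda>_. i" d "\<lambda>_. j" d F] assms by (simp add: mult.commute)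

text \<open>The Choi matrix of \<open>\<Phi>\<close> is the image of the unnormalised maximally entangled state.
  Its Gram vectors are the Kraus operators.\<close>

lemma quantum_operation_kraus:
  assumes \<Phi>: "quantum_operation d e \<Phi>"
  obtains K :: nat and V :: "nat \<Rightarrow> nat \<Rightarrow> nat \<Rightarrow> complex"
  where "isometry ({..<e} \<times> {..<K}) {..<d} (\<lambda>(a, k). V a k)"
    "\<And>i j a b. i < d \<Longrightarrow> j < d \<Longrightarrow> a < e \<Longrightarrow> b < e \<Longrightarrow>
       \<Phi> (mat_unit d i j) $$ (a, b) = (\<Sum>k<K. V a k i * cnj (V b k j))"
proof -
  have car: "\<Phi> M \<in> carrier_mat e e" if "M \<in> carrier_mat d d" for M
    using \<Phi> that by (auto simp: quantum_operation_def linear_mat_map_def)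
  have tr: "mtrace (\<Phi> M) = mtrace M" if "M \<in> carrier_mat d d" for M
    using \<Phi> that by (auto simp: quantum_operation_def)
  define \<Omega> :: "complex mat" where "\<Omega> = mat (d * d) (d * d)
    (\<lambda>(r, s). of_bool (r div d = r mod d) * of_bool (s div d = s mod d))"
  have \<Omega>: "\<Omega> $$ (i * d + k, j * d + l) = of_bool (i = k) * of_bool (j = l)"
    if "i < d" "j < d" "k < d" "l < d" for i j k l
    using that by (simp add: \<Omega>_def index_less_mult)
  have "psd (d * d) \<Omega>"
    by (rule psd_of_gram[where K = "{()}" and g = "\<lambda>r _. of_bool (r div d = r mod d)"])
      (auto simp: \<Omega>_def)
  then have "psd (d * e) (tensor_map d d d e (\<lambda>N. N) \<Phi> \<Omega>)"
    using \<Phi> by (auto simp: quantum_operation_def completely_positive_def)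
  from psd_gram[OF this] obtain K :: nat and g
    where g: "\<And>r s. r < d * e \<Longrightarrow> s < d * e \<Longrightarrow>
        tensor_map d d d e (\<lambda>N. N) \<Phi> \<Omega> $$ (r, s) = (\<Sum>k<K. g r k * cnj (g s k))"
    by blast
  define V where "V a k i = g (i * e + a) k" for a k i
  have choi: "\<Phi> (mat_unit d i j) $$ (a, b) = (\<Sum>k<K. V a k i * cnj (V b k j))"
    if ij: "i < d" "j < d" and ab: "a < e" "b < e" for i j a b
  proof -
    have "tensor_map d d d e (\<lambda>N. N) \<Phi> \<Omega> $$ (i * e + a, j * e + b)
        = (\<Sum>i'<d. \<Sum>j'<d. \<Sum>k<d. \<Sum>l<d. \<Omega> $$ (i' * d + k, j' * d + l) *
            (mat_unit d i' j' $$ (i, j) * \<Phi> (mat_unit d k l) $$ (a, b)))"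
      by (rule tensor_map_index) (use car ij ab in auto)
    also have "\<dots> = (\<Sum>i'<d. \<Sum>j'<d. \<Sum>k<d. \<Sum>l<d. (of_bool (i' = k) * of_bool (j' = l)) *
        ((of_bool (i = i') * of_bool (j = j')) * \<Phi> (mat_unit d k l) $$ (a, b)))"
      by (intro sum.cong refl) (simp only: \<Omega> mat_unit_index ij lessThan_iff)
    also have "\<dots> = (\<Sum>i'<d. \<Sum>j'<d. of_bool (i = i') * of_bool (j = j') *
        (\<Sum>k<d. \<Sum>l<d. of_bool (i' = k) * of_bool (j' = l) * \<Phi> (mat_unit d k l) $$ (a, b)))"
      by (simp only: sum_distrib_left ac_simps)
    also have "\<dots> = (\<Sum>k<d. \<Sum>l<d. of_bool (i = k) * of_bool (j = l) * \<Phi> (mat_unit d k l) $$ (a, b))"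
      by (rule sum_delta_pair[OF ij])
    also have "\<dots> = \<Phi> (mat_unit d i j) $$ (a, b)"
      by (rule sum_delta_pair[OF ij])
    finally show ?thesis
      using g[of "i * e + a" "j * e + b"] ij ab by (simp add: V_def index_less_mult)
  qed
  \<comment> \<open>Trace preservation applied to |j><i|, whose trace is the Kronecker delta. The
    order is reversed because the column with index \<open>i\<close> is the conjugated one.\<close>
  have "isometry ({..<e} \<times> {..<K}) {..<d} (\<lambda>(a, k). V a k)"
    unfolding isometry_def
  proof (intro ballI)
    fix i j assume "i \<in> {..<d}" "j \<in> {..<d}"
    then have ij: "i < d" "j < d" by auto
    have "(\<Sum>r\<in>{..<e} \<times> {..<K}. cnj ((case r of (a, k) \<Rightarrow> V a k) i) * (case r of (a, k) \<Rightarrow> V a k) j)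
        = (\<Sum>a<e. \<Sum>k<K. V a k j * cnj (V a k i))"
      by (simp add: sum.cartesian_product' mult.commute)
    also have "\<dots> = (\<Sum>a<e. \<Phi> (mat_unit d j i) $$ (a, a))"
      using ij by (simp add: choi)
    also have "\<dots> = mtrace (\<Phi> (mat_unit d j i))"
      using car[of "mat_unit d j i"] by (auto simp: mtrace_def)
    also have "\<dots> = (\<Sum>a<d. of_bool (a = j) * of_bool (a = i))"
      unfolding tr[OF mat_unit_carrier] unfolding mtrace_def by (intro sum.cong) (auto simp: mat_unit_def)
    also have "\<dots> = (\<Sum>a<d. if a = j then of_bool (i = j) else 0)"
      by (intro sum.cong refl) auto
    also have "\<dots> = of_bool (i = j)"
      using ij by simp
    finally show "(\<Sum>r\<in>{..<e} \<times> {..<K}. cnj ((case r of (a, k) \<Rightarrow> V a k) i) *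
        (case r of (a, k) \<Rightarrow> V a k) j) = of_bool (i = j)" .
  qed
  then show thesis
    using that choi by blast
qed

text \<open>The discarded factor joins the environment: \<open>e\<close> pairs a basis index of that
  factor with a Kraus index, and the same isometry is merely regrouped.\<close>

lemma quantum_operation_discard:
  assumes \<Phi>: "quantum_operation d (b * c) \<Phi>"
  shows "\<exists>(E :: (nat \<times> nat) set) V. finite E \<and> isometry ({..<b} \<times> E) {..<d} (\<lambda>(a, e). V a e) \<and>
    (\<forall>i<d. \<forall>j<d. \<forall>\<alpha><b. \<forall>\<beta><b. (\<Sum>\<gamma><c. \<Phi> (mat_unit d i j) $$ (\<alpha> * c + \<gamma>, \<beta> * c + \<gamma>))
      = (\<Sum>e\<in>E. V \<alpha> e i * cnj (V \<beta> e j)))"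
proof -
  obtain K :: nat and V where V: "isometry ({..<b * c} \<times> {..<K}) {..<d} (\<lambda>(a, k). V a k)"
    and kraus: "\<And>i j a a'. i < d \<Longrightarrow> j < d \<Longrightarrow> a < b * c \<Longrightarrow> a' < b * c \<Longrightarrow>
       \<Phi> (mat_unit d i j) $$ (a, a') = (\<Sum>k<K. V a k i * cnj (V a' k j))"
    using quantum_operation_kraus[OF \<Phi>] by blast
  define W where "W \<alpha> e i = V (\<alpha> * c + fst e) (snd e) i" for \<alpha> e i
  show ?thesis
  proof (rule exI[of _ "{..<c} \<times> {..<K}"], rule exI[of _ W], intro conjI allI impI)
    show "isometry ({..<b} \<times> {..<c} \<times> {..<K}) {..<d} (\<lambda>(a, e). W a e)"
      using V unfolding isometry_def
      by (simp add: sum.cartesian_product' sum_lessThan_mult W_def)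
    fix i j \<alpha> \<beta> assume "i < d" "j < d" "\<alpha> < b" "\<beta> < b"
    then show "(\<Sum>\<gamma><c. \<Phi> (mat_unit d i j) $$ (\<alpha> * c + \<gamma>, \<beta> * c + \<gamma>))
      = (\<Sum>e\<in>{..<c} \<times> {..<K}. W \<alpha> e i * cnj (W \<beta> e j))"
      by (simp add: kraus index_less_mult W_def sum.cartesian_product')
  qed simp
qed

section \<open>Partial traces after local operations\<close>

lemma discard_snd_carrier: "discard_snd b c M \<in> carrier_mat b b"
  by (simp add: discard_snd_def)

lemma discard_snd_mat_unit:
  assumes "\<alpha> < b" "\<beta> < b"
  shows "discard_snd b c (mat_unit (b * c) r s) $$ (\<alpha>, \<beta>)
    = (\<Sum>\<gamma><c. of_bool (\<alpha> * c + \<gamma> = r) * of_bool (\<beta> * c + \<gamma> = s))"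
  using assms by (simp add: discard_snd_def mat_unit_index index_less_mult)

lemma tensor_map_discard:
  assumes "\<alpha> < b1" "\<beta> < b1" "i < b2" "j < b2"
  shows "tensor_map (b1 * c1) (b2 * c2) b1 b2 (discard_snd b1 c1) (discard_snd b2 c2) M
      $$ (\<alpha> * b2 + i, \<beta> * b2 + j)
    = (\<Sum>\<gamma><c1. \<Sum>\<delta><c2. M $$ ((\<alpha> * c1 + \<gamma>) * (b2 * c2) + (i * c2 + \<delta>),
        (\<beta> * c1 + \<gamma>) * (b2 * c2) + (j * c2 + \<delta>)))" (is "?L = _")
proof -
  let ?M = "\<lambda>r s t u. M $$ (r * (b2 * c2) + t, s * (b2 * c2) + u)"
  let ?X = "\<lambda>r s. \<Sum>\<gamma><c1. of_bool (\<alpha> * c1 + \<gamma> = r) * of_bool (\<beta> * c1 + \<gamma> = s) :: complex"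
  let ?Y = "\<lambda>t u. \<Sum>\<delta><c2. of_bool (i * c2 + \<delta> = t) * of_bool (j * c2 + \<delta> = u) :: complex"
  have "?L = (\<Sum>r<b1 * c1. \<Sum>s<b1 * c1. \<Sum>t<b2 * c2. \<Sum>u<b2 * c2. ?M r s t u * (?X r s * ?Y t u))"
    by (simp only: tensor_map_index[OF discard_snd_carrier discard_snd_carrier assms]
        discard_snd_mat_unit assms)
  also have "\<dots> = (\<Sum>r<b1 * c1. \<Sum>s<b1 * c1. (\<Sum>t<b2 * c2. \<Sum>u<b2 * c2. ?M r s t u * ?Y t u) * ?X r s)"
  proof (intro sum.cong refl)
    fix r s
    show "(\<Sum>t<b2 * c2. \<Sum>u<b2 * c2. ?M r s t u * (?X r s * ?Y t u))
        = (\<Sum>t<b2 * c2. \<Sum>u<b2 * c2. ?M r s t u * ?Y t u) * ?X r s"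
      unfolding sum_distrib_right[where r = "?X r s"] by (intro sum.cong refl) (simp only: ac_simps)
  qed
  also have "\<dots> = (\<Sum>\<gamma><c1. \<Sum>t<b2 * c2. \<Sum>u<b2 * c2. ?M (\<alpha> * c1 + \<gamma>) (\<beta> * c1 + \<gamma>) t u * ?Y t u)"
    using assms by (intro sum_double_delta) (auto intro: index_less_mult)
  also have "\<dots> = (\<Sum>\<gamma><c1. \<Sum>\<delta><c2. ?M (\<alpha> * c1 + \<gamma>) (\<beta> * c1 + \<gamma>) (i * c2 + \<delta>) (j * c2 + \<delta>))"
    using assms by (intro sum.cong refl sum_double_delta) (auto intro: index_less_mult)
  finally show ?thesis .
qed

text \<open>Separates the two parties: an entry of the stored state depends on the operations only
  through the local coefficients \<open>X\<close> and \<open>Y\<close>, so Stinespring forms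
  obtained for each party alone can be inserted.\<close>

lemma tensor_map_storage:
  assumes \<Phi>: "quantum_operation d1 (b1 * c1) \<Phi>" and \<Psi>: "quantum_operation d2 (b2 * c2) \<Psi>"
    and ab: "\<alpha> < b1" "\<beta> < b1" "i < b2" "j < b2"
    and X: "\<And>p p'. p < d1 \<Longrightarrow> p' < d1 \<Longrightarrow>
      (\<Sum>\<gamma><c1. \<Phi> (mat_unit d1 p p') $$ (\<alpha> * c1 + \<gamma>, \<beta> * c1 + \<gamma>)) = X p p'"
    and Y: "\<And>q q'. q < d2 \<Longrightarrow> q' < d2 \<Longrightarrow>
      (\<Sum>\<gamma><c2. \<Psi> (mat_unit d2 q q') $$ (i * c2 + \<gamma>, j * c2 + \<gamma>)) = Y q q'"
  shows "tensor_map (b1 * c1) (b2 * c2) b1 b2 (discard_snd b1 c1) (discard_snd b2 c2)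
      (tensor_map d1 d2 (b1 * c1) (b2 * c2) \<Phi> \<Psi> \<sigma>) $$ (\<alpha> * b2 + i, \<beta> * b2 + j)
    = (\<Sum>p<d1. \<Sum>p'<d1. \<Sum>q<d2. \<Sum>q'<d2. \<sigma> $$ (p * d2 + q, p' * d2 + q') * (X p p' * Y q q'))"
proof -
  have car: "\<Phi> (mat_unit d1 p p') \<in> carrier_mat (b1 * c1) (b1 * c1)"
    "\<Psi> (mat_unit d2 q q') \<in> carrier_mat (b2 * c2) (b2 * c2)" for p p' q q'
    using \<Phi> \<Psi> by (auto simp: quantum_operation_def linear_mat_map_def)
  let ?\<Phi> = "\<lambda>p p' \<gamma>. \<Phi> (mat_unit d1 p p') $$ (\<alpha> * c1 + \<gamma>, \<beta> * c1 + \<gamma>)"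
  let ?\<Psi> = "\<lambda>q q' \<gamma>. \<Psi> (mat_unit d2 q q') $$ (i * c2 + \<gamma>, j * c2 + \<gamma>)"
  let ?\<sigma> = "\<lambda>p p' q q'. \<sigma> $$ (p * d2 + q, p' * d2 + q')"
  have "tensor_map (b1 * c1) (b2 * c2) b1 b2 (discard_snd b1 c1) (discard_snd b2 c2)
      (tensor_map d1 d2 (b1 * c1) (b2 * c2) \<Phi> \<Psi> \<sigma>) $$ (\<alpha> * b2 + i, \<beta> * b2 + j)
    = (\<Sum>\<gamma><c1. \<Sum>\<delta><c2. \<Sum>p<d1. \<Sum>p'<d1. \<Sum>q<d2. \<Sum>q'<d2. ?\<sigma> p p' q q' * (?\<Phi> p p' \<gamma> * ?\<Psi> q q' \<delta>))"
    unfolding tensor_map_discard[OF ab]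
    using ab by (intro sum.cong refl tensor_map_index car) (auto intro: index_less_mult)
  also have "\<dots> = (\<Sum>p<d1. \<Sum>p'<d1. \<Sum>q<d2. \<Sum>q'<d2. \<Sum>\<gamma><c1. \<Sum>\<delta><c2.
      ?\<sigma> p p' q q' * (?\<Phi> p p' \<gamma> * ?\<Psi> q q' \<delta>))"
    unfolding sum.cartesian_product
    by (rule sum.reindex_bij_witness[of _ "\<lambda>(p, p', q, q', \<gamma>, \<delta>). (\<gamma>, \<delta>, p, p', q, q')"
          "\<lambda>(\<gamma>, \<delta>, p, p', q, q'). (p, p', q, q', \<gamma>, \<delta>)"]) auto
  also have "\<dots> = (\<Sum>p<d1. \<Sum>p'<d1. \<Sum>q<d2. \<Sum>q'<d2. ?\<sigma> p p' q q' *
      ((\<Sum>\<gamma><c1. ?\<Phi> p p' \<gamma>) * (\<Sum>\<delta><c2. ?\<Psi> q q' \<delta>)))"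
    by (simp only: sum_product) (simp only: sum_distrib_left)
  also have "\<dots> = (\<Sum>p<d1. \<Sum>p'<d1. \<Sum>q<d2. \<Sum>q'<d2. ?\<sigma> p p' q q' * (X p p' * Y q q'))"
    by (intro sum.cong refl) (simp only: X Y lessThan_iff)
  finally show ?thesis .
qed

section \<open>Factorisation of storage\<close>

text \<open>Against every observable \<open>S\<close>, the dependence of the storage on \<open>x\<close> (and \<open>S\<close>) and on \<open>y\<close>
  factors through a bilinear form on vectors of squared length at most \<open>P\<close> and \<open>Q\<close>.\<close>

definition storage_factors ::
    "nat \<Rightarrow> nat \<Rightarrow> real \<Rightarrow> real \<Rightarrow> (bit vec \<Rightarrow> bit vec \<Rightarrow> complex mat) \<Rightarrow> 't set \<Rightarrow>
     (bit vec \<Rightarrow> 't \<Rightarrow> complex) \<Rightarrow> bool" where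
  "storage_factors n L P Q \<rho> T v \<longleftrightarrow>
     (\<forall>x\<in>carrier_vec n. \<forall>y\<in>carrier_vec n. hermitian_mat L (\<rho> x y)) \<and>
     (\<forall>y\<in>carrier_vec n. (\<Sum>t\<in>T. (cmod (v y t))\<^sup>2) \<le> Q) \<and>
     (\<forall>x\<in>carrier_vec n. \<forall>S. contraction {..<L} {..<L} S \<longrightarrow>
        (\<exists>u. (\<Sum>t\<in>T. (cmod (u t))\<^sup>2) \<le> P \<and>
          (\<forall>y\<in>carrier_vec n. (\<Sum>s<L. \<Sum>s'<L. \<rho> x y $$ (s, s') * S s' s) = (\<Sum>t\<in>T. u t * v y t))))"

text \<open>Apply \<open>S\<close> to \<open>\<phi>\<close> tensored with |i>. Keeping
  \<open>i\<close> fixed while \<open>j\<close> runs over the whole register is what makes a full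
  row of matrix units cost only 1.\<close>

lemma contraction_slice:
  assumes S: "contraction {..<a * b} {..<a * b} S" and i: "i < (b :: nat)"
  shows "(\<Sum>\<beta><a. \<Sum>j<b. (cmod (\<Sum>\<alpha><a. S (\<beta> * b + j) (\<alpha> * b + i) * \<phi> \<alpha>))\<^sup>2)
    \<le> (\<Sum>\<alpha><a. (cmod (\<phi> \<alpha>))\<^sup>2)"
proof -
  define \<psi> where "\<psi> s = of_bool (s mod b = i) * \<phi> (s div b)" for s
  have \<psi>: "\<psi> (\<alpha> * b + i') = of_bool (i' = i) * \<phi> \<alpha>" if "i' < b" for \<alpha> i'
    using that by (simp add: \<psi>_def)
  have row: "(\<Sum>c<a * b. S r c * \<psi> c) = (\<Sum>\<alpha><a. S r (\<alpha> * b + i) * \<phi> \<alpha>)" for r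
  proof -
    have "(\<Sum>c<a * b. S r c * \<psi> c)
        = (\<Sum>\<alpha><a. \<Sum>i'<b. if i' = i then S r (\<alpha> * b + i) * \<phi> \<alpha> else 0)"
      unfolding sum_lessThan_mult by (intro sum.cong refl) (simp add: \<psi>)
    then show ?thesis
      using i by simp
  qed
  have "(\<Sum>c<a * b. (cmod (\<psi> c))\<^sup>2) = (\<Sum>\<alpha><a. \<Sum>i'<b. if i' = i then (cmod (\<phi> \<alpha>))\<^sup>2 else 0)"
    unfolding sum_lessThan_mult by (intro sum.cong refl) (simp add: \<psi>)
  also have "\<dots> = (\<Sum>\<alpha><a. (cmod (\<phi> \<alpha>))\<^sup>2)"
    using i by simp
  finally show ?thesis
    using contractionD[OF S, of \<psi>] unfolding row by (simp add: sum_lessThan_mult)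
qed

text \<open>The kernel is Alice's Heisenberg operator: \<open>V\<close>, then the block <j|S|i> on
  her register with the environment untouched, then the adjoint of \<open>V\<close>. The isometry
  preserves length, stacking the blocks over \<open>j\<close> is a slice of \<open>S\<close>, and
  the adjoint of \<open>V\<close> contracts for each \<open>j\<close> separately.\<close>

lemma contraction_isometry_conj:
  assumes V: "isometry ({..<a} \<times> E) {..<d} (\<lambda>(a, e). V a e)"
    and S: "contraction {..<a * b} {..<a * b} S" and i: "i < (b :: nat)"
  shows "(\<Sum>j<b. \<Sum>p'<(d::nat). (cmod (\<Sum>p<d.
      (\<Sum>\<alpha><a. \<Sum>\<beta><a. \<Sum>e\<in>E. cnj (V \<beta> e p') * S (\<beta> * b + j) (\<alpha> * b + i) * V \<alpha> e p) * \<psi> p))\<^sup>2)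
    \<le> (\<Sum>p<d. (cmod (\<psi> p))\<^sup>2)"
proof -
  define \<phi> where "\<phi> \<alpha> e = (\<Sum>p<d. V \<alpha> e p * \<psi> p)" for \<alpha> e
  define \<chi> where "\<chi> j \<beta> e = (\<Sum>\<alpha><a. S (\<beta> * b + j) (\<alpha> * b + i) * \<phi> \<alpha> e)" for j \<beta> e
  have con: "contraction ({..<a} \<times> E) {..<d} (\<lambda>(a, e). V a e)"
    by (rule isometry_contraction[OF V finite_lessThan])
  have \<phi>: "(\<Sum>\<alpha><a. \<Sum>e\<in>E. (cmod (\<phi> \<alpha> e))\<^sup>2) \<le> (\<Sum>p<d. (cmod (\<psi> p))\<^sup>2)"
    using contractionD[OF con, of \<psi>] by (simp add: \<phi>_def sum.cartesian_product')
  have adj: "(\<Sum>p'<d. (cmod (\<Sum>\<beta><a. \<Sum>e\<in>E. cnj (V \<beta> e p') * h \<beta> e))\<^sup>2)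
      \<le> (\<Sum>\<beta><a. \<Sum>e\<in>E. (cmod (h \<beta> e))\<^sup>2)" for h
    using contractionD[OF contraction_adjoint[OF con], of "\<lambda>(\<beta>, e). h \<beta> e"]
    by (simp add: sum.cartesian_product')
  have inner: "(\<Sum>p<d. (\<Sum>\<alpha><a. \<Sum>\<beta><a. \<Sum>e\<in>E.
        cnj (V \<beta> e p') * S (\<beta> * b + j) (\<alpha> * b + i) * V \<alpha> e p) * \<psi> p)
      = (\<Sum>\<beta><a. \<Sum>e\<in>E. cnj (V \<beta> e p') * \<chi> j \<beta> e)" for j p'
    unfolding \<chi>_def \<phi>_def sum_distrib_left sum_distrib_right sum.cartesian_product
    by (rule sum.reindex_bij_witness[of _ "\<lambda>(\<beta>, e, \<alpha>, p). (p, \<alpha>, \<beta>, e)" "\<lambda>(p, \<alpha>, \<beta>, e). (\<beta>, e, \<alpha>, p)"])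
      (auto simp: mult.assoc)
  have "(\<Sum>j<b. \<Sum>p'<d. (cmod (\<Sum>p<d.
      (\<Sum>\<alpha><a. \<Sum>\<beta><a. \<Sum>e\<in>E. cnj (V \<beta> e p') * S (\<beta> * b + j) (\<alpha> * b + i) * V \<alpha> e p) * \<psi> p))\<^sup>2)
      \<le> (\<Sum>j<b. \<Sum>\<beta><a. \<Sum>e\<in>E. (cmod (\<chi> j \<beta> e))\<^sup>2)"
    unfolding inner by (intro sum_mono adj)
  also have "\<dots> = (\<Sum>e\<in>E. \<Sum>\<beta><a. \<Sum>j<b. (cmod (\<chi> j \<beta> e))\<^sup>2)"
    unfolding sum.cartesian_product
    by (rule sum.reindex_bij_witness[of _ "\<lambda>(e, \<beta>, j). (j, \<beta>, e)" "\<lambda>(j, \<beta>, e). (e, \<beta>, j)"]) auto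
  also have "\<dots> \<le> (\<Sum>e\<in>E. \<Sum>\<alpha><a. (cmod (\<phi> \<alpha> e))\<^sup>2)"
    unfolding \<chi>_def by (intro sum_mono contraction_slice[OF S i])
  also have "\<dots> = (\<Sum>\<alpha><a. \<Sum>e\<in>E. (cmod (\<phi> \<alpha> e))\<^sup>2)"
    by (rule sum.swap)
  also note \<phi>
  finally show ?thesis .
qed

text \<open>Bob's counterpart. Writing W_j for the block <j|W, the kernel is the adjoint of W_i
  times W_j. The first factor contracts, and the squared lengths of W_j applied to
  \<open>\<psi>\<close> sum over \<open>j\<close> to that of W applied to
  \<open>\<psi>\<close>.\<close>

lemma contraction_isometry_block:
  assumes W: "isometry ({..<b} \<times> F) {..<d} (\<lambda>(a, e). W a e)" and F: "finite F" and i: "i < (b :: nat)"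
  shows "(\<Sum>j<b. \<Sum>q<(d::nat). (cmod (\<Sum>q'<d. (\<Sum>f\<in>F. W j f q' * cnj (W i f q)) * \<psi> q'))\<^sup>2)
    \<le> (\<Sum>q<d. (cmod (\<psi> q))\<^sup>2)"
proof -
  define \<omega> where "\<omega> j f = (\<Sum>q'<d. W j f q' * \<psi> q')" for j f
  have con: "contraction ({..<b} \<times> F) {..<d} (\<lambda>(a, e). W a e)"
    by (rule isometry_contraction[OF W finite_lessThan])
  have \<omega>: "(\<Sum>j<b. \<Sum>f\<in>F. (cmod (\<omega> j f))\<^sup>2) \<le> (\<Sum>q<d. (cmod (\<psi> q))\<^sup>2)"
    using contractionD[OF con, of \<psi>] by (simp add: \<omega>_def sum.cartesian_product')
  have adj: "(\<Sum>q<d. (cmod (\<Sum>f\<in>F. cnj (W i f q) * h f))\<^sup>2) \<le> (\<Sum>f\<in>F. (cmod (h f))\<^sup>2)" for h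
  proof -
    \<comment> \<open>The adjoint of W_i is the adjoint of \<open>W\<close> restricted to vectors
      supported in block \<open>i\<close>.\<close>
    have "(\<Sum>j<b. \<Sum>f\<in>F. cnj (W j f q) * (if j = i then h f else 0))
        = (\<Sum>f\<in>F. cnj (W i f q) * h f)" for q
      by (subst sum.swap) (use i in \<open>simp add: if_distrib[where f = "\<lambda>x. _ * x"] cong: if_cong\<close>)
    moreover have "(\<Sum>j<b. \<Sum>f\<in>F. (cmod (if j = i then h f else 0))\<^sup>2) = (\<Sum>f\<in>F. (cmod (h f))\<^sup>2)"
      by (subst sum.swap) (use i in \<open>simp add: if_distrib[where f = cmod]
        if_distrib[where f = "\<lambda>x. x\<^sup>2"] cong: if_cong\<close>)
    ultimately show ?thesis
      using contractionD[OF contraction_adjoint[OF con], of "\<lambda>(j, f). if j = i then h f else 0"]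
      by (simp add: sum.cartesian_product')
  qed
  have inner: "(\<Sum>q'<d. (\<Sum>f\<in>F. W j f q' * cnj (W i f q)) * \<psi> q')
      = (\<Sum>f\<in>F. cnj (W i f q) * \<omega> j f)" for j q
    unfolding \<omega>_def sum_distrib_left sum_distrib_right
    by (subst sum.swap) (simp add: ac_simps)
  have "(\<Sum>j<b. \<Sum>q<d. (cmod (\<Sum>q'<d. (\<Sum>f\<in>F. W j f q' * cnj (W i f q)) * \<psi> q'))\<^sup>2)
      \<le> (\<Sum>j<b. \<Sum>f\<in>F. (cmod (\<omega> j f))\<^sup>2)"
    unfolding inner by (intro sum_mono adj)
  also note \<omega>
  finally show ?thesis .
qed

text \<open>A purification: \<open>k\<close> labels the purifying system, and trace 1 becomes unit
  length.\<close>

lemma density_gram: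
  assumes "density d \<rho>"
  shows "\<exists>(K :: nat) g. (\<forall>a<d. \<forall>b<d. \<rho> $$ (a, b) = (\<Sum>k<K. g a k * cnj (g b k))) \<and>
    (\<Sum>a<d. \<Sum>k<K. (cmod (g a k))\<^sup>2) = 1"
proof -
  have psd: "psd d \<rho>" and tr: "mtrace \<rho> = 1" and dim: "dim_row \<rho> = d"
    using assms by (auto simp: density_def psd_def)
  obtain K :: nat and g where g: "\<forall>a<d. \<forall>b<d. \<rho> $$ (a, b) = (\<Sum>k<K. g a k * cnj (g b k))"
    using psd_gram[OF psd] by blast
  have "complex_of_real (\<Sum>a<d. \<Sum>k<K. (cmod (g a k))\<^sup>2) = mtrace \<rho>"
    unfolding of_real_sum[of _ "{..<d}"] of_real_sum_cmod_square using g dim by (simp add: mtrace_def)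
  then have "(\<Sum>a<d. \<Sum>k<K. (cmod (g a k))\<^sup>2) = 1"
    unfolding tr by (simp only: of_real_eq_1_iff)
  with g show ?thesis
    by blast
qed

text \<open>\<open>v y\<close> consists of the entries of Bob's state, and \<open>u i j\<close> is
  the expectation of the block <j|S|i> in Alice's state. For fixed \<open>i\<close> the entries of
  \<open>u\<close> have total squared length at most 1, hence the bound
  \<open>2 ^ b2\<close>.\<close>

lemma nonentangled_storage_factors:
  assumes "nonentangled_storage n b1 b2 \<rho>"
  shows "\<exists>v. storage_factors n (2 ^ b1 * 2 ^ b2) (2 ^ b2) 1 \<rho>
    ({..<2 ^ b2} \<times> {..<2 ^ b2} :: (nat \<times> nat) set) v"
proof -
  define a b :: nat where "a = 2 ^ b1" and "b = 2 ^ b2"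
  obtain \<rho>A \<rho>B where A: "\<And>x. x \<in> carrier_vec n \<Longrightarrow> density a (\<rho>A x)"
    and B: "\<And>y. y \<in> carrier_vec n \<Longrightarrow> density b (\<rho>B y)"
    and \<rho>: "\<And>x y. x \<in> carrier_vec n \<Longrightarrow> y \<in> carrier_vec n \<Longrightarrow> \<rho> x y = \<rho>A x \<otimes>\<^sub>m \<rho>B y"
    using assms unfolding nonentangled_storage_def a_def b_def by blast
  have carA: "\<rho>A x \<in> carrier_mat a a" if "x \<in> carrier_vec n" for x
    using A[OF that] by (simp add: density_def psd_def)
  have carB: "\<rho>B y \<in> carrier_mat b b" if "y \<in> carrier_vec n" for y
    using B[OF that] by (simp add: density_def psd_def)
  have entry: "\<rho> x y $$ (\<alpha> * b + i, \<beta> * b + j) = \<rho>A x $$ (\<alpha>, \<beta>) * \<rho>B y $$ (i, j)"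
    if "x \<in> carrier_vec n" "y \<in> carrier_vec n" "\<alpha> < a" "\<beta> < a" "i < b" "j < b" for x y \<alpha> \<beta> i j
    unfolding \<rho>[OF that(1,2)]
    by (rule kronecker_index[OF carA[OF that(1)] carB[OF that(2)] that(3-6)])
  have herm: "hermitian_mat (a * b) (\<rho> x y)" if xy: "x \<in> carrier_vec n" "y \<in> carrier_vec n" for x y
    unfolding hermitian_mat_def
  proof (intro conjI allI impI)
    show "\<rho> x y \<in> carrier_mat (a * b) (a * b)"
      unfolding \<rho>[OF xy] using xy by (intro kronecker_carrier carA carB)
    have hA: "hermitian_mat a (\<rho>A x)" and hB: "hermitian_mat b (\<rho>B y)"
      using A[OF xy(1)] B[OF xy(2)] by (auto simp: density_def psd_hermitian)
    fix s s' assume "s < a * b" "s' < a * b"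
    then obtain \<alpha> i \<beta> j where "\<alpha> < a" "i < b" "\<beta> < a" "j < b" "s = \<alpha> * b + i" "s' = \<beta> * b + j"
      by (elim nat_lessE_mult)
    then show "\<rho> x y $$ (s', s) = cnj (\<rho> x y $$ (s, s'))"
      by (simp add: entry xy hermitian_mat_cnj[OF hA] hermitian_mat_cnj[OF hB])
  qed
  \<comment> \<open>The purity of a state is at most 1: an entry is an inner product of Gram
    vectors, and Cauchy--Schwarz bounds the double sum by the square of the trace.\<close>
  have vQ: "(\<Sum>(i, j)\<in>{..<b} \<times> {..<b}. (cmod (\<rho>B y $$ (i, j)))\<^sup>2) \<le> 1" if y: "y \<in> carrier_vec n" for y
  proof -
    obtain K :: nat and g where g: "\<forall>i<b. \<forall>j<b. \<rho>B y $$ (i, j) = (\<Sum>k<K. g i k * cnj (g j k))"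
      and tr: "(\<Sum>i<b. \<Sum>k<K. (cmod (g i k))\<^sup>2) = 1"
      using density_gram[OF B[OF y]] by blast
    have "(\<Sum>(i, j)\<in>{..<b} \<times> {..<b}. (cmod (\<rho>B y $$ (i, j)))\<^sup>2)
        = (\<Sum>i<b. \<Sum>j<b. (cmod (\<Sum>k<K. g i k * cnj (g j k)))\<^sup>2)"
      by (simp add: sum.cartesian_product' g)
    also have "\<dots> \<le> (\<Sum>i<b. \<Sum>j<b. (\<Sum>k<K. (cmod (g i k))\<^sup>2) * (\<Sum>k<K. (cmod (g j k))\<^sup>2))"
      by (intro sum_mono order_trans[OF cmod_sum_mult_le]) simp
    also have "\<dots> = 1"
      using tr by (simp flip: sum_product)
    finally show ?thesis .
  qed
  have u: "\<exists>u. (\<Sum>t\<in>{..<b} \<times> {..<b}. (cmod (u t))\<^sup>2) \<le> real b \<and>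
      (\<forall>y\<in>carrier_vec n. (\<Sum>s<a * b. \<Sum>s'<a * b. \<rho> x y $$ (s, s') * S s' s)
        = (\<Sum>t\<in>{..<b} \<times> {..<b}. u t * (case t of (i, j) \<Rightarrow> \<rho>B y $$ (i, j))))"
    if x: "x \<in> carrier_vec n" and S: "contraction {..<a * b} {..<a * b} S" for x S
  proof -
    obtain K :: nat and g where g: "\<forall>i<a. \<forall>j<a. \<rho>A x $$ (i, j) = (\<Sum>k<K. g i k * cnj (g j k))"
      and tr: "(\<Sum>i<a. \<Sum>k<K. (cmod (g i k))\<^sup>2) = 1"
      using density_gram[OF A[OF x]] by blast
    define h where "h i j \<beta> k = (\<Sum>\<alpha><a. S (\<beta> * b + j) (\<alpha> * b + i) * g \<alpha> k)" for i j \<beta> k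
    define u where "u i j = (\<Sum>\<alpha><a. \<Sum>\<beta><a. \<rho>A x $$ (\<alpha>, \<beta>) * S (\<beta> * b + j) (\<alpha> * b + i))" for i j
    \<comment> \<open>The expectation is an inner product of Alice's purification \<open>g\<close>,
      of unit length, with the block of \<open>S\<close> applied to \<open>g\<close>;
      Cauchy--Schwarz then leaves only the length of \<open>h\<close>.\<close>
    have u_eq: "u i j = (\<Sum>\<beta><a. \<Sum>k<K. cnj (g \<beta> k) * h i j \<beta> k)" for i j
    proof -
      have "u i j = (\<Sum>\<alpha><a. \<Sum>\<beta><a. \<Sum>k<K. g \<alpha> k * cnj (g \<beta> k) * S (\<beta> * b + j) (\<alpha> * b + i))"
        by (simp add: u_def g sum_distrib_right)
      also have "\<dots> = (\<Sum>\<beta><a. \<Sum>k<K. cnj (g \<beta> k) * h i j \<beta> k)"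
        unfolding h_def sum_distrib_left sum.cartesian_product
        by (rule sum.reindex_bij_witness[of _ "\<lambda>(\<beta>, k, \<alpha>). (\<alpha>, \<beta>, k)" "\<lambda>(\<alpha>, \<beta>, k). (\<beta>, k, \<alpha>)"])
          (auto simp: ac_simps)
      finally show ?thesis .
    qed
    have row: "(\<Sum>j<b. (cmod (u i j))\<^sup>2) \<le> 1" if i: "i < b" for i
    proof -
      have "(\<Sum>j<b. (cmod (u i j))\<^sup>2) \<le> (\<Sum>j<b. \<Sum>\<beta><a. \<Sum>k<K. (cmod (h i j \<beta> k))\<^sup>2)"
      proof (rule sum_mono)
        fix j
        have "(cmod (u i j))\<^sup>2 = (cmod (\<Sum>t\<in>{..<a} \<times> {..<K}. cnj (g (fst t) (snd t)) * h i j (fst t) (snd t)))\<^sup>2"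
          by (simp add: u_eq sum.cartesian_product')
        also have "\<dots> \<le> (\<Sum>t\<in>{..<a} \<times> {..<K}. (cmod (cnj (g (fst t) (snd t))))\<^sup>2) *
            (\<Sum>t\<in>{..<a} \<times> {..<K}. (cmod (h i j (fst t) (snd t)))\<^sup>2)"
          by (rule cmod_sum_mult_le)
        finally show "(cmod (u i j))\<^sup>2 \<le> (\<Sum>\<beta><a. \<Sum>k<K. (cmod (h i j \<beta> k))\<^sup>2)"
          using tr by (simp add: sum.cartesian_product')
      qed
      also have "\<dots> = (\<Sum>k<K. \<Sum>\<beta><a. \<Sum>j<b. (cmod (h i j \<beta> k))\<^sup>2)"
        unfolding sum.cartesian_product
        by (rule sum.reindex_bij_witness[of _ "\<lambda>(k, \<beta>, j). (j, \<beta>, k)" "\<lambda>(j, \<beta>, k). (k, \<beta>, j)"]) auto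
      also have "\<dots> \<le> (\<Sum>k<K. \<Sum>\<alpha><a. (cmod (g \<alpha> k))\<^sup>2)"
        unfolding h_def by (intro sum_mono contraction_slice[OF S i])
      also have "\<dots> = 1"
        using tr by (subst sum.swap)
      finally show ?thesis .
    qed
    have "(\<Sum>i<b. \<Sum>j<b. (cmod (u i j))\<^sup>2) \<le> (\<Sum>i<b. 1)"
      by (intro sum_mono row) auto
    moreover have "(\<Sum>s<a * b. \<Sum>s'<a * b. \<rho> x y $$ (s, s') * S s' s) = (\<Sum>i<b. \<Sum>j<b. u i j * \<rho>B y $$ (i, j))"
      if y: "y \<in> carrier_vec n" for y
    proof -
      have "(\<Sum>s<a * b. \<Sum>s'<a * b. \<rho> x y $$ (s, s') * S s' s) = (\<Sum>\<alpha><a. \<Sum>i<b. \<Sum>\<beta><a. \<Sum>j<b.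
          \<rho>A x $$ (\<alpha>, \<beta>) * \<rho>B y $$ (i, j) * S (\<beta> * b + j) (\<alpha> * b + i))"
        unfolding sum_lessThan_mult by (intro sum.cong refl) (simp add: entry x y)
      also have "\<dots> = (\<Sum>i<b. \<Sum>j<b. u i j * \<rho>B y $$ (i, j))"
        unfolding u_def sum_distrib_right sum.cartesian_product
        by (rule sum.reindex_bij_witness[of _ "\<lambda>(i, j, \<alpha>, \<beta>). (\<alpha>, i, \<beta>, j)" "\<lambda>(\<alpha>, i, \<beta>, j). (i, j, \<alpha>, \<beta>)"])
          (auto simp: ac_simps)
      finally show ?thesis .
    qed
    ultimately show ?thesis
      by (intro exI[of _ "\<lambda>(i, j). u i j"]) (simp add: sum.cartesian_product')
  qed
  show ?thesis
    unfolding storage_factors_def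
  proof (rule exI[of _ "\<lambda>y (i, j). \<rho>B y $$ (i, j)"], fold a_def b_def, intro conjI ballI allI impI)
    fix y :: "bit vec" assume "y \<in> carrier_vec n"
    then show "(\<Sum>t\<in>{..<b} \<times> {..<b}. (cmod (case t of (i, j) \<Rightarrow> \<rho>B y $$ (i, j)))\<^sup>2) \<le> 1"
      using vQ by (simp add: case_prod_beta)
  next
    fix x :: "bit vec" and S assume "x \<in> carrier_vec n" "contraction {..<a * b} {..<a * b} S"
    from u[OF this] show "\<exists>u. (\<Sum>t\<in>{..<b} \<times> {..<b}. (cmod (u t))\<^sup>2) \<le> 2 ^ b2 \<and>
      (\<forall>y\<in>carrier_vec n. (\<Sum>s<a * b. \<Sum>s'<a * b. \<rho> x y $$ (s, s') * S s' s)
        = (\<Sum>t\<in>{..<b} \<times> {..<b}. u t * (case t of (i, j) \<Rightarrow> \<rho>B y $$ (i, j))))"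
      by (simp add: b_def)
  qed (rule herm)
qed

text \<open>Expanding the \<open>b2\<close> qubits in matrix units \<open>|i\<rangle>\<langle>j|\<close> and moving both local operations to the
  Heisenberg picture gives, for \<open>\<sigma> = \<Sum>l. |g l\<rangle>\<langle>g l|\<close>,
  \<open>tr (\<rho> x y S) = (\<Sum>i j l. \<langle>g l| X i j \<otimes> Y i j |g l\<rangle>)\<close>. The vectors are \<open>X i j |g l\<rangle>\<close> and
  \<open>Y i j\<^sup>\<dagger> |g l\<rangle>\<close>.\<close>

lemma entangled_storage_factors:
  assumes "entangled_storage n b1 b2 \<rho>"
  shows "\<exists>(T :: (nat \<times> nat \<times> nat \<times> nat \<times> nat) set) v.
    storage_factors n (2 ^ b1 * 2 ^ b2) (2 ^ b2) (2 ^ b2) \<rho> T v"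
proof -
  define a b :: nat where "a = 2 ^ b1" and "b = 2 ^ b2"
  obtain d1 d2 c1 c2 :: nat and \<sigma> \<Phi> \<Psi> where \<sigma>: "density (d1 * d2) \<sigma>"
    and \<Phi>: "\<And>x. x \<in> carrier_vec n \<Longrightarrow> quantum_operation d1 (a * c1) (\<Phi> x)"
    and \<Psi>: "\<And>y. y \<in> carrier_vec n \<Longrightarrow> quantum_operation d2 (b * c2) (\<Psi> y)"
    and \<rho>: "\<And>x y. x \<in> carrier_vec n \<Longrightarrow> y \<in> carrier_vec n \<Longrightarrow> \<rho> x y =
      tensor_map (a * c1) (b * c2) a b (discard_snd a c1) (discard_snd b c2)
        (tensor_map d1 d2 (a * c1) (b * c2) (\<Phi> x) (\<Psi> y) \<sigma>)"
  proof -
    from assms obtain a1 a2 c1 c2 \<sigma> \<Phi> \<Psi> where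
      "density (2 ^ a1 * 2 ^ a2) \<sigma>"
      "\<forall>x\<in>carrier_vec n. quantum_operation (2 ^ a1) (2 ^ (b1 + c1)) (\<Phi> x)"
      "\<forall>y\<in>carrier_vec n. quantum_operation (2 ^ a2) (2 ^ (b2 + c2)) (\<Psi> y)"
      "\<forall>x\<in>carrier_vec n. \<forall>y\<in>carrier_vec n. \<rho> x y =
         tensor_map (2 ^ (b1 + c1)) (2 ^ (b2 + c2)) (2 ^ b1) (2 ^ b2)
           (discard_snd (2 ^ b1) (2 ^ c1)) (discard_snd (2 ^ b2) (2 ^ c2))
           (tensor_map (2 ^ a1) (2 ^ a2) (2 ^ (b1 + c1)) (2 ^ (b2 + c2)) (\<Phi> x) (\<Psi> y) \<sigma>)"
      unfolding entangled_storage_def by blast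
    then show thesis
      by (intro that[of "2 ^ a1" "2 ^ a2" \<sigma> "2 ^ c1" \<Phi> "2 ^ c2" \<Psi>])
        (auto simp: a_def b_def power_add)
  qed
  have "\<forall>x\<in>carrier_vec n. \<exists>EV. finite (fst EV) \<and>
      isometry ({..<a} \<times> (fst EV :: (nat \<times> nat) set)) {..<d1} (\<lambda>(a, e). snd EV a e) \<and>
      (\<forall>i<d1. \<forall>j<d1. \<forall>\<alpha><a. \<forall>\<beta><a. (\<Sum>\<gamma><c1. \<Phi> x (mat_unit d1 i j) $$ (\<alpha> * c1 + \<gamma>, \<beta> * c1 + \<gamma>))
        = (\<Sum>e\<in>fst EV. snd EV \<alpha> e i * cnj (snd EV \<beta> e j)))"
    using quantum_operation_discard[OF \<Phi>] by simp
  from bchoice[OF this] obtain EV where EV: "\<forall>x\<in>carrier_vec n. finite (fst (EV x)) \<and>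
      isometry ({..<a} \<times> (fst (EV x) :: (nat \<times> nat) set)) {..<d1} (\<lambda>(a, e). snd (EV x) a e) \<and>
      (\<forall>i<d1. \<forall>j<d1. \<forall>\<alpha><a. \<forall>\<beta><a. (\<Sum>\<gamma><c1. \<Phi> x (mat_unit d1 i j) $$ (\<alpha> * c1 + \<gamma>, \<beta> * c1 + \<gamma>))
        = (\<Sum>e\<in>fst (EV x). snd (EV x) \<alpha> e i * cnj (snd (EV x) \<beta> e j)))"
    by blast
  have "\<forall>y\<in>carrier_vec n. \<exists>FW. finite (fst FW) \<and>
      isometry ({..<b} \<times> (fst FW :: (nat \<times> nat) set)) {..<d2} (\<lambda>(a, e). snd FW a e) \<and>
      (\<forall>i<d2. \<forall>j<d2. \<forall>\<alpha><b. \<forall>\<beta><b. (\<Sum>\<gamma><c2. \<Psi> y (mat_unit d2 i j) $$ (\<alpha> * c2 + \<gamma>, \<beta> * c2 + \<gamma>))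
        = (\<Sum>e\<in>fst FW. snd FW \<alpha> e i * cnj (snd FW \<beta> e j)))"
    using quantum_operation_discard[OF \<Psi>] by simp
  from bchoice[OF this] obtain FW where FW: "\<forall>y\<in>carrier_vec n. finite (fst (FW y)) \<and>
      isometry ({..<b} \<times> (fst (FW y) :: (nat \<times> nat) set)) {..<d2} (\<lambda>(a, e). snd (FW y) a e) \<and>
      (\<forall>i<d2. \<forall>j<d2. \<forall>\<alpha><b. \<forall>\<beta><b. (\<Sum>\<gamma><c2. \<Psi> y (mat_unit d2 i j) $$ (\<alpha> * c2 + \<gamma>, \<beta> * c2 + \<gamma>))
        = (\<Sum>e\<in>fst (FW y). snd (FW y) \<alpha> e i * cnj (snd (FW y) \<beta> e j)))"
    by blast
  define E V F W where "E x = fst (EV x)" and "V x = snd (EV x)"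
    and "F y = fst (FW y)" and "W y = snd (FW y)" for x y
  \<comment> \<open>The \<open>(\<alpha>, \<beta>)\<close> entry of Alice's stored state when her
    operation acts on |p><p'|; \<open>WW\<close> is the same for Bob.\<close>
  define VV where "VV x \<alpha> \<beta> p p' = (\<Sum>e\<in>E x. V x \<alpha> e p * cnj (V x \<beta> e p'))" for x \<alpha> \<beta> p p'
  define WW where "WW y i j q q' = (\<Sum>f\<in>F y. W y i f q * cnj (W y j f q'))" for y i j q q'
  have V: "isometry ({..<a} \<times> E x) {..<d1} (\<lambda>(a, e). V x a e)" if "x \<in> carrier_vec n" for x
    using EV that by (simp add: E_def V_def)
  have W: "finite (F y)" "isometry ({..<b} \<times> F y) {..<d2} (\<lambda>(a, e). W y a e)" if "y \<in> carrier_vec n" for y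
    using FW that by (simp_all add: F_def W_def)
  have entry: "\<rho> x y $$ (\<alpha> * b + i, \<beta> * b + j) = (\<Sum>p<d1. \<Sum>p'<d1. \<Sum>q<d2. \<Sum>q'<d2.
      \<sigma> $$ (p * d2 + q, p' * d2 + q') * (VV x \<alpha> \<beta> p p' * WW y i j q q'))"
    if "x \<in> carrier_vec n" "y \<in> carrier_vec n" "\<alpha> < a" "\<beta> < a" "i < b" "j < b" for x y \<alpha> \<beta> i j
    unfolding \<rho>[OF that(1,2)] using that EV FW
    by (intro tensor_map_storage \<Phi> \<Psi>) (auto simp: VV_def WW_def E_def F_def V_def W_def)
  have \<sigma>h: "hermitian_mat (d1 * d2) \<sigma>"
    using \<sigma> by (simp add: density_def psd_hermitian)
  have herm: "hermitian_mat (a * b) (\<rho> x y)" if xy: "x \<in> carrier_vec n" "y \<in> carrier_vec n" for x y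
    unfolding hermitian_mat_def
  proof (intro conjI allI impI)
    show "\<rho> x y \<in> carrier_mat (a * b) (a * b)"
      unfolding \<rho>[OF xy] by (rule tensor_map_carrier)
    fix s s' assume "s < a * b" "s' < a * b"
    then obtain \<alpha> i \<beta> j where *: "\<alpha> < a" "i < b" "\<beta> < a" "j < b"
      and s: "s = \<alpha> * b + i" "s' = \<beta> * b + j"
      by (elim nat_lessE_mult)
    have "\<rho> x y $$ (s', s) = (\<Sum>p<d1. \<Sum>p'<d1. \<Sum>q<d2. \<Sum>q'<d2.
        \<sigma> $$ (p * d2 + q, p' * d2 + q') * (VV x \<beta> \<alpha> p p' * WW y j i q q'))"
      unfolding s by (intro entry xy *)
    also have "\<dots> = (\<Sum>p<d1. \<Sum>p'<d1. \<Sum>q<d2. \<Sum>q'<d2.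
        \<sigma> $$ (p' * d2 + q', p * d2 + q) * (VV x \<beta> \<alpha> p' p * WW y j i q' q))"
      unfolding sum.cartesian_product
      by (rule sum.reindex_bij_witness[of _ "\<lambda>(p, p', q, q'). (p', p, q', q)" "\<lambda>(p, p', q, q'). (p', p, q', q)"])
        auto
    also have "\<dots> = cnj (\<Sum>p<d1. \<Sum>p'<d1. \<Sum>q<d2. \<Sum>q'<d2.
        \<sigma> $$ (p * d2 + q, p' * d2 + q') * (VV x \<alpha> \<beta> p p' * WW y i j q q'))"
      unfolding cnj_sum complex_cnj_mult
    proof (intro sum.cong refl)
      fix p p' q q' assume "p \<in> {..<d1}" "p' \<in> {..<d1}" "q \<in> {..<d2}" "q' \<in> {..<d2}"
      then have "\<sigma> $$ (p' * d2 + q', p * d2 + q) = cnj (\<sigma> $$ (p * d2 + q, p' * d2 + q'))"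
        by (simp add: hermitian_mat_cnj[OF \<sigma>h] index_less_mult)
      then show "\<sigma> $$ (p' * d2 + q', p * d2 + q) * (VV x \<beta> \<alpha> p' p * WW y j i q' q)
          = cnj (\<sigma> $$ (p * d2 + q, p' * d2 + q')) * (cnj (VV x \<alpha> \<beta> p p') * cnj (WW y i j q q'))"
        by (simp add: VV_def WW_def mult.commute)
    qed
    also have "\<dots> = cnj (\<rho> x y $$ (s, s'))"
      unfolding s by (subst entry) (use xy * in auto)
    finally show "\<rho> x y $$ (s', s) = cnj (\<rho> x y $$ (s, s'))" .
  qed
  obtain K :: nat and g0 where g0: "\<forall>r<d1 * d2. \<forall>s<d1 * d2. \<sigma> $$ (r, s) = (\<Sum>k<K. g0 r k * cnj (g0 s k))"
    and tr0: "(\<Sum>r<d1 * d2. \<Sum>k<K. (cmod (g0 r k))\<^sup>2) = 1"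
    using density_gram[OF \<sigma>] by blast
  define g where "g p q k = g0 (p * d2 + q) k" for p q k
  have g: "\<sigma> $$ (p * d2 + q, p' * d2 + q') = (\<Sum>k<K. g p q k * cnj (g p' q' k))"
    if "p < d1" "p' < d1" "q < d2" "q' < d2" for p p' q q'
    using that by (simp add: g0 g_def index_less_mult)
  have tr: "(\<Sum>p<d1. \<Sum>q<d2. \<Sum>k<K. (cmod (g p q k))\<^sup>2) = 1"
    using tr0 by (simp add: g_def sum_lessThan_mult)
  \<comment> \<open>Besides the matrix unit \<open>i\<close>, \<open>j\<close> of Bob's storage, the
    index records the space in which the two halves meet: \<open>p'\<close> is Alice's index after
    her operator has acted, \<open>q\<close> is Bob's index before his, and \<open>k\<close> labels
    the purification of \<open>\<sigma>\<close>.\<close>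
  define T where "T = {..<b} \<times> {..<b} \<times> {..<d1} \<times> {..<d2} \<times> {..<K}"
  have sum_T: "sum h T = (\<Sum>i<b. \<Sum>j<b. \<Sum>p<d1. \<Sum>q<d2. \<Sum>k<K. h (i, j, p, q, k))"
    for h :: "_ \<Rightarrow> 'z::comm_monoid_add"
    by (simp add: T_def sum.cartesian_product')
  define v where "v y = (\<lambda>(i, j, p', q, k). \<Sum>q'<d2. WW y i j q q' * cnj (g p' q' k))" for y
  have vQ: "(\<Sum>t\<in>T. (cmod (v y t))\<^sup>2) \<le> real b" if y: "y \<in> carrier_vec n" for y
  proof -
    \<comment> \<open>Conjugation turns an entry of \<open>v\<close> into an entry of the adjoint of
      W_i times W_j, applied to Bob's half of the purification.\<close>
    have "cmod (\<Sum>q'<d2. WW y i j q q' * cnj (g p' q' k))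
        = cmod (\<Sum>q'<d2. (\<Sum>f\<in>F y. W y j f q' * cnj (W y i f q)) * g p' q' k)" for i j p' q k
    proof -
      have "cnj (\<Sum>q'<d2. WW y i j q q' * cnj (g p' q' k))
        = (\<Sum>q'<d2. (\<Sum>f\<in>F y. W y j f q' * cnj (W y i f q)) * g p' q' k)"
        by (simp add: WW_def mult.commute)
      then show ?thesis
        by (metis complex_mod_cnj)
    qed
    then have "(\<Sum>t\<in>T. (cmod (v y t))\<^sup>2) = (\<Sum>i<b. \<Sum>j<b. \<Sum>p'<d1. \<Sum>q<d2. \<Sum>k<K.
        (cmod (\<Sum>q'<d2. (\<Sum>f\<in>F y. W y j f q' * cnj (W y i f q)) * g p' q' k))\<^sup>2)"
      by (simp add: sum_T v_def)
    also have "\<dots> = (\<Sum>i<b. \<Sum>p'<d1. \<Sum>k<K. \<Sum>j<b. \<Sum>q<d2.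
        (cmod (\<Sum>q'<d2. (\<Sum>f\<in>F y. W y j f q' * cnj (W y i f q)) * g p' q' k))\<^sup>2)"
      unfolding sum.cartesian_product
      by (rule sum.reindex_bij_witness[of _ "\<lambda>(i, p', k, j, q). (i, j, p', q, k)"
            "\<lambda>(i, j, p', q, k). (i, p', k, j, q)"]) auto
    also have "\<dots> \<le> (\<Sum>i<b. \<Sum>p'<d1. \<Sum>k<K. \<Sum>q<d2. (cmod (g p' q k))\<^sup>2)"
      by (intro sum_mono contraction_isometry_block W y) auto
    also have "\<dots> = (\<Sum>i<b. \<Sum>p'<d1. \<Sum>q<d2. \<Sum>k<K. (cmod (g p' q k))\<^sup>2)"
      by (rule sum.cong[OF refl], rule sum.cong[OF refl], rule sum.swap)
    also have "\<dots> = real b"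
      by (simp add: tr)
    finally show ?thesis .
  qed
  have u: "\<exists>u. (\<Sum>t\<in>T. (cmod (u t))\<^sup>2) \<le> real b \<and>
      (\<forall>y\<in>carrier_vec n. (\<Sum>s<a * b. \<Sum>s'<a * b. \<rho> x y $$ (s, s') * S s' s) = (\<Sum>t\<in>T. u t * v y t))"
    if x: "x \<in> carrier_vec n" and S: "contraction {..<a * b} {..<a * b} S" for x S
  proof -
    define X where "X i j p' p =
      (\<Sum>\<alpha><a. \<Sum>\<beta><a. \<Sum>e\<in>E x. cnj (V x \<beta> e p') * S (\<beta> * b + j) (\<alpha> * b + i) * V x \<alpha> e p)" for i j p' p
    define u where "u = (\<lambda>(i, j, p', q, k). \<Sum>p<d1. X i j p' p * g p q k)"
    have "(\<Sum>t\<in>T. (cmod (u t))\<^sup>2)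
        = (\<Sum>i<b. \<Sum>j<b. \<Sum>p'<d1. \<Sum>q<d2. \<Sum>k<K. (cmod (\<Sum>p<d1. X i j p' p * g p q k))\<^sup>2)"
      by (simp add: sum_T u_def)
    also have "\<dots> = (\<Sum>i<b. \<Sum>q<d2. \<Sum>k<K. \<Sum>j<b. \<Sum>p'<d1. (cmod (\<Sum>p<d1. X i j p' p * g p q k))\<^sup>2)"
      unfolding sum.cartesian_product
      by (rule sum.reindex_bij_witness[of _ "\<lambda>(i, q, k, j, p'). (i, j, p', q, k)"
            "\<lambda>(i, j, p', q, k). (i, q, k, j, p')"]) auto
    \<comment> \<open>Bob's index \<open>q\<close> and the label \<open>k\<close> are spectators:
      Alice's operators act on the vector \<open>p\<close> to \<open>g p q k\<close> alone. All of
      these together have squared length 1, once for each \<open>i\<close>.\<close>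
    also have "\<dots> \<le> (\<Sum>i<b. \<Sum>q<d2. \<Sum>k<K. \<Sum>p<d1. (cmod (g p q k))\<^sup>2)"
      unfolding X_def by (intro sum_mono contraction_isometry_conj V S x) auto
    also have "\<dots> = (\<Sum>i<b. \<Sum>p<d1. \<Sum>q<d2. \<Sum>k<K. (cmod (g p q k))\<^sup>2)"
      unfolding sum.cartesian_product
      by (rule sum.reindex_bij_witness[of _ "\<lambda>(i, p, q, k). (i, q, k, p)" "\<lambda>(i, q, k, p). (i, p, q, k)"]) auto
    also have "\<dots> = real b"
      by (simp add: tr)
    finally have "(\<Sum>t\<in>T. (cmod (u t))\<^sup>2) \<le> real b" .
    moreover have "(\<Sum>s<a * b. \<Sum>s'<a * b. \<rho> x y $$ (s, s') * S s' s) = (\<Sum>t\<in>T. u t * v y t)"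
      if y: "y \<in> carrier_vec n" for y
    proof -
      let ?G = "\<lambda>p q p' q' k. g p q k * cnj (g p' q' k)"
      have X_eq: "X i j p' p = (\<Sum>\<alpha><a. \<Sum>\<beta><a. VV x \<alpha> \<beta> p p' * S (\<beta> * b + j) (\<alpha> * b + i))" for i j p' p
        unfolding X_def VV_def sum_distrib_right by (intro sum.cong refl) (simp add: ac_simps)
      have "(\<Sum>s<a * b. \<Sum>s'<a * b. \<rho> x y $$ (s, s') * S s' s) = (\<Sum>\<alpha><a. \<Sum>i<b. \<Sum>\<beta><a. \<Sum>j<b.
          (\<Sum>p<d1. \<Sum>p'<d1. \<Sum>q<d2. \<Sum>q'<d2.
            (\<Sum>k<K. ?G p q p' q' k) * (VV x \<alpha> \<beta> p p' * WW y i j q q')) * S (\<beta> * b + j) (\<alpha> * b + i))"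
        unfolding sum_lessThan_mult
        by (intro sum.cong refl arg_cong2[where f = "(*)"])
          (simp add: entry x y g)
      also have "\<dots> = (\<Sum>\<alpha><a. \<Sum>i<b. \<Sum>\<beta><a. \<Sum>j<b. \<Sum>p<d1. \<Sum>p'<d1. \<Sum>q<d2. \<Sum>q'<d2. \<Sum>k<K.
          ?G p q p' q' k * (VV x \<alpha> \<beta> p p' * WW y i j q q') * S (\<beta> * b + j) (\<alpha> * b + i))"
        unfolding sum_distrib_right ..
      \<comment> \<open>The sums over \<open>\<alpha>\<close>, \<open>\<beta>\<close> and
        \<open>p\<close> build \<open>u\<close>, the sum over \<open>q'\<close> builds
        \<open>v\<close>, and the remaining five indices are the shared index in
        \<open>T\<close>.\<close>
      also have "\<dots> = (\<Sum>i<b. \<Sum>j<b. \<Sum>p'<d1. \<Sum>q<d2. \<Sum>k<K. \<Sum>p<d1. \<Sum>q'<d2. \<Sum>\<alpha><a. \<Sum>\<beta><a.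
          VV x \<alpha> \<beta> p p' * S (\<beta> * b + j) (\<alpha> * b + i) * g p q k * (WW y i j q q' * cnj (g p' q' k)))"
        unfolding sum.cartesian_product
        by (rule sum.reindex_bij_witness[of _
              "\<lambda>(i, j, p', q, k, p, q', \<alpha>, \<beta>). (\<alpha>, i, \<beta>, j, p, p', q, q', k)"
              "\<lambda>(\<alpha>, i, \<beta>, j, p, p', q, q', k). (i, j, p', q, k, p, q', \<alpha>, \<beta>)"])
          (auto simp: ac_simps)
      also have "\<dots> = (\<Sum>t\<in>T. u t * v y t)"
        unfolding sum_T u_def v_def prod.case sum_product unfolding X_eq sum_distrib_right ..
      finally show ?thesis .
    qed
    ultimately show ?thesis by blast
  qed
  have "storage_factors n (a * b) b b \<rho> T v"
    unfolding storage_factors_def using herm vQ u by blast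
  then show ?thesis
    by (auto simp: a_def b_def)
qed

section \<open>Collisions of the DEOR extractor\<close>

lemma bits_index_vCons:
  "bits_index (vCons b x) = of_bool (b = 1) * 2 ^ dim_vec x + bits_index x"
  by (simp add: bits_index_def sum.lessThan_Suc_shift del: sum.lessThan_Suc)

lemma bits_index_less: "x \<in> carrier_vec n \<Longrightarrow> bits_index x < 2 ^ n"
proof (induction n arbitrary: x)
  case 0
  then show ?case by (simp add: bits_index_def)
next
  case (Suc n)
  then obtain b y where x: "x = vCons b y" "y \<in> carrier_vec n"
    by (cases x) auto
  then show ?case
    using Suc.IH[of y] by (auto simp: bits_index_vCons)
qed

lemma inj_on_bits_index: "inj_on bits_index (carrier_vec n)"
proof (induction n)
  case 0
  show ?case by (auto simp: inj_on_def)
next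
  case (Suc n)
  show ?case
  proof (rule inj_onI)
    fix x y :: "bit vec"
    assume xy: "x \<in> carrier_vec (Suc n)" "y \<in> carrier_vec (Suc n)" "bits_index x = bits_index y"
    then obtain a v b w where *: "x = vCons a v" "v \<in> carrier_vec n" "y = vCons b w" "w \<in> carrier_vec n"
      by (cases x; cases y) auto
    have eq: "of_bool (a = 1) * 2 ^ n + bits_index v = of_bool (b = 1) * 2 ^ n + bits_index w"
      using xy(3) * by (simp add: bits_index_vCons)
    have less: "bits_index v < 2 ^ n" "bits_index w < 2 ^ n"
      using * bits_index_less by auto
    have "a = b"
      using eq less by (cases "a = 1"; cases "b = 1") auto
    moreover from this have "v = w"
      using eq * Suc.IH by (auto dest: inj_onD)
    ultimately show "x = y"
      using * by simp
  qed
qed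

lemma finite_carrier_bit_vec: "finite (carrier_vec n :: bit vec set)"
  by (rule inj_on_finite[OF inj_on_bits_index, of _ "{..<2 ^ n}"]) (auto simp: bits_index_less)

lemma card_carrier_bit_vec: "card (carrier_vec n :: bit vec set) \<le> 2 ^ n"
proof -
  have "bits_index ` carrier_vec n \<subseteq> {..<2 ^ n}"
    by (auto simp: bits_index_less)
  from card_inj_on_le[OF inj_on_bits_index this] show ?thesis
    by simp
qed

text \<open>The nontrivial character of the additive group of GF(2).\<close>

definition bit_sign :: "bit \<Rightarrow> real" where
  "bit_sign b = (if b = 0 then 1 else - 1)"

lemma bit_add_eq_0_iff: "a + b = 0 \<longleftrightarrow> a = b" for a b :: bit
  by (cases "a = 0"; cases "b = 0") simp_all

lemma bit_sign_0 [simp]: "bit_sign 0 = 1"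
  by (simp add: bit_sign_def)

lemma bit_sign_add: "bit_sign (a + b) = bit_sign a * bit_sign b"
  by (cases "a = 0"; cases "b = 0") (simp_all add: bit_sign_def)

lemma bit_sign_sum: "bit_sign (\<Sum>i\<in>I. f i) = (\<Prod>i\<in>I. bit_sign (f i))"
  by (induction I rule: infinite_finite_induct) (simp_all add: bit_sign_add del: add_bit_eq_xor)

text \<open>Some unit vector \<open>e\<close> has \<open>e \<bullet> w = 1\<close>, and translation
  by \<open>e\<close> permutes the vectors while flipping every sign.\<close>

lemma sum_bit_sign:
  assumes w: "w \<in> carrier_vec n" "w \<noteq> 0\<^sub>v n"
  shows "(\<Sum>x\<in>carrier_vec n. bit_sign (x \<bullet> w)) = 0"
proof -
  obtain i where i: "i < n" "w $ i = 1"
    using w by (metis bit_not_zero_iff carrier_vecD eq_vecI index_zero_vec)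
  define e where "e = (unit_vec n i :: bit vec)"
  have e: "e \<in> carrier_vec n" "e \<bullet> w = 1"
    using i w by (auto simp: e_def)
  have ee: "x + e + e = x" if "x \<in> carrier_vec n" for x
    using that by (intro eq_vecI) (auto simp: e_def)
  have "(\<Sum>x\<in>carrier_vec n. bit_sign (x \<bullet> w)) = (\<Sum>x\<in>carrier_vec n. bit_sign ((x + e) \<bullet> w))"
    by (rule sum.reindex_bij_witness[of _ "\<lambda>x. x + e" "\<lambda>x. x + e"]) (use e ee in auto)
  also have "\<dots> = (\<Sum>x\<in>carrier_vec n. - bit_sign (x \<bullet> w))"
  proof (rule sum.cong[OF refl])
    fix x :: "bit vec" assume "x \<in> carrier_vec n"
    then show "bit_sign ((x + e) \<bullet> w) = - bit_sign (x \<bullet> w)"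
      using e w by (simp add: add_scalar_prod_distrib[of _ n] bit_sign_add) (simp add: bit_sign_def)
  qed
  finally show ?thesis
    by (simp add: sum_negf)
qed

lemma msum_mult_vec_scalar_prod:
  fixes A :: "'i \<Rightarrow> 'a::comm_semiring_0 mat"
  assumes A: "\<And>i. i \<in> S \<Longrightarrow> A i \<in> carrier_mat n n" and x: "x \<in> carrier_vec n" and w: "w \<in> carrier_vec n"
  shows "(msum n n A S *\<^sub>v x) \<bullet> w = (\<Sum>i\<in>S. (A i *\<^sub>v x) \<bullet> w)"
proof -
  have summand: "(A i *\<^sub>v x) \<bullet> w = (\<Sum>a<n. \<Sum>b<n. A i $$ (a, b) * x $ b * w $ a)" if "i \<in> S" for i
    using A[OF that] x w by (auto simp: scalar_prod_def atLeast0LessThan sum_distrib_right)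
  have "(msum n n A S *\<^sub>v x) \<bullet> w = (\<Sum>a<n. (\<Sum>b<n. (\<Sum>i\<in>S. A i $$ (a, b)) * x $ b) * w $ a)"
    using x w by (simp add: msum_def scalar_prod_def atLeast0LessThan)
  also have "\<dots> = (\<Sum>a<n. \<Sum>b<n. \<Sum>i\<in>S. A i $$ (a, b) * x $ b * w $ a)"
    by (simp only: sum_distrib_right)
  also have "\<dots> = (\<Sum>a<n. \<Sum>i\<in>S. \<Sum>b<n. A i $$ (a, b) * x $ b * w $ a)"
    by (rule sum.cong[OF refl], rule sum.swap)
  also have "\<dots> = (\<Sum>i\<in>S. \<Sum>a<n. \<Sum>b<n. A i $$ (a, b) * x $ b * w $ a)"
    by (rule sum.swap)
  also have "\<dots> = (\<Sum>i\<in>S. (A i *\<^sub>v x) \<bullet> w)"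
    by (intro sum.cong refl summand[symmetric])
  finally show ?thesis .
qed

text \<open>Moving \<open>M\<close> to the other argument gives the character with parameter
  \<open>transpose_mat M *\<^sub>v w\<close>, which is nonzero since \<open>M\<close> is
  invertible.\<close>

lemma sum_bit_sign_full_rank:
  fixes M :: "bit mat"
  assumes M: "M \<in> carrier_mat n n" "vec_space.rank n M = n"
    and w: "w \<in> carrier_vec n" "w \<noteq> 0\<^sub>v n"
  shows "(\<Sum>x\<in>carrier_vec n. bit_sign ((M *\<^sub>v x) \<bullet> w)) = 0"
proof -
  have "det (transpose_mat M) \<noteq> 0"
    using vec_space.det_rank_iff[OF M(1)] M by (simp add: det_transpose)
  then have "transpose_mat M *\<^sub>v w \<noteq> 0\<^sub>v n"
    using det_0_iff_vec_prod_zero_field[of "transpose_mat M" n] M w by auto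
  moreover have "(M *\<^sub>v x) \<bullet> w = x \<bullet> (transpose_mat M *\<^sub>v w)" if "x \<in> carrier_vec n" for x
    using transpose_vec_mult_scalar[of M n n x w] that M w
    by (metis comm_scalar_prod mult_mat_vec_carrier transpose_carrier_mat)
  moreover have "transpose_mat M *\<^sub>v w \<in> carrier_vec n"
    using mult_mat_vec_carrier[of "transpose_mat M" n n w] M w by simp
  ultimately show ?thesis
    using sum_bit_sign[of "transpose_mat M *\<^sub>v w" n] by simp
qed

text \<open>The collision indicator is a product over the output bits; expanding it gives one
  character sum for each set \<open>S\<close> of bits. The full rank condition for the sum of the
  matrices in \<open>S\<close> kills every nonempty \<open>S\<close>, and the empty one counts all
  \<open>x\<close>.\<close>

lemma deor_collisions:
  assumes A: "deor_matrices n m A" and y: "y \<in> carrier_vec n" "y' \<in> carrier_vec n" "y \<noteq> y'"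
  shows "2 ^ m * (\<Sum>x\<in>carrier_vec n. of_bool (deor_extractor m A x y = deor_extractor m A x y'))
    = real (card (carrier_vec n :: bit vec set))"
proof -
  have car: "A i \<in> carrier_mat n n" if "i < m" for i
    using A that by (simp add: deor_matrices_def)
  \<comment> \<open>Over GF(2) the sum is the difference, so outputs collide exactly when all
    \<open>m\<close> bits vanish at \<open>w\<close>.\<close>
  define w where "w = y + y'"
  have w: "w \<in> carrier_vec n" "w \<noteq> 0\<^sub>v n"
  proof -
    show "w \<in> carrier_vec n" using y by (simp add: w_def)
    show "w \<noteq> 0\<^sub>v n"
    proof
      assume "w = 0\<^sub>v n"
      then have "y $ i + y' $ i = 0" if "i < n" for i
        using that y by (metis carrier_vecD index_add_vec(1) index_zero_vec(1) w_def)
      then have "y $ i = y' $ i" if "i < n" for i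
        using that by (metis bit_add_eq_0_iff)
      then show False
        using y by auto
    qed
  qed
  let ?s = "\<lambda>x i. bit_sign ((A i *\<^sub>v x) \<bullet> w)"
  have indicator: "2 ^ m * of_bool (deor_extractor m A x y = deor_extractor m A x y')
      = (\<Sum>S\<in>Pow {..<m}. \<Prod>i\<in>S. ?s x i)" if x: "x \<in> carrier_vec n" for x
  proof -
    have Aw: "(A i *\<^sub>v x) \<bullet> w = (A i *\<^sub>v x) \<bullet> y + (A i *\<^sub>v x) \<bullet> y'" if "i < m" for i
      unfolding w_def using car[OF that] x y by (intro scalar_prod_add_distrib) auto
    have E: "deor_extractor m A x y = deor_extractor m A x y' \<longleftrightarrow> (\<forall>i<m. (A i *\<^sub>v x) \<bullet> w = 0)"
      by (auto simp: deor_extractor_def vec_eq_iff Aw bit_add_eq_0_iff)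
    \<comment> \<open>Each factor is 2 if bit \<open>i\<close> vanishes at \<open>w\<close> and 0
      otherwise.\<close>
    have "(\<Prod>i<m. ?s x i + 1) = 2 ^ m * of_bool (\<forall>i<m. (A i *\<^sub>v x) \<bullet> w = 0)"
    proof (cases "\<forall>i<m. (A i *\<^sub>v x) \<bullet> w = 0")
      case True
      then show ?thesis by (simp add: bit_sign_def)
    next
      case False
      then show ?thesis by (auto simp: bit_sign_def intro!: prod_zero)
    qed
    then show ?thesis
      unfolding E by (simp add: prod_add)
  qed
  have "(\<Sum>x\<in>carrier_vec n. \<Prod>i\<in>S. ?s x i) = 0" if S: "S \<subseteq> {..<m}" "S \<noteq> {}" for S
  proof -
    have "(\<Prod>i\<in>S. ?s x i) = bit_sign ((msum n n A S *\<^sub>v x) \<bullet> w)" if "x \<in> carrier_vec n" for x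
      using S car w(1) that by (subst msum_mult_vec_scalar_prod) (auto simp: bit_sign_sum)
    moreover have "vec_space.rank n (msum n n A S) = n"
      using A S by (simp add: deor_matrices_def)
    ultimately show ?thesis
      using sum_bit_sign_full_rank[of "msum n n A S" n w] w by simp
  qed
  then have "(\<Sum>S\<in>Pow {..<m}. \<Sum>x\<in>carrier_vec n. \<Prod>i\<in>S. ?s x i)
      = (\<Sum>S\<in>Pow {..<m}. if S = {} then real (card (carrier_vec n :: bit vec set)) else 0)"
    by (intro sum.cong refl) auto
  also have "\<dots> = real (card (carrier_vec n :: bit vec set))"
    by simp
  finally have total: "(\<Sum>S\<in>Pow {..<m}. \<Sum>x\<in>carrier_vec n. \<Prod>i\<in>S. ?s x i)
      = real (card (carrier_vec n :: bit vec set))" .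
  have "2 ^ m * (\<Sum>x\<in>carrier_vec n. of_bool (deor_extractor m A x y = deor_extractor m A x y'))
      = (\<Sum>x\<in>carrier_vec n. \<Sum>S\<in>Pow {..<m}. \<Prod>i\<in>S. ?s x i)"
    unfolding sum_distrib_left by (intro sum.cong refl indicator)
  also note sum.swap
  also note total
  finally show ?thesis .
qed

text \<open>Here \<open>z\<close> is a basis position of the output register, so that it also labels
  the diagonal blocks of the operator to be bounded.\<close>

definition deor_bias :: "nat \<Rightarrow> (nat \<Rightarrow> bit mat) \<Rightarrow> bit vec \<Rightarrow> bit vec \<Rightarrow> nat \<Rightarrow> real" where
  "deor_bias m A x y z = of_bool (bits_index (deor_extractor m A x y) = z) - 1 / 2 ^ m"

lemma deor_extractor_carrier [simp]: "deor_extractor m A x y \<in> carrier_vec m"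
  by (simp add: deor_extractor_def)

lemma sum_deor_bias_mult:
  "(\<Sum>z<2 ^ m. deor_bias m A x y z * deor_bias m A x y' z)
    = of_bool (deor_extractor m A x y = deor_extractor m A x y') - 1 / 2 ^ m"
proof -
  let ?e = "bits_index (deor_extractor m A x y)" and ?e' = "bits_index (deor_extractor m A x y')"
  have less: "?e < 2 ^ m" "?e' < 2 ^ m"
    by (simp_all add: bits_index_less)
  have "(\<Sum>z<2 ^ m. deor_bias m A x y z * deor_bias m A x y' z)
      = (\<Sum>z<2 ^ m. (if z = ?e then of_bool (?e = ?e') else 0) - (if z = ?e then 1 / 2 ^ m else 0)
          - (if z = ?e' then 1 / 2 ^ m else 0) + 1 / 2 ^ m * (1 / 2 ^ m))"
    by (intro sum.cong refl) (auto simp: deor_bias_def algebra_simps)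
  also have "\<dots> = of_bool (?e = ?e') - 1 / 2 ^ m"
    using less by (simp add: sum.distrib sum_subtractf)
  also have "?e = ?e' \<longleftrightarrow> deor_extractor m A x y = deor_extractor m A x y'"
    using inj_onD[OF inj_on_bits_index] by (metis deor_extractor_carrier)
  finally show ?thesis .
qed

text \<open>A Parseval argument: as functions of \<open>x\<close> and \<open>z\<close>, the biases
  for different \<open>y\<close> are orthogonal, because a collision probability of exactly
  \<open>1 / 2 ^ m\<close> equals the term subtracted by centring. Only the diagonal of the Gram
  matrix \<open>G\<close> remains.\<close>

lemma deor_second_moment:
  fixes a :: "bit vec \<Rightarrow> complex"
  assumes A: "deor_matrices n m A"
  shows "(\<Sum>x\<in>carrier_vec n. \<Sum>z<2 ^ m. (cmod (\<Sum>y\<in>carrier_vec n. of_real (deor_bias m A x y z) * a y))\<^sup>2)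
    \<le> 2 ^ n * (\<Sum>y\<in>carrier_vec n. (cmod (a y))\<^sup>2)"
proof -
  let ?C = "carrier_vec n :: bit vec set"
  let ?c = "\<lambda>x y z. complex_of_real (deor_bias m A x y z)"
  have G: "(\<Sum>x\<in>?C. \<Sum>z<2 ^ m. ?c x y z * ?c x y' z)
      = of_real (if y = y' then real (card ?C) * (1 - 1 / 2 ^ m) else 0)"
    if "y \<in> ?C" "y' \<in> ?C" for y y'
  proof -
    have "(\<Sum>x\<in>?C. \<Sum>z<2 ^ m. ?c x y z * ?c x y' z) = of_real (\<Sum>x\<in>?C.
        of_bool (deor_extractor m A x y = deor_extractor m A x y') - 1 / 2 ^ m)"
      by (simp only: sum_deor_bias_mult[symmetric] of_real_sum of_real_mult)
    also have "(\<Sum>x\<in>?C. of_bool (deor_extractor m A x y = deor_extractor m A x y') - 1 / 2 ^ m)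
        = (if y = y' then real (card ?C) * (1 - 1 / 2 ^ m) else 0)"
    proof (cases "y = y'")
      case False
      have "(\<Sum>x\<in>?C. of_bool (deor_extractor m A x y = deor_extractor m A x y'))
          = real (card ?C) / 2 ^ m"
        using deor_collisions[OF A that False] by (simp add: eq_divide_eq mult.commute)
      then show ?thesis
        using False by (simp only: sum_subtractf) simp
    qed simp
    finally show ?thesis .
  qed
  have "complex_of_real (\<Sum>x\<in>?C. \<Sum>z<2 ^ m. (cmod (\<Sum>y\<in>?C. ?c x y z * a y))\<^sup>2)
      = (\<Sum>x\<in>?C. \<Sum>z<2 ^ m. (\<Sum>y\<in>?C. ?c x y z * a y) * (\<Sum>y'\<in>?C. ?c x y' z * cnj (a y')))"
    unfolding of_real_sum[of _ ?C] of_real_sum_cmod_square by simp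
  also have "\<dots> = (\<Sum>x\<in>?C. \<Sum>z<2 ^ m. \<Sum>y\<in>?C. \<Sum>y'\<in>?C. (?c x y z * a y) * (?c x y' z * cnj (a y')))"
    by (simp only: sum_product)
  also have "\<dots> = (\<Sum>y\<in>?C. \<Sum>y'\<in>?C. \<Sum>x\<in>?C. \<Sum>z<2 ^ m. (a y * cnj (a y')) * (?c x y z * ?c x y' z))"
    unfolding sum.cartesian_product
    by (rule sum.reindex_bij_witness[of _ "\<lambda>(y, y', x, z). (x, z, y, y')" "\<lambda>(x, z, y, y'). (y, y', x, z)"])
      (auto simp: ac_simps)
  also have "\<dots> = (\<Sum>y\<in>?C. \<Sum>y'\<in>?C. (a y * cnj (a y')) * (\<Sum>x\<in>?C. \<Sum>z<2 ^ m. ?c x y z * ?c x y' z))"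
    by (simp only: sum_distrib_left)
  also have "\<dots> = (\<Sum>y\<in>?C. \<Sum>y'\<in>?C. if y' = y then (a y * cnj (a y)) * of_real (real (card ?C) * (1 - 1 / 2 ^ m)) else 0)"
    by (intro sum.cong refl) (simp add: G)
  also have "\<dots> = (\<Sum>y\<in>?C. (a y * cnj (a y)) * of_real (real (card ?C) * (1 - 1 / 2 ^ m)))"
    using finite_carrier_bit_vec by simp
  also have "\<dots> = of_real (real (card ?C) * (1 - 1 / 2 ^ m) * (\<Sum>y\<in>?C. (cmod (a y))\<^sup>2))"
    unfolding of_real_mult[of "real (card ?C) * (1 - 1 / 2 ^ m)"] of_real_sum_cmod_square
    unfolding sum_distrib_left
    by (intro sum.cong refl) (rule mult.commute)
  finally have "(\<Sum>x\<in>?C. \<Sum>z<2 ^ m. (cmod (\<Sum>y\<in>?C. ?c x y z * a y))\<^sup>2)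
      = real (card ?C) * (1 - 1 / 2 ^ m) * (\<Sum>y\<in>?C. (cmod (a y))\<^sup>2)"
    by (simp only: of_real_eq_iff)
  also have "\<dots> \<le> 2 ^ n * (\<Sum>y\<in>?C. (cmod (a y))\<^sup>2)"
  proof (rule mult_right_mono)
    have "real (card ?C) * (1 - 1 / 2 ^ m) \<le> real (card ?C) * 1"
      by (intro mult_left_mono) auto
    also have "\<dots> \<le> 2 ^ n"
      using of_nat_mono[OF card_carrier_bit_vec[of n], where ?'a = real] by simp
    finally show "real (card ?C) * (1 - 1 / 2 ^ m) \<le> 2 ^ n" .
  qed (simp add: sum_nonneg)
  finally show ?thesis .
qed

section \<open>The extractor bound\<close>

text \<open>A submatrix of a contraction is a contraction: extend the argument by zeros and drop
  rows. It cuts the observable down to the block of a fixed output and a fixed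
  \<open>x\<close>.\<close>

lemma contraction_reindex:
  assumes T: "contraction R C T" and R: "finite R" and C: "finite C"
    and f: "inj_on f A" "f ` A \<subseteq> R" and g: "inj_on g B" "g ` B \<subseteq> C"
  shows "contraction A B (\<lambda>a b. T (f a) (g b))"
  unfolding contraction_def
proof
  fix \<psi> :: "'d \<Rightarrow> complex"
  define \<psi>' where "\<psi>' c = (if c \<in> g ` B then \<psi> (inv_into B g c) else 0)" for c
  have \<psi>': "\<psi>' (g b) = \<psi> b" if "b \<in> B" for b
    using that g(1) by (simp add: \<psi>'_def)
  have out: "\<psi>' c = 0" if "c \<notin> g ` B" for c
    using that by (simp add: \<psi>'_def)
  have row: "(\<Sum>b\<in>B. T (f a) (g b) * \<psi> b) = (\<Sum>c\<in>C. T (f a) c * \<psi>' c)" for a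
  proof -
    have "(\<Sum>c\<in>C. T (f a) c * \<psi>' c) = (\<Sum>c\<in>g ` B. T (f a) c * \<psi>' c)"
      using C g(2) by (intro sum.mono_neutral_right) (auto simp: out)
    then show ?thesis
      using g(1) by (simp add: sum.reindex \<psi>')
  qed
  have "(\<Sum>a\<in>A. (cmod (\<Sum>b\<in>B. T (f a) (g b) * \<psi> b))\<^sup>2) = (\<Sum>r\<in>f ` A. (cmod (\<Sum>c\<in>C. T r c * \<psi>' c))\<^sup>2)"
    unfolding row using f(1) by (simp add: sum.reindex)
  also have "\<dots> \<le> (\<Sum>r\<in>R. (cmod (\<Sum>c\<in>C. T r c * \<psi>' c))\<^sup>2)"
    using R f(2) by (intro sum_mono2) auto
  also have "\<dots> \<le> (\<Sum>c\<in>C. (cmod (\<psi>' c))\<^sup>2)"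
    by (rule contractionD[OF T])
  also have "\<dots> = (\<Sum>c\<in>g ` B. (cmod (\<psi>' c))\<^sup>2)"
    using C g(2) by (intro sum.mono_neutral_right) (auto simp: out)
  also have "\<dots> = (\<Sum>b\<in>B. (cmod (\<psi> b))\<^sup>2)"
    using g(1) by (simp add: sum.reindex \<psi>')
  finally show "(\<Sum>a\<in>A. (cmod (\<Sum>b\<in>B. T (f a) (g b) * \<psi> b))\<^sup>2) \<le> (\<Sum>b\<in>B. (cmod (\<psi> b))\<^sup>2)" .
qed

lemma source_sum:
  assumes "source n k X"
  shows "(\<Sum>x\<in>carrier_vec n. pmf X x) = 1"
  using assms finite_carrier_bit_vec by (intro sum_pmf_eq_1) (auto simp: source_def)

text \<open>The weight of \<open>x\<close> is split into two square roots before Cauchy--Schwarz.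
  The half with \<open>u\<close> keeps the weights, which sum to 1; in the half with
  \<open>v\<close> they are bounded by \<open>2 powr (- k1)\<close>, so that the second moment over
  uniform \<open>x\<close> applies.\<close>

lemma deor_weighted_bound:
  assumes A: "deor_matrices n m A" and X: "source n k1 X" and Y: "source n k2 Y"
    and u: "\<And>x z. x \<in> carrier_vec n \<Longrightarrow> z < 2 ^ m \<Longrightarrow> (\<Sum>t\<in>T. (cmod (u x z t))\<^sup>2) \<le> P"
    and v: "\<And>y. y \<in> carrier_vec n \<Longrightarrow> (\<Sum>t\<in>T. (cmod (v y t))\<^sup>2) \<le> Q"
  shows "(cmod (\<Sum>x\<in>carrier_vec n. \<Sum>z<2 ^ m. \<Sum>y\<in>carrier_vec n.
      of_real (pmf X x * pmf Y y * deor_bias m A x y z) * (\<Sum>t\<in>T. u x z t * v y t)))\<^sup>2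
    \<le> 2 ^ m * P * (2 powr (real n - k1 - k2) * Q)"
proof -
  let ?C = "carrier_vec n :: bit vec set"
  let ?Z = "{..<2 ^ m} :: nat set"
  define h where "h x z t = (\<Sum>y\<in>?C. of_real (deor_bias m A x y z) * (of_real (pmf Y y) * v y t))" for x z t
  define \<alpha> \<beta> where "\<alpha> = (\<lambda>(x, z, t). of_real (sqrt (pmf X x)) * u x z t)"
    and "\<beta> = (\<lambda>(x, z, t). of_real (sqrt (pmf X x)) * h x z t)"
  let ?I = "?C \<times> ?Z \<times> T"
  have sqrt_sq: "complex_of_real (sqrt (pmf X x)) * of_real (sqrt (pmf X x)) = of_real (pmf X x)" for x
    by (simp flip: of_real_mult)
  have split: "(\<Sum>z\<in>?Z. \<Sum>y\<in>?C. of_real (pmf X x * pmf Y y * deor_bias m A x y z) * (\<Sum>t\<in>T. u x z t * v y t))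
      = (\<Sum>z\<in>?Z. \<Sum>t\<in>T. \<alpha> (x, z, t) * \<beta> (x, z, t))" for x
  proof (rule sum.cong[OF refl])
    fix z
    have "(\<Sum>y\<in>?C. of_real (pmf X x * pmf Y y * deor_bias m A x y z) * (\<Sum>t\<in>T. u x z t * v y t))
        = (\<Sum>t\<in>T. of_real (pmf X x) * (u x z t * h x z t))"
      unfolding h_def sum_distrib_left by (subst sum.swap) (simp add: ac_simps)
    also have "\<dots> = (\<Sum>t\<in>T. \<alpha> (x, z, t) * \<beta> (x, z, t))"
      by (intro sum.cong refl) (simp add: \<alpha>_def \<beta>_def flip: sqrt_sq)
    finally show "(\<Sum>y\<in>?C. of_real (pmf X x * pmf Y y * deor_bias m A x y z) * (\<Sum>t\<in>T. u x z t * v y t))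
        = (\<Sum>t\<in>T. \<alpha> (x, z, t) * \<beta> (x, z, t))" .
  qed
  have \<alpha>_bound: "(\<Sum>i\<in>?I. (cmod (\<alpha> i))\<^sup>2) \<le> 2 ^ m * P"
  proof -
    have "(\<Sum>i\<in>?I. (cmod (\<alpha> i))\<^sup>2) = (\<Sum>x\<in>?C. pmf X x * (\<Sum>z\<in>?Z. \<Sum>t\<in>T. (cmod (u x z t))\<^sup>2))"
      by (simp add: \<alpha>_def sum.cartesian_product' norm_mult power_mult_distrib sum_distrib_left)
    also have "\<dots> \<le> (\<Sum>x\<in>?C. pmf X x * (\<Sum>z\<in>?Z. P))"
      by (intro sum_mono mult_left_mono u) auto
    also have "\<dots> = 2 ^ m * P"
      using source_sum[OF X] by (simp flip: sum_distrib_right)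
    finally show ?thesis .
  qed
  have \<beta>_bound: "(\<Sum>i\<in>?I. (cmod (\<beta> i))\<^sup>2) \<le> 2 powr (real n - k1 - k2) * Q"
  proof -
    have "(\<Sum>i\<in>?I. (cmod (\<beta> i))\<^sup>2) = (\<Sum>x\<in>?C. \<Sum>z\<in>?Z. \<Sum>t\<in>T. pmf X x * (cmod (h x z t))\<^sup>2)"
      by (simp add: \<beta>_def sum.cartesian_product' norm_mult power_mult_distrib)
    also have "\<dots> \<le> (\<Sum>x\<in>?C. \<Sum>z\<in>?Z. \<Sum>t\<in>T. 2 powr (- k1) * (cmod (h x z t))\<^sup>2)"
      using X by (intro sum_mono mult_right_mono) (auto simp: source_def)
    also have "\<dots> = 2 powr (- k1) * (\<Sum>t\<in>T. \<Sum>x\<in>?C. \<Sum>z\<in>?Z. (cmod (h x z t))\<^sup>2)"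
      unfolding sum_distrib_left sum.cartesian_product
      by (rule sum.reindex_bij_witness[of _ "\<lambda>(t, x, z). (x, z, t)" "\<lambda>(x, z, t). (t, x, z)"]) auto
    also have "\<dots> \<le> 2 powr (- k1) * (\<Sum>t\<in>T. 2 ^ n * (\<Sum>y\<in>?C. (cmod (of_real (pmf Y y) * v y t))\<^sup>2))"
      unfolding h_def by (intro mult_left_mono sum_mono deor_second_moment[OF A]) auto
    also have "(\<Sum>t\<in>T. 2 ^ n * (\<Sum>y\<in>?C. (cmod (of_real (pmf Y y) * v y t))\<^sup>2))
        = 2 ^ n * (\<Sum>y\<in>?C. (pmf Y y)\<^sup>2 * (\<Sum>t\<in>T. (cmod (v y t))\<^sup>2))"
      unfolding sum_distrib_left by (subst sum.swap) (simp add: norm_mult power_mult_distrib)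
    \<comment> \<open>The weight of \<open>y\<close> is squared at this point: one factor is bounded
      by the min-entropy, the other still sums to 1.\<close>
    also have "\<dots> \<le> 2 ^ n * (\<Sum>y\<in>?C. pmf Y y * (2 powr (- k2) * Q))"
    proof (intro mult_left_mono sum_mono)
      fix y assume y: "y \<in> ?C"
      have "pmf Y y * (\<Sum>t\<in>T. (cmod (v y t))\<^sup>2) \<le> 2 powr (- k2) * Q"
        using Y v[OF y] by (intro mult_mono) (auto simp: source_def sum_nonneg)
      then show "(pmf Y y)\<^sup>2 * (\<Sum>t\<in>T. (cmod (v y t))\<^sup>2) \<le> pmf Y y * (2 powr (- k2) * Q)"
        unfolding power2_eq_square mult.assoc by (intro mult_left_mono) auto
    qed auto
    also have "\<dots> = 2 ^ n * (2 powr (- k2) * Q)"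
      using source_sum[OF Y] by (simp flip: sum_distrib_right)
    also have "2 powr (- k1) * (2 ^ n * (2 powr (- k2) * Q)) = 2 powr (real n - k1 - k2) * Q"
      by (simp add: powr_add powr_diff powr_minus powr_realpow field_simps)
    finally show ?thesis
      by (simp add: mult_left_mono)
  qed
  have P0: "0 \<le> 2 ^ m * P"
    using \<alpha>_bound by (rule order_trans[rotated]) (simp add: sum_nonneg)
  have "(cmod (\<Sum>i\<in>?I. \<alpha> i * \<beta> i))\<^sup>2 \<le> 2 ^ m * P * (2 powr (real n - k1 - k2) * Q)"
    using P0 by (intro order_trans[OF cmod_sum_mult_le] mult_mono \<alpha>_bound \<beta>_bound sum_nonneg) auto
  then show ?thesis
    unfolding split by (simp add: sum.cartesian_product')
qed

text \<open>Both |e><e| - 1/M and |k><k| are diagonal, so their pairing with \<open>G\<close> sees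
  only its diagonal blocks.\<close>

lemma sum_ket_index:
  fixes G :: "nat \<Rightarrow> nat \<Rightarrow> nat \<Rightarrow> nat \<Rightarrow> complex" and e M k W :: nat
  assumes e: "e < M" and k: "k < W"
  shows "(\<Sum>z<M. \<Sum>w<W. \<Sum>z'<M. \<Sum>w'<W.
      (of_bool (e = z) * of_bool (e = z') - of_bool (z = z') / of_nat M) *
      (of_bool (k = w) * of_bool (k = w')) * G z w z' w')
    = (\<Sum>z<M. (of_bool (e = z) - 1 / of_nat M) * G z k z k)"
proof -
  have "(\<Sum>z<M. \<Sum>w<W. \<Sum>z'<M. \<Sum>w'<W.
      (of_bool (e = z) * of_bool (e = z') - of_bool (z = z') / of_nat M) *
      (of_bool (k = w) * of_bool (k = w')) * G z w z' w')
    = (\<Sum>w<W. \<Sum>w'<W. of_bool (k = w) * of_bool (k = w') * (\<Sum>z<M. \<Sum>z'<M.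
      (of_bool (e = z) * of_bool (e = z') - of_bool (z = z') / of_nat M) * G z w z' w'))"
    unfolding sum_distrib_left sum.cartesian_product
    by (rule sum.reindex_bij_witness[of _ "\<lambda>(w, w', z, z'). (z, w, z', w')" "\<lambda>(z, w, z', w'). (w, w', z, z')"])
      (auto simp: ac_simps)
  also have "\<dots> = (\<Sum>z<M. \<Sum>z'<M.
      (of_bool (e = z) * of_bool (e = z') - of_bool (z = z') / of_nat M) * G z k z' k)"
    by (rule sum_delta_pair[OF k k])
  also have "\<dots> = (\<Sum>z<M. (of_bool (e = z) - 1 / of_nat M) * G z k z k)"
  proof (rule sum.cong[OF refl])
    fix z assume z: "z \<in> {..<M}"
    have "(\<Sum>z'<M. (of_bool (e = z) * of_bool (e = z') - of_bool (z = z') / of_nat M) * G z k z' k)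
        = (\<Sum>z'<M. if z' = z then (of_bool (e = z) - 1 / of_nat M) * G z k z k else
            if z' = e then of_bool (e = z) * G z k z' k else 0)"
      by (intro sum.cong refl) auto
    also have "\<dots> = (\<Sum>z'<M. if z' = z then (of_bool (e = z) - 1 / of_nat M) * G z k z k else 0)"
      by (intro sum.cong refl) auto
    also have "\<dots> = (of_bool (e = z) - 1 / of_nat M) * G z k z k"
      using z by simp
    finally show "(\<Sum>z'<M. (of_bool (e = z) * of_bool (e = z') - of_bool (z = z') / of_nat M) * G z k z' k)
        = (of_bool (e = z) - 1 / of_nat M) * G z k z k" .
  qed
  finally show ?thesis .
qed

text \<open>The optimal observable enters only through its blocks at a fixed output \<open>z\<close>
  and a fixed \<open>x\<close>. Each block is a contraction on the storage, so
  \<open>storage_factors\<close> supplies a vector \<open>u x z\<close> for it, and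
  \<open>deor_weighted_bound\<close> takes over.\<close>

lemma deor_trace_norm_bound:
  assumes A: "deor_matrices n m A" and X: "source n k1 X" and Y: "source n k2 Y"
    and \<rho>: "storage_factors n L P Q \<rho> T v"
  defines "d \<equiv> L * 2 ^ n" and "I \<equiv> carrier_vec n \<times> carrier_vec n"
    and "p \<equiv> (\<lambda>x y. complex_of_real (pmf X x * pmf Y y))"
  shows "(2 * trace_norm
      (msum (2 ^ m * d) (2 ^ m * d)
         (\<lambda>(x, y). p x y \<cdot>\<^sub>m (ketbra (deor_extractor m A x y) \<otimes>\<^sub>m \<rho> x y \<otimes>\<^sub>m ketbra x)) I
       - maximally_mixed m \<otimes>\<^sub>m msum d d (\<lambda>(x, y). p x y \<cdot>\<^sub>m (\<rho> x y \<otimes>\<^sub>m ketbra x)) I))\<^sup>2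
    \<le> 2 ^ m * P * (2 powr (real n - k1 - k2) * Q)"
proof -
  let ?C = "carrier_vec n :: bit vec set"
  let ?M = "2 ^ m :: nat" and ?W = "2 ^ n :: nat"
  let ?E = "deor_extractor m A"
  define N where "N = ?M * d"
  define D where "D = msum N N
         (\<lambda>(x, y). p x y \<cdot>\<^sub>m (ketbra (?E x y) \<otimes>\<^sub>m \<rho> x y \<otimes>\<^sub>m ketbra x)) I
       - maximally_mixed m \<otimes>\<^sub>m msum d d (\<lambda>(x, y). p x y \<cdot>\<^sub>m (\<rho> x y \<otimes>\<^sub>m ketbra x)) I"
  \<comment> \<open>Position of a basis vector of the full space, with registers in the order
    output, storage, copy of \<open>x\<close>.\<close>
  define ix where "ix z s w = z * d + (s * ?W + w)" for z s w
  \<comment> \<open>The entry of (|E x y><E x y| - maximally mixed) tensored with |x><x|: everything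
    in the difference except the weight and the stored state.\<close>
  define \<kappa> where "\<kappa> x y z w z' w' =
      (of_bool (bits_index (?E x y) = z) * of_bool (bits_index (?E x y) = z') - of_bool (z = z') / of_nat ?M) *
      (of_bool (bits_index x = w) * of_bool (bits_index x = w') :: complex)" for x y z w z' w'
  have herm: "hermitian_mat L (\<rho> x y)" if "x \<in> ?C" "y \<in> ?C" for x y
    using \<rho> that by (simp add: storage_factors_def)
  have car: "\<rho> x y \<in> carrier_mat L L" if "x \<in> ?C" "y \<in> ?C" for x y
    using herm[OF that] by (simp add: hermitian_mat_def)
  have ket: "ketbra x \<in> carrier_mat ?W ?W" if "x \<in> ?C" for x
    using that by (simp add: ketbra_def)
  have ketE: "ketbra (?E x y) \<in> carrier_mat ?M ?M" for x y
    unfolding ketbra_def carrier_vecD[OF deor_extractor_carrier] by (rule mat_unit_carrier)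
  have mm: "maximally_mixed m \<in> carrier_mat ?M ?M"
    by (simp add: maximally_mixed_def)
  have ket_index: "ketbra x $$ (w, w') = of_bool (bits_index x = w) * of_bool (bits_index x = w')"
    if "x \<in> carrier_vec l" "w < 2 ^ l" "w' < 2 ^ l" for x l w w'
    using that by (auto simp: ketbra_def mat_unit_def)
  have Dcar: "D \<in> carrier_mat N N"
    unfolding D_def N_def using mm by (intro minus_carrier_mat kronecker_carrier) auto
  have ix: "ix z s w < N" "s * ?W + w < d" if "z < ?M" "s < L" "w < ?W" for z s w
    using that by (auto simp: ix_def N_def d_def intro!: index_less_mult)
  have D_entry: "D $$ (ix z s w, ix z' s' w')
      = (\<Sum>x\<in>?C. \<Sum>y\<in>?C. p x y * (\<kappa> x y z w z' w' * \<rho> x y $$ (s, s')))"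
    if b: "z < ?M" "s < L" "w < ?W" "z' < ?M" "s' < L" "w' < ?W" for z s w z' s' w'
  proof -
    have inner: "(\<rho> x y \<otimes>\<^sub>m ketbra x) $$ (s * ?W + w, s' * ?W + w')
        = \<rho> x y $$ (s, s') * (of_bool (bits_index x = w) * of_bool (bits_index x = w'))"
      and inner_car: "\<rho> x y \<otimes>\<^sub>m ketbra x \<in> carrier_mat d d"
      if xy: "x \<in> ?C" "y \<in> ?C" for x y
      using kronecker_index[OF car[OF xy] ket[OF xy(1)] b(2,5,3,6)] ket_index[OF xy(1) b(3,6)]
        kronecker_carrier[OF car[OF xy] ket[OF xy(1)]] by (simp_all add: d_def)
    have outer: "(ketbra (?E x y) \<otimes>\<^sub>m \<rho> x y \<otimes>\<^sub>m ketbra x) $$ (ix z s w, ix z' s' w')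
        = of_bool (bits_index (?E x y) = z) * of_bool (bits_index (?E x y) = z') *
          (\<rho> x y $$ (s, s') * (of_bool (bits_index x = w) * of_bool (bits_index x = w')))"
      and outer_car: "ketbra (?E x y) \<otimes>\<^sub>m \<rho> x y \<otimes>\<^sub>m ketbra x \<in> carrier_mat N N"
      if xy: "x \<in> ?C" "y \<in> ?C" for x y
      using kronecker_index[OF ketE inner_car[OF xy] b(1,4) ix(2)[OF b(1-3)] ix(2)[OF b(4-6)]]
        ket_index[OF deor_extractor_carrier b(1,4)] kronecker_carrier[OF ketE inner_car[OF xy]]
      unfolding inner[OF xy] by (simp_all only: ix_def N_def)
    have "msum N N (\<lambda>(x, y). p x y \<cdot>\<^sub>m (ketbra (?E x y) \<otimes>\<^sub>m \<rho> x y \<otimes>\<^sub>m ketbra x)) I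
          $$ (ix z s w, ix z' s' w')
        = (\<Sum>x\<in>?C. \<Sum>y\<in>?C. p x y * (of_bool (bits_index (?E x y) = z) * of_bool (bits_index (?E x y) = z') *
          (\<rho> x y $$ (s, s') * (of_bool (bits_index x = w) * of_bool (bits_index x = w')))))"
      unfolding msum_index[OF ix(1)[OF b(1-3)] ix(1)[OF b(4-6)]] I_def sum.cartesian_product' prod.case
    proof (intro sum.cong refl)
      fix x y :: "bit vec" assume xy: "x \<in> ?C" "y \<in> ?C"
      show "(p x y \<cdot>\<^sub>m (ketbra (?E x y) \<otimes>\<^sub>m \<rho> x y \<otimes>\<^sub>m ketbra x)) $$ (ix z s w, ix z' s' w')
        = p x y * (of_bool (bits_index (?E x y) = z) * of_bool (bits_index (?E x y) = z') *
          (\<rho> x y $$ (s, s') * (of_bool (bits_index x = w) * of_bool (bits_index x = w'))))"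
        unfolding outer[OF xy, symmetric]
        using outer_car[OF xy] ix(1)[OF b(1-3)] ix(1)[OF b(4-6)] by (intro index_smult_mat) auto
    qed
    moreover have "(maximally_mixed m \<otimes>\<^sub>m msum d d (\<lambda>(x, y). p x y \<cdot>\<^sub>m (\<rho> x y \<otimes>\<^sub>m ketbra x)) I)
          $$ (ix z s w, ix z' s' w')
        = of_bool (z = z') / of_nat ?M * (\<Sum>x\<in>?C. \<Sum>y\<in>?C. p x y *
          (\<rho> x y $$ (s, s') * (of_bool (bits_index x = w) * of_bool (bits_index x = w'))))"
    proof -
      have "msum d d (\<lambda>(x, y). p x y \<cdot>\<^sub>m (\<rho> x y \<otimes>\<^sub>m ketbra x)) I $$ (s * ?W + w, s' * ?W + w')
        = (\<Sum>x\<in>?C. \<Sum>y\<in>?C. p x y *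
          (\<rho> x y $$ (s, s') * (of_bool (bits_index x = w) * of_bool (bits_index x = w'))))"
        unfolding msum_index[OF ix(2)[OF b(1-3)] ix(2)[OF b(4-6)]] I_def sum.cartesian_product' prod.case
      proof (intro sum.cong refl)
        fix x y :: "bit vec" assume xy: "x \<in> ?C" "y \<in> ?C"
        show "(p x y \<cdot>\<^sub>m (\<rho> x y \<otimes>\<^sub>m ketbra x)) $$ (s * ?W + w, s' * ?W + w')
          = p x y * (\<rho> x y $$ (s, s') * (of_bool (bits_index x = w) * of_bool (bits_index x = w')))"
          unfolding inner[OF xy, symmetric]
          using inner_car[OF xy] ix(2)[OF b(1-3)] ix(2)[OF b(4-6)] by (intro index_smult_mat) auto
      qed
      moreover have "maximally_mixed m $$ (z, z') = of_bool (z = z') / of_nat ?M"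
        using b by (simp add: maximally_mixed_def)
      ultimately show ?thesis
        unfolding ix_def
        by (subst kronecker_index[OF mm msum_carrier b(1,4) ix(2)[OF b(1-3)] ix(2)[OF b(4-6)]]) simp
    qed
    moreover have "maximally_mixed m \<otimes>\<^sub>m msum d d (\<lambda>(x, y). p x y \<cdot>\<^sub>m (\<rho> x y \<otimes>\<^sub>m ketbra x)) I \<in> carrier_mat N N"
      unfolding N_def by (intro kronecker_carrier mm msum_carrier)
    ultimately show ?thesis
      using ix(1)[OF b(1-3)] ix(1)[OF b(4-6)]
      by (simp add: D_def \<kappa>_def sum_distrib_left left_diff_distrib right_diff_distrib sum_subtractf ac_simps)
  qed
  have split_N: "\<exists>z s w. i = ix z s w \<and> z < ?M \<and> s < L \<and> w < ?W" if "i < N" for i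
  proof -
    from that obtain z r where z: "z < ?M" "r < d" "i = z * d + r"
      unfolding N_def by (rule nat_lessE_mult)
    from z(2) obtain s w where "s < L" "w < ?W" "r = s * ?W + w"
      unfolding d_def by (rule nat_lessE_mult)
    with z show ?thesis
      by (auto simp: ix_def)
  qed
  have D: "hermitian_mat N D"
    unfolding hermitian_mat_def
  proof (intro conjI allI impI Dcar)
    fix i j assume "i < N" "j < N"
    then obtain z s w z' s' w' where i: "i = ix z s w" "z < ?M" "s < L" "w < ?W"
      and j: "j = ix z' s' w'" "z' < ?M" "s' < L" "w' < ?W"
      using split_N by metis
    have "cnj (D $$ (i, j)) = (\<Sum>x\<in>?C. \<Sum>y\<in>?C. cnj (p x y) * (cnj (\<kappa> x y z w z' w') * cnj (\<rho> x y $$ (s, s'))))"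
      unfolding i(1) j(1) D_entry[OF i(2-4) j(2-4)] by simp
    also have "\<dots> = (\<Sum>x\<in>?C. \<Sum>y\<in>?C. p x y * (\<kappa> x y z' w' z w * \<rho> x y $$ (s', s)))"
    proof (intro sum.cong refl)
      fix x y :: "bit vec" assume xy: "x \<in> ?C" "y \<in> ?C"
      have "cnj (\<rho> x y $$ (s, s')) = \<rho> x y $$ (s', s)"
        by (rule hermitian_mat_cnj[OF herm[OF xy] i(3) j(3)])
      moreover have "cnj (\<kappa> x y z w z' w') = \<kappa> x y z' w' z w"
        by (auto simp: \<kappa>_def)
      ultimately show "cnj (p x y) * (cnj (\<kappa> x y z w z' w') * cnj (\<rho> x y $$ (s, s')))
          = p x y * (\<kappa> x y z' w' z w * \<rho> x y $$ (s', s))"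
        by (simp add: p_def)
    qed
    also have "\<dots> = D $$ (j, i)"
      unfolding i(1) j(1) D_entry[OF j(2-4) i(2-4)] ..
    finally show "D $$ (j, i) = cnj (D $$ (i, j))" ..
  qed
  obtain S where S: "contraction {..<N} {..<N} S"
    and tn: "trace_norm D = 1 / 2 * Re (\<Sum>i<N. \<Sum>j<N. D $$ (i, j) * S j i)"
    by (rule trace_norm_hermitian[OF D])
  define S' where "S' x z = (\<lambda>s' s. S (ix z s' (bits_index x)) (ix z s (bits_index x)))" for x z
  have S': "contraction {..<L} {..<L} (S' x z)" if x: "x \<in> ?C" and z: "z < ?M" for x z
  proof -
    have inj: "inj_on (\<lambda>s. ix z s (bits_index x)) {..<L}"
      by (rule inj_onI) (simp add: ix_def)
    have sub: "(\<lambda>s. ix z s (bits_index x)) ` {..<L} \<subseteq> {..<N}"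
      using ix(1)[OF z] bits_index_less[OF x] by auto
    show ?thesis
      unfolding S'_def by (rule contraction_reindex[OF S _ _ inj sub inj sub]) auto
  qed
  have factor: "\<forall>x\<in>?C. \<forall>S. contraction {..<L} {..<L} S \<longrightarrow> (\<exists>u. (\<Sum>t\<in>T. (cmod (u t))\<^sup>2) \<le> P \<and>
      (\<forall>y\<in>?C. (\<Sum>s<L. \<Sum>s'<L. \<rho> x y $$ (s, s') * S s' s) = (\<Sum>t\<in>T. u t * v y t)))"
    using \<rho> unfolding storage_factors_def by (elim conjE)
  define U where "U x z u \<longleftrightarrow> (\<Sum>t\<in>T. (cmod (u t))\<^sup>2) \<le> P \<and>
      (\<forall>y\<in>?C. (\<Sum>s<L. \<Sum>s'<L. \<rho> x y $$ (s, s') * S' x z s' s) = (\<Sum>t\<in>T. u t * v y t))" for x z u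
  \<comment> \<open>The vector must be chosen from \<open>x\<close> and \<open>z\<close> alone,
    before \<open>y\<close> is fixed; this is why the quantifier over \<open>y\<close> stands inside
    the existential in \<open>storage_factors\<close>.\<close>
  define u where "u x z = (SOME u. U x z u)" for x z
  have ex: "\<exists>u. U x z u" if "x \<in> ?C" "z < ?M" for x z
    unfolding U_def by (rule factor[rule_format, OF that(1) S'[OF that]])
  have U: "U x z (u x z)" if "x \<in> ?C" "z < ?M" for x z
    unfolding u_def by (rule someI_ex[OF ex[OF that]])
  have u: "(\<Sum>t\<in>T. (cmod (u x z t))\<^sup>2) \<le> P" if "x \<in> ?C" "z < ?M" for x z
    using U[OF that] by (simp add: U_def)
  have uv: "(\<Sum>s<L. \<Sum>s'<L. \<rho> x y $$ (s, s') * S' x z s' s) = (\<Sum>t\<in>T. u x z t * v y t)"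
    if "x \<in> ?C" "z < ?M" "y \<in> ?C" for x z y
    using U[OF that(1,2)] that(3) by (simp add: U_def)
  have "(\<Sum>i<N. \<Sum>j<N. D $$ (i, j) * S j i)
      = (\<Sum>z<?M. \<Sum>s<L. \<Sum>w<?W. \<Sum>z'<?M. \<Sum>s'<L. \<Sum>w'<?W.
          D $$ (ix z s w, ix z' s' w') * S (ix z' s' w') (ix z s w))"
    unfolding N_def d_def sum_lessThan_mult ix_def ..
  also have "\<dots> = (\<Sum>z<?M. \<Sum>s<L. \<Sum>w<?W. \<Sum>z'<?M. \<Sum>s'<L. \<Sum>w'<?W. \<Sum>x\<in>?C. \<Sum>y\<in>?C.
          p x y * (\<kappa> x y z w z' w' * \<rho> x y $$ (s, s')) * S (ix z' s' w') (ix z s w))"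
    by (intro sum.cong refl) (simp only: D_entry lessThan_iff sum_distrib_right)
  also have "\<dots> = (\<Sum>x\<in>?C. \<Sum>y\<in>?C. \<Sum>z<?M. \<Sum>w<?W. \<Sum>z'<?M. \<Sum>w'<?W. \<Sum>s<L. \<Sum>s'<L.
          \<kappa> x y z w z' w' * (p x y * (\<rho> x y $$ (s, s') * S (ix z' s' w') (ix z s w))))"
    unfolding sum.cartesian_product
    by (rule sum.reindex_bij_witness[of _ "\<lambda>(x, y, z, w, z', w', s, s'). (z, s, w, z', s', w', x, y)"
          "\<lambda>(z, s, w, z', s', w', x, y). (x, y, z, w, z', w', s, s')"]) (auto simp: ac_simps)
  also have "\<dots> = (\<Sum>x\<in>?C. \<Sum>y\<in>?C. \<Sum>z<?M. \<Sum>w<?W. \<Sum>z'<?M. \<Sum>w'<?W.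
          \<kappa> x y z w z' w' * (p x y * (\<Sum>s<L. \<Sum>s'<L. \<rho> x y $$ (s, s') * S (ix z' s' w') (ix z s w))))"
    unfolding sum_distrib_left ..
  also have "\<dots> = (\<Sum>x\<in>?C. \<Sum>y\<in>?C. \<Sum>z<?M. (of_bool (bits_index (?E x y) = z) - 1 / of_nat ?M) *
          (p x y * (\<Sum>s<L. \<Sum>s'<L. \<rho> x y $$ (s, s') * S (ix z s' (bits_index x)) (ix z s (bits_index x)))))"
    unfolding \<kappa>_def by (intro sum.cong refl sum_ket_index bits_index_less) auto
  also have "\<dots> = (\<Sum>x\<in>?C. \<Sum>y\<in>?C. \<Sum>z<?M.
      of_real (pmf X x * pmf Y y * deor_bias m A x y z) * (\<Sum>t\<in>T. u x z t * v y t))"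
  proof (intro sum.cong refl)
    fix x y z assume "x \<in> ?C" "y \<in> ?C" "z \<in> {..<?M}"
    then have *: "(\<Sum>s<L. \<Sum>s'<L. \<rho> x y $$ (s, s') * S (ix z s' (bits_index x)) (ix z s (bits_index x)))
        = (\<Sum>t\<in>T. u x z t * v y t)"
      using uv[of x z y] by (simp add: S'_def)
    show "(of_bool (bits_index (?E x y) = z) - 1 / of_nat ?M) *
          (p x y * (\<Sum>s<L. \<Sum>s'<L. \<rho> x y $$ (s, s') * S (ix z s' (bits_index x)) (ix z s (bits_index x))))
        = of_real (pmf X x * pmf Y y * deor_bias m A x y z) * (\<Sum>t\<in>T. u x z t * v y t)"
      unfolding * by (simp add: p_def deor_bias_def)
  qed
  also have "\<dots> = (\<Sum>x\<in>?C. \<Sum>z<?M. \<Sum>y\<in>?C.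
      of_real (pmf X x * pmf Y y * deor_bias m A x y z) * (\<Sum>t\<in>T. u x z t * v y t))"
    by (rule sum.cong[OF refl], rule sum.swap)
  finally have tr: "(\<Sum>i<N. \<Sum>j<N. D $$ (i, j) * S j i) = (\<Sum>x\<in>?C. \<Sum>z<?M. \<Sum>y\<in>?C.
      of_real (pmf X x * pmf Y y * deor_bias m A x y z) * (\<Sum>t\<in>T. u x z t * v y t))" .
  have "(2 * trace_norm D)\<^sup>2 = (Re (\<Sum>i<N. \<Sum>j<N. D $$ (i, j) * S j i))\<^sup>2"
    by (simp add: tn)
  also have "\<dots> \<le> (cmod (\<Sum>i<N. \<Sum>j<N. D $$ (i, j) * S j i))\<^sup>2"
    unfolding cmod_power2 by simp
  also have "\<dots> \<le> 2 ^ m * P * (2 powr (real n - k1 - k2) * Q)"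
    unfolding tr using \<rho>
    by (intro deor_weighted_bound[OF A X Y] u) (auto simp: storage_factors_def)
  finally show ?thesis
    unfolding D_def N_def .
qed

text \<open>The two storage models differ only in the product \<open>P * Q\<close>; \<open>r\<close>
  is the resulting charge in qubits, namely \<open>2 * real b2\<close> for entangled and
  \<open>real b2\<close> for product storage.\<close>

lemma x_strong_extractor_deor:
  assumes A: "deor_matrices n m A" and \<epsilon>: "0 < \<epsilon>"
    and storage: "\<And>\<rho>. storage n b1 b2 \<rho> \<Longrightarrow>
      \<exists>(T :: 't set) v. storage_factors n (2 ^ b1 * 2 ^ b2) P Q \<rho> T v"
    and PQ: "0 \<le> P * Q" "P * Q \<le> 2 powr r"
    and k: "k1 + k2 - r \<ge> 2 * real m + real n - 2 + 2 * log 2 (1 / \<epsilon>)"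
  shows "x_strong_extractor storage b1 b2 n m k1 k2 \<epsilon> (deor_extractor m A)"
  unfolding x_strong_extractor_def Let_def
proof (intro conjI ballI allI impI)
  fix X Y \<rho> assume X: "source n k1 X" and Y: "source n k2 Y" and \<rho>: "storage n b1 b2 \<rho>"
  obtain T :: "'t set" and v where "storage_factors n (2 ^ (b1 + b2)) P Q \<rho> T v"
    using storage[OF \<rho>] by (auto simp: power_add)
  note bound = deor_trace_norm_bound[OF A X Y this]
  let ?t = "trace_norm (msum (2 ^ m * (2 ^ (b1 + b2) * 2 ^ n)) (2 ^ m * (2 ^ (b1 + b2) * 2 ^ n))
      (\<lambda>(x, y). complex_of_real (pmf X x * pmf Y y) \<cdot>\<^sub>m
        (ketbra (deor_extractor m A x y) \<otimes>\<^sub>m \<rho> x y \<otimes>\<^sub>m ketbra x)) (carrier_vec n \<times> carrier_vec n)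
      - maximally_mixed m \<otimes>\<^sub>m
        msum (2 ^ (b1 + b2) * 2 ^ n) (2 ^ (b1 + b2) * 2 ^ n)
          (\<lambda>(x, y). complex_of_real (pmf X x * pmf Y y) \<cdot>\<^sub>m (\<rho> x y \<otimes>\<^sub>m ketbra x))
          (carrier_vec n \<times> carrier_vec n))"
  have "(2 * ?t)\<^sup>2 \<le> 2 ^ m * P * (2 powr (real n - k1 - k2) * Q)"
    by (rule bound)
  also have "\<dots> = 2 powr (real m + real n - k1 - k2) * (P * Q)"
    by (simp add: powr_add powr_diff powr_realpow field_simps)
  also have "\<dots> \<le> 2 powr (real m + real n - k1 - k2) * 2 powr r"
    using PQ by (intro mult_left_mono) auto
  also have "\<dots> = 2 powr (real m + real n - k1 - k2 + r)"
    by (simp add: powr_add)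
  \<comment> \<open>The summand 2 is the \<open>- 2\<close> of the hypothesis. It becomes the factor
    4 in \<open>(2 * \<epsilon>)\<^sup>2\<close> and so reflects the normalising factor 1/2 of the
    trace norm.\<close>
  also have "\<dots> \<le> 2 powr (2 + 2 * log 2 \<epsilon>)"
  proof (rule powr_mono)
    have "log 2 (1 / \<epsilon>) = - log 2 \<epsilon>"
      using \<epsilon> by (simp add: log_divide)
    then show "real m + real n - k1 - k2 + r \<le> 2 + 2 * log 2 \<epsilon>"
      using k by simp
  qed simp
  also have "\<dots> = (2 * \<epsilon>)\<^sup>2"
  proof -
    have "2 powr (2 * log 2 \<epsilon>) = (2 powr log 2 \<epsilon>) powr 2"
      by (simp add: powr_powr mult.commute)
    then show ?thesis
      using \<epsilon> by (simp add: powr_add power_mult_distrib)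
  qed
  finally show "?t \<le> \<epsilon>"
    using \<epsilon> by (simp add: abs_le_square_iff[symmetric])
qed simp

theorem lemma19:
  fixes n m b1 b2 :: nat and k1 k2 \<epsilon> :: real and A :: "nat \<Rightarrow> bit mat"
  assumes "0 < m" and "m \<le> n" and "0 < \<epsilon>"
    and "deor_matrices n m A"
  shows "(k1 + k2 - 2 * real b2 \<ge> 2 * real m + real n - 2 + 2 * log 2 (1 / \<epsilon>) \<longrightarrow>
            x_strong_extractor entangled_storage b1 b2 n m k1 k2 \<epsilon> (deor_extractor m A)) \<and>
         (k1 + k2 - real b2 \<ge> 2 * real m + real n - 2 + 2 * log 2 (1 / \<epsilon>) \<longrightarrow>
            x_strong_extractor nonentangled_storage b1 b2 n m k1 k2 \<epsilon> (deor_extractor m A))"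
proof (intro conjI impI)
  assume k: "k1 + k2 - 2 * real b2 \<ge> 2 * real m + real n - 2 + 2 * log 2 (1 / \<epsilon>)"
  show "x_strong_extractor entangled_storage b1 b2 n m k1 k2 \<epsilon> (deor_extractor m A)"
  proof (rule x_strong_extractor_deor[OF assms(4,3) entangled_storage_factors _ _ k])
    have "(2::real) ^ b2 * 2 ^ b2 = 2 powr (2 * real b2)"
      by (simp only: mult_2 powr_add) (simp add: powr_realpow)
    then show "(2::real) ^ b2 * 2 ^ b2 \<le> 2 powr (2 * real b2)" by simp
  qed simp_all
next
  assume k: "k1 + k2 - real b2 \<ge> 2 * real m + real n - 2 + 2 * log 2 (1 / \<epsilon>)"
  have "\<exists>(T :: (nat \<times> nat) set) v. storage_factors n (2 ^ b1 * 2 ^ b2) (2 ^ b2) 1 \<rho> T v"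
    if "nonentangled_storage n b1 b2 \<rho>" for \<rho>
    using nonentangled_storage_factors[OF that] by blast
  then show "x_strong_extractor nonentangled_storage b1 b2 n m k1 k2 \<epsilon> (deor_extractor m A)"
    by (rule x_strong_extractor_deor[OF assms(4,3) _ _ _ k]) (simp_all add: powr_realpow)
qed

end
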